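(* Assume that there exists an interpolation basis $\{S^\phi(x-k)\}_{k\in\mathbb{Z}}$ relative to the samples $\{f_s(k)\}_{k\in\mathbb{Z}}$ in $V_0$, and that there exist two constants $A_s,B_s$ with $0<A_s\le B_s<+\infty$ such that, for $z=e^{-iw/2}$ and all $w$, $$A_s\le |PE_s(w)|^2=\left|\overline{P_s(-z)}\,E_s(-z)+\overline{P_s(z)}\,E_s(z)\right|^2\le B_s .$$ Let $j\in\mathbb{Z}$. Then, for any given sequence $\{F_k\}_{k\in\mathbb{Z}}\in l^2$, there exists a unique element $f_s\in W_{j-1}$ such that $$\tilde T_{W_{j-1}}(f_s)=\left\{f_s\!\left(\frac{2k+1}{2^j}\right)\right\}_{k\in\mathbb{Z}}=\{F_k\}_{k\in\mathbb{Z}} .$$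
   Context: Fourier transform: $\hat f(w)=\int_{-\infty}^{+\infty}f(x)e^{-iwx}\,dx$. Throughout $z=e^{-iw/2}$, so replacing $w$ by $w+2\pi$ replaces $z$ by $-z$. $l^2$ denotes square-summable sequences indexed by $\mathbb{Z}$. $\{V_j\}_{j\in\mathbb{Z}}$ is a multiresolution analysis of $L^2(\mathbb{R})$ (nested closed subspaces $V_j\subset V_{j+1}$, $f(x)\in V_j\iff f(2x)\in V_{j+1}$, $\overline{\bigcup_j V_j}=L^2(\mathbb{R})$, $\bigcap_j V_j=\{0\}$) with a real scaling function $\phi$, i.e. $\{\phi(x-k)\}_{k\in\mathbb{Z}}$ is a Riesz basis of $V_0$. The wavelet space $W_j$ is the orthogonal complement of $V_j$ in $V_{j+1}$, so $V_{j+1}=V_j\oplus W_j$. The spaces $V_j$ and $W_j$ are regarded as reproducing kernel Hilbert spaces of functions, so that point values make sense. Standing assumption: the series $\sum_{k}\phi(k/2)e^{-iwk/2}$ and $\sum_k\hat\phi(w+4k\pi)$ converge pointwise everywhere, and the Poisson summation identity $\frac12\sum_k\phi(k/2)e^{-iwk/2}=\sum_k\hat\phi(w+4k\pi)$ holds. Interpolation basis of $V_0$ relative to the samples $\{f_s(k)\}_k$: a Riesz basis $\{S^\phi(x-k)\}_{k\in\mathbb{Z}}$ of $V_0$ such that $f_s(x)=\sum_{k}f_s(k)S^\phi(x-k)$ for every $f_s\in V_0$. Its generator satisfies $\hat S^\phi(w)=\hat\phi(w)/\sum_k\phi(k)e^{-iwk}=\hat\phi(w)/\sum_k\hat\phi(w+2k\pi)$,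 where $1/\sum_k\hat\phi(w+2k\pi)\in L^2[0,2\pi]$. Definitions: $P_s(z)=\frac12\sum_{k}S^\phi(k/2)z^k=\sum_{k}\hat S^\phi(w+4k\pi)$; $E_s(z)=E_s(e^{-iw/2})=\sum_{k}\left|\hat S^\phi\left(\frac w2+2k\pi\right)\right|^2$; $PE_s(w)=\overline{P_s(-z)}E_s(-z)+\overline{P_s(z)}E_s(z)$; $\tilde T_{W_{j-1}}(f_s)=\{f_s(k/2^{j-1}+1/2^j)\}_{k\in\mathbb{Z}}$ for $f_s\in W_{j-1}$. *)

theory Defs
  imports "HOL-Analysis.Analysis"
begin

section \<open>Square-integrable functions\<close>

text \<open>
  Elements of \<open>L\<^sup>2(\<real>)\<close> are represented by actual functions rather than by classes modulo
  almost-everywhere equality, because point values of the elements of the spaces \<open>V\<^sub>j\<close> and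
  \<open>W\<^sub>j\<close> are needed.
\<close>

definition L2 :: "(real \<Rightarrow> complex) set" where
  "L2 = {f. f \<in> borel_measurable lebesgue \<and> integrable lebesgue (\<lambda>x. (cmod (f x))\<^sup>2)}"

definition L2_norm :: "(real \<Rightarrow> complex) \<Rightarrow> real" where
  "L2_norm f = sqrt (integral\<^sup>L lebesgue (\<lambda>x. (cmod (f x))\<^sup>2))"

definition L2_inner :: "(real \<Rightarrow> complex) \<Rightarrow> (real \<Rightarrow> complex) \<Rightarrow> complex" where
  "L2_inner f g = integral\<^sup>L lebesgue (\<lambda>x. f x * cnj (g x))"

definition square_summable :: "(int \<Rightarrow> complex) \<Rightarrow> bool" where
  "square_summable c \<longleftrightarrow> (\<lambda>k. (cmod (c k))\<^sup>2) summable_on UNIV"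

text \<open>
  Pointwise convergence of a two-sided series is convergence of its symmetric partial sums.
  This is the weakest of the usual readings and does not require absolute convergence.
\<close>

definition bisums :: "(int \<Rightarrow> complex) \<Rightarrow> complex \<Rightarrow> bool" where
  "bisums a s \<longleftrightarrow> (\<lambda>N. \<Sum>k\<in>{- int N..int N}. a k) \<longlonglongrightarrow> s"

definition bisum :: "(int \<Rightarrow> complex) \<Rightarrow> complex" where
  "bisum a = (THE s. bisums a s)"

section \<open>Fourier transform\<close>

text \<open>
  \<open>F\<close> is a version of the Fourier transform of \<open>f \<in> L\<^sup>2(\<real>)\<close>: the integral
  of \<open>f x * exp (- i w x)\<close> over the line is the limit in the mean of the integrals over
  \<open>[-T, T]\<close>.  This determines \<open>F\<close> up to a null set.  It is a relation because pointwise
  conditions are imposed on \<open>F\<close>; for integrable \<open>f\<close> the usual Fourier integral is such a version.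
\<close>

definition fourier_transform :: "(real \<Rightarrow> complex) \<Rightarrow> (real \<Rightarrow> complex) \<Rightarrow> bool" where
  "fourier_transform f F \<longleftrightarrow> f \<in> L2 \<and> F \<in> L2 \<and>
     ((\<lambda>T. L2_norm (\<lambda>w. F w -
         set_lebesgue_integral lebesgue {-T..T} (\<lambda>x. f x * exp (- (\<i> * of_real (w * x))))))
       \<longlongrightarrow> 0) at_top"

section \<open>Multiresolution analysis\<close>

text \<open>
  A closed subspace of \<open>L\<^sup>2(\<real>)\<close> that is a reproducing kernel Hilbert space of functions, i.e.
  on which every point evaluation is a bounded functional.  Boundedness makes
  two members that agree almost everywhere equal.
\<close>

definition rkhs :: "(real \<Rightarrow> complex) set \<Rightarrow> bool" where
  "rkhs V \<longleftrightarrow>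
     V \<subseteq> L2 \<and> (\<lambda>x. 0) \<in> V \<and>
     (\<forall>f\<in>V. \<forall>g\<in>V. (\<lambda>x. f x + g x) \<in> V) \<and>
     (\<forall>c. \<forall>f\<in>V. (\<lambda>x. c * f x) \<in> V) \<and>
     (\<forall>g\<in>L2. (\<forall>e>0. \<exists>f\<in>V. L2_norm (\<lambda>x. g x - f x) < e)
        \<longrightarrow> (\<exists>f\<in>V. AE x in lebesgue. f x = g x)) \<and>
     (\<forall>x. \<exists>C. \<forall>f\<in>V. cmod (f x) \<le> C * L2_norm f)"

definition riesz_basis :: "(real \<Rightarrow> complex) set \<Rightarrow> (int \<Rightarrow> real \<Rightarrow> complex) \<Rightarrow> bool" where
  "riesz_basis V b \<longleftrightarrow>
     (\<forall>k. b k \<in> V) \<and>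
     (\<forall>f\<in>V. \<forall>e>0. \<exists>K c. finite K \<and> L2_norm (\<lambda>x. f x - (\<Sum>k\<in>K. c k * b k x)) < e) \<and>
     (\<exists>A>0. \<exists>B. \<forall>K c. finite K \<longrightarrow>
        A * (\<Sum>k\<in>K. (cmod (c k))\<^sup>2) \<le> (L2_norm (\<lambda>x. \<Sum>k\<in>K. c k * b k x))\<^sup>2 \<and>
        (L2_norm (\<lambda>x. \<Sum>k\<in>K. c k * b k x))\<^sup>2 \<le> B * (\<Sum>k\<in>K. (cmod (c k))\<^sup>2))"

definition translates :: "(real \<Rightarrow> complex) \<Rightarrow> int \<Rightarrow> real \<Rightarrow> complex" where
  "translates f k x = f (x - of_int k)"

definition multiresolution_analysis ::
    "(int \<Rightarrow> (real \<Rightarrow> complex) set) \<Rightarrow> (real \<Rightarrow> complex) \<Rightarrow> bool" where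
  "multiresolution_analysis V \<phi> \<longleftrightarrow>
     (\<forall>j. rkhs (V j)) \<and>
     (\<forall>j. V j \<subseteq> V (j + 1)) \<and>
     (\<forall>j f. f \<in> V j \<longleftrightarrow> (\<lambda>x. f (2 * x)) \<in> V (j + 1)) \<and>
     (\<forall>g\<in>L2. \<forall>e>0. \<exists>j. \<exists>f\<in>V j. L2_norm (\<lambda>x. g x - f x) < e) \<and>
     (\<Inter>j. V j) = {\<lambda>x. 0} \<and>
     (\<forall>x. \<phi> x \<in> \<real>) \<and>
     riesz_basis (V 0) (translates \<phi>)"

definition wavelet_space ::
    "(int \<Rightarrow> (real \<Rightarrow> complex) set) \<Rightarrow> int \<Rightarrow> (real \<Rightarrow> complex) set" where
  "wavelet_space V j = {f \<in> V (j + 1). \<forall>g\<in>V j. L2_inner f g = 0}"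

definition poisson_summation :: "(real \<Rightarrow> complex) \<Rightarrow> (real \<Rightarrow> complex) \<Rightarrow> bool" where
  "poisson_summation \<phi> \<phi>hat \<longleftrightarrow>
     (\<forall>w. \<exists>s t. bisums (\<lambda>k. \<phi> (of_int k / 2) * exp (- (\<i> * of_real (w * of_int k / 2)))) s \<and>
        bisums (\<lambda>k. \<phi>hat (w + 4 * of_int k * pi)) t \<and>
        1 / 2 * s = t)"

section \<open>Interpolation bases and their symbols\<close>

text \<open>
  The expansion converges unconditionally in the norm of \<open>V\<^sub>0\<close>, hence also pointwise.
\<close>

definition interpolation_basis ::
    "(int \<Rightarrow> (real \<Rightarrow> complex) set) \<Rightarrow> (real \<Rightarrow> complex) \<Rightarrow> bool" where
  "interpolation_basis V S \<longleftrightarrow>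
     riesz_basis (V 0) (translates S) \<and>
     (\<forall>f\<in>V 0. ((\<lambda>K. L2_norm (\<lambda>x. f x - (\<Sum>k\<in>K. f (of_int k) * translates S k x)))
        \<longlongrightarrow> 0) (finite_subsets_at_top UNIV))"

text \<open>
  The symbols are written as functions of \<open>w\<close>, where \<open>z = exp (- i w / 2)\<close>, so that \<open>- z\<close>
  corresponds to \<open>w + 2 \<pi>\<close>.  Here \<open>Shat\<close> is a version of the Fourier transform of the generator
  \<open>S\<close>.  Of the two expressions for \<open>P\<^sub>s\<close>, namely half the sum of \<open>S(k/2) z\<^sup>k\<close> and the
  periodization of \<open>Shat\<close>, the periodization is used, since its pointwise convergence follows
  (off a null set) from that of the periodization of the transform of the scaling function.
\<close>

definition P_symbol :: "(real \<Rightarrow> complex) \<Rightarrow> real \<Rightarrow> complex" where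
  "P_symbol Shat w = bisum (\<lambda>k. Shat (w + 4 * of_int k * pi))"

definition E_symbol :: "(real \<Rightarrow> complex) \<Rightarrow> real \<Rightarrow> real" where
  "E_symbol Shat w = (\<Sum>\<^sub>\<infinity>k::int. (cmod (Shat (w / 2 + 2 * of_int k * pi)))\<^sup>2)"

definition PE_symbol :: "(real \<Rightarrow> complex) \<Rightarrow> real \<Rightarrow> complex" where
  "PE_symbol Shat w =
     cnj (P_symbol Shat (w + 2 * pi)) * of_real (E_symbol Shat (w + 2 * pi)) +
     cnj (P_symbol Shat w) * of_real (E_symbol Shat w)"

definition wavelet_samples :: "int \<Rightarrow> (real \<Rightarrow> complex) \<Rightarrow> int \<Rightarrow> complex" where
  "wavelet_samples i f k = f (of_int k / 2 powi i + 1 / 2 powi (i + 1))"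

end

theory Submission
  imports Defs
begin

text \<open>
  A dilation by \<open>2^j\<close> reduces the claim to the samples at the odd integers of the elements of
  \<open>W\<^sub>-\<^sub>1 \<subseteq> V\<^sub>0\<close>.  An \<open>f \<in> V\<^sub>0\<close> is the series of its samples \<open>f n\<close> against \<open>S\<^sub>n x = S (x - n)\<close>, and it
  lies in \<open>W\<^sub>-\<^sub>1\<close> iff it is orthogonal to all \<open>\<sigma>\<^sub>k x = S (x / 2 - k)\<close>.  These equations determine the even
  samples from the odd ones as soon as the Laurent matrix of the inner products of \<open>S\<^sub>2\<^sub>m\<close> and
  \<open>\<sigma>\<^sub>k\<close> is invertible on \<open>l\<^sup>2\<close>.  By Plancherel, periodization and the refinement equation
  \<open>Shat w = P\<^sub>s w * Shat (w / 2)\<close> its symbol is \<open>PE\<^sub>s\<close>, which is bounded and bounded away from zero.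

  The refinement equation with the pointwise periodization \<open>P\<^sub>s\<close> comes from the scaling function:
  expanding \<open>\<phi>\<close> and \<open>\<phi> (x / 2)\<close> in the interpolation basis gives \<open>\<phi>hat = \<Phi> * Shat\<close> and
  \<open>2 * \<phi>hat w = s w * Shat (w / 2)\<close> with \<open>\<Phi> w\<close> and \<open>s w\<close> the sums of the samples of \<open>\<phi>\<close> at the
  integers and half-integers, and \<open>\<Phi>\<close> vanishes almost nowhere because the translates of \<open>\<phi>\<close> form a
  Riesz basis; Poisson summation then identifies \<open>s / (2 * \<Phi>)\<close> with \<open>P\<^sub>s\<close>.
\<close>

section \<open>The space \<open>L\<^sup>2\<close>\<close>

lemma L2_norm_nonneg [simp]: "0 \<le> L2_norm f"
  by (simp add: L2_norm_def)

lemma L2_norm_sq: "(L2_norm f)\<^sup>2 = (LINT x|lebesgue. (cmod (f x))\<^sup>2)"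
  by (simp add: L2_norm_def)

lemma L2_measurable: "f \<in> L2 \<Longrightarrow> f \<in> borel_measurable lebesgue"
  by (simp add: L2_def)

lemma L2_integrable_sq: "f \<in> L2 \<Longrightarrow> integrable lebesgue (\<lambda>x. (cmod (f x))\<^sup>2)"
  by (simp add: L2_def)

lemma L2_zero [simp]: "(\<lambda>x. 0) \<in> L2"
  by (simp add: L2_def)

lemma L2_norm_zero [simp]: "L2_norm (\<lambda>x. 0) = 0"
  by (simp add: L2_norm_def)

lemma two_mult_le_weighted_squares: "2 * (a * b) \<le> s * a\<^sup>2 + b\<^sup>2 / s" if "s > 0" for a b s :: real
proof -
  have "0 \<le> (s * a - b)\<^sup>2 / s" using that by simp
  also have "(s * a - b)\<^sup>2 / s = s * a\<^sup>2 + b\<^sup>2 / s - 2 * (a * b)"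
    using that by (simp add: power2_eq_square field_simps)
  finally show ?thesis by simp
qed

lemma L2_dominated:
  assumes "f \<in> borel_measurable lebesgue" "integrable lebesgue g"
    and "AE x in lebesgue. (cmod (f x))\<^sup>2 \<le> g x"
  shows "f \<in> L2"
proof -
  note assms(1)[measurable]
  have "integrable lebesgue (\<lambda>x. (cmod (f x))\<^sup>2)"
    by (rule Bochner_Integration.integrable_bound[OF assms(2)]) (use assms(3) in auto)
  then show ?thesis using assms(1) by (simp add: L2_def)
qed

lemma L2_add:
  assumes "f \<in> L2" "g \<in> L2"
  shows "(\<lambda>x. f x + g x) \<in> L2"
proof (rule L2_dominated)
  show "(\<lambda>x. f x + g x) \<in> borel_measurable lebesgue"
    using assms by (auto simp: L2_def)
  show "integrable lebesgue (\<lambda>x. 2 * (cmod (f x))\<^sup>2 + 2 * (cmod (g x))\<^sup>2)"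
    using assms by (auto simp: L2_def)
  show "AE x in lebesgue. (cmod (f x + g x))\<^sup>2 \<le> 2 * (cmod (f x))\<^sup>2 + 2 * (cmod (g x))\<^sup>2"
  proof (rule AE_I2)
    fix x
    have "(cmod (f x + g x))\<^sup>2 \<le> (cmod (f x) + cmod (g x))\<^sup>2"
      by (simp add: norm_triangle_ineq power_mono)
    also have "\<dots> \<le> 2 * (cmod (f x))\<^sup>2 + 2 * (cmod (g x))\<^sup>2"
      using sum_squares_bound[of "cmod (f x)" "cmod (g x)"] by (simp add: power2_sum)
    finally show "(cmod (f x + g x))\<^sup>2 \<le> 2 * (cmod (f x))\<^sup>2 + 2 * (cmod (g x))\<^sup>2" .
  qed
qed

lemma L2_mult_bounded:
  assumes f: "f \<in> L2" and m: "m \<in> borel_measurable lebesgue" and K: "\<And>x. cmod (m x) \<le> K"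
  shows "(\<lambda>x. m x * f x) \<in> L2" "L2_norm (\<lambda>x. m x * f x) \<le> K * L2_norm f"
proof -
  have K0: "0 \<le> K" using K[of 0] norm_ge_zero order_trans by blast
  have le: "(cmod (m x * f x))\<^sup>2 \<le> K\<^sup>2 * (cmod (f x))\<^sup>2" for x
    by (simp add: norm_mult power_mult_distrib mult_right_mono K power_mono)
  show mem: "(\<lambda>x. m x * f x) \<in> L2"
    by (rule L2_dominated[where g = "\<lambda>x. K\<^sup>2 * (cmod (f x))\<^sup>2"])
       (use f m le in \<open>auto simp: L2_def\<close>)
  have "(L2_norm (\<lambda>x. m x * f x))\<^sup>2 \<le> (LINT x|lebesgue. K\<^sup>2 * (cmod (f x))\<^sup>2)"
    unfolding L2_norm_sq
    by (intro integral_mono le integrable_mult_right L2_integrable_sq f mem)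
  also have "\<dots> = (K * L2_norm f)\<^sup>2"
    by (simp add: power_mult_distrib L2_norm_sq)
  finally show "L2_norm (\<lambda>x. m x * f x) \<le> K * L2_norm f"
    by (rule power2_le_imp_le) (simp add: K0)
qed

lemma L2_cmult: "f \<in> L2 \<Longrightarrow> (\<lambda>x. c * f x) \<in> L2"
  by (rule L2_mult_bounded(1)[where K = "cmod c"]) auto

lemma L2_norm_cmult: "L2_norm (\<lambda>x. c * f x) = cmod c * L2_norm f"
  by (simp add: L2_norm_def norm_mult power_mult_distrib real_sqrt_mult)

lemma L2_uminus: "f \<in> L2 \<Longrightarrow> (\<lambda>x. - f x) \<in> L2"
  using L2_cmult[of f "-1"] by simp

lemma L2_norm_uminus: "L2_norm (\<lambda>x. - f x) = L2_norm f"
  by (simp add: L2_norm_def)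

lemma L2_norm_commute: "L2_norm (\<lambda>x. f x - g x) = L2_norm (\<lambda>x. g x - f x)"
  by (simp add: L2_norm_def norm_minus_commute)

lemma L2_diff: "f \<in> L2 \<Longrightarrow> g \<in> L2 \<Longrightarrow> (\<lambda>x. f x - g x) \<in> L2"
  using L2_add[OF _ L2_uminus, of f g] by simp

lemma L2_sum: "(\<And>k. k \<in> K \<Longrightarrow> f k \<in> L2) \<Longrightarrow> (\<lambda>x. \<Sum>k\<in>K. f k x) \<in> L2"
  by (induction K rule: infinite_finite_induct) (auto intro: L2_add)

lemma L2_cnj: "f \<in> L2 \<Longrightarrow> (\<lambda>x. cnj (f x)) \<in> L2"
  by (simp add: L2_def borel_measurable_continuous_onI[THEN measurable_compose_rev] continuous_intros)

lemma L2_integrable_mult: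
  assumes "f \<in> L2" "g \<in> L2"
  shows "integrable lebesgue (\<lambda>x. f x * g x)"
proof (rule Bochner_Integration.integrable_bound)
  show "integrable lebesgue (\<lambda>x. (cmod (f x))\<^sup>2 + (cmod (g x))\<^sup>2)"
    using assms by (auto simp: L2_def)
  show "(\<lambda>x. f x * g x) \<in> borel_measurable lebesgue"
    using assms by (auto simp: L2_def)
  show "AE x in lebesgue. norm (f x * g x) \<le> norm ((cmod (f x))\<^sup>2 + (cmod (g x))\<^sup>2)"
  proof (rule AE_I2)
    fix x
    have "0 \<le> cmod (f x) * cmod (g x)" by simp
    with two_mult_le_weighted_squares[of 1 "cmod (f x)" "cmod (g x)"]
    show "norm (f x * g x) \<le> norm ((cmod (f x))\<^sup>2 + (cmod (g x))\<^sup>2)"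
      unfolding norm_mult by (simp only: real_norm_def) linarith
  qed
qed

lemma L2_Cauchy_Schwarz:
  assumes "f \<in> L2" "g \<in> L2"
  shows "cmod (LINT x|lebesgue. f x * g x) \<le> L2_norm f * L2_norm g"
proof -
  let ?a = "L2_norm f" and ?b = "L2_norm g"
  have int: "integrable lebesgue (\<lambda>x. cmod (f x * g x))"
    using L2_integrable_mult[OF assms] by simp
  have bound: "(LINT x|lebesgue. cmod (f x * g x)) \<le> (?a + e) * (?b + e)" if "e > 0" for e
  proof -
    define s where "s = (?b + e) / (?a + e)"
    have pos: "?a + e > 0" "?b + e > 0" using that by (auto intro: add_nonneg_pos)
    then have s: "s > 0" by (simp add: s_def)
    have "2 * (LINT x|lebesgue. cmod (f x * g x)) = (LINT x|lebesgue. 2 * (cmod (f x) * cmod (g x)))"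
      by (simp add: norm_mult)
    also have "\<dots> \<le> (LINT x|lebesgue. s * (cmod (f x))\<^sup>2 + (cmod (g x))\<^sup>2 / s)"
      using int assms s
      by (intro integral_mono two_mult_le_weighted_squares) (auto simp: L2_def norm_mult)
    also have "\<dots> = s * ?a\<^sup>2 + ?b\<^sup>2 / s"
      using assms by (simp add: L2_def L2_norm_sq)
    also have "\<dots> \<le> s * (?a + e)\<^sup>2 + (?b + e)\<^sup>2 / s"
      using s that by (intro add_mono mult_left_mono divide_right_mono power_mono) auto
    also have "\<dots> = 2 * ((?a + e) * (?b + e))"
      using pos unfolding s_def by (simp add: power2_eq_square)
    finally show ?thesis by simp
  qed
  have "(LINT x|lebesgue. cmod (f x * g x)) \<le> ?a * ?b"
  proof (rule tendsto_lowerbound)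
    show "((\<lambda>e. (?a + e) * (?b + e)) \<longlongrightarrow> ?a * ?b) (at_right 0)"
      by (auto intro!: tendsto_eq_intros)
    show "\<forall>\<^sub>F e in at_right 0. (LINT x|lebesgue. cmod (f x * g x)) \<le> (?a + e) * (?b + e)"
      using bound by (auto simp: eventually_at_right_field intro!: exI[of _ 1])
  qed simp
  then show ?thesis
    using integral_norm_bound[of lebesgue "\<lambda>x. f x * g x"] by linarith
qed

lemma L2_inner_Cauchy_Schwarz:
  assumes "f \<in> L2" "g \<in> L2"
  shows "cmod (L2_inner f g) \<le> L2_norm f * L2_norm g"
  using L2_Cauchy_Schwarz[OF assms(1) L2_cnj[OF assms(2)]]
  by (simp add: L2_inner_def L2_norm_def)

lemma L2_inner_integrable:
  assumes "f \<in> L2" "g \<in> L2"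
  shows "integrable lebesgue (\<lambda>x. f x * cnj (g x))"
  by (rule L2_integrable_mult[OF assms(1) L2_cnj[OF assms(2)]])

lemma L2_inner_add_left:
  "f \<in> L2 \<Longrightarrow> g \<in> L2 \<Longrightarrow> h \<in> L2 \<Longrightarrow> L2_inner (\<lambda>x. f x + g x) h = L2_inner f h + L2_inner g h"
  unfolding L2_inner_def by (simp add: L2_inner_integrable distrib_right)

lemma L2_inner_diff_left:
  "f \<in> L2 \<Longrightarrow> g \<in> L2 \<Longrightarrow> h \<in> L2 \<Longrightarrow> L2_inner (\<lambda>x. f x - g x) h = L2_inner f h - L2_inner g h"
  unfolding L2_inner_def by (simp add: L2_inner_integrable left_diff_distrib)

lemma L2_inner_commute: "L2_inner g f = cnj (L2_inner f g)"
  unfolding L2_inner_def by (simp add: mult.commute flip: Bochner_Integration.integral_cnj)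

lemma L2_inner_add_right:
  "f \<in> L2 \<Longrightarrow> g \<in> L2 \<Longrightarrow> h \<in> L2 \<Longrightarrow> L2_inner h (\<lambda>x. f x + g x) = L2_inner h f + L2_inner h g"
  unfolding L2_inner_def by (simp add: L2_inner_integrable distrib_left)

lemma L2_inner_cmult_left: "L2_inner (\<lambda>x. c * f x) h = c * L2_inner f h"
  unfolding L2_inner_def by (simp add: mult.assoc)

lemma L2_inner_zero_left [simp]: "L2_inner (\<lambda>x. 0) h = 0"
  by (simp add: L2_inner_def)

lemma L2_inner_sum_left:
  "(\<And>k. k \<in> K \<Longrightarrow> f k \<in> L2) \<Longrightarrow> h \<in> L2 \<Longrightarrow>
   L2_inner (\<lambda>x. \<Sum>k\<in>K. c k * f k x) h = (\<Sum>k\<in>K. c k * L2_inner (f k) h)"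
  by (induction K rule: infinite_finite_induct)
     (auto simp: L2_inner_add_left L2_sum L2_cmult L2_inner_cmult_left)

lemma L2_inner_sum_right:
  "(\<And>k. k \<in> K \<Longrightarrow> f k \<in> L2) \<Longrightarrow> h \<in> L2 \<Longrightarrow>
   L2_inner h (\<lambda>x. \<Sum>k\<in>K. c k * f k x) = (\<Sum>k\<in>K. cnj (c k) * L2_inner h (f k))"
  by (subst L2_inner_commute, subst L2_inner_sum_left)
     (auto simp: L2_inner_commute[of h])

lemma L2_inner_self: "L2_inner f f = of_real ((L2_norm f)\<^sup>2)"
  unfolding L2_inner_def L2_norm_sq by (simp add: complex_norm_square[symmetric] del: of_real_power)

lemma L2_norm_add_sq:
  assumes "f \<in> L2" "g \<in> L2"
  shows "(L2_norm (\<lambda>x. f x + g x))\<^sup>2 = (L2_norm f)\<^sup>2 + (L2_norm g)\<^sup>2 + 2 * Re (L2_inner f g)"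
proof -
  have "complex_of_real ((L2_norm (\<lambda>x. f x + g x))\<^sup>2) = L2_inner (\<lambda>x. f x + g x) (\<lambda>x. f x + g x)"
    by (simp only: L2_inner_self)
  also have "\<dots> = L2_inner f f + L2_inner f g + (cnj (L2_inner f g) + L2_inner g g)"
    using assms L2_inner_commute[of g f]
    by (simp only: L2_inner_add_left L2_inner_add_right L2_add)
  finally have "Re (complex_of_real ((L2_norm (\<lambda>x. f x + g x))\<^sup>2)) = Re \<dots>" by (rule arg_cong)
  then show ?thesis by (simp add: L2_inner_self del: of_real_power)
qed

lemma L2_norm_triangle:
  assumes "f \<in> L2" "g \<in> L2"
  shows "L2_norm (\<lambda>x. f x + g x) \<le> L2_norm f + L2_norm g"
proof (rule power2_le_imp_le)
  have "Re (L2_inner f g) \<le> L2_norm f * L2_norm g"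
    using L2_inner_Cauchy_Schwarz[OF assms] complex_Re_le_cmod order_trans by blast
  then show "(L2_norm (\<lambda>x. f x + g x))\<^sup>2 \<le> (L2_norm f + L2_norm g)\<^sup>2"
    unfolding L2_norm_add_sq[OF assms] by (simp add: power2_sum)
qed simp

lemma L2_norm_triangle_diff:
  assumes "f \<in> L2" "g \<in> L2" "h \<in> L2"
  shows "L2_norm (\<lambda>x. f x - h x) \<le> L2_norm (\<lambda>x. f x - g x) + L2_norm (\<lambda>x. g x - h x)"
  using L2_norm_triangle[OF L2_diff[OF assms(1,2)] L2_diff[OF assms(2,3)]] by simp

lemma L2_norm_diff_bound:
  assumes "f \<in> L2" "g \<in> L2"
  shows "\<bar>L2_norm f - L2_norm g\<bar> \<le> L2_norm (\<lambda>x. f x - g x)"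
  using L2_norm_triangle_diff[OF assms L2_zero] L2_norm_triangle_diff[OF assms(2,1) L2_zero]
  by (simp add: L2_norm_commute[of g f])

lemma tendsto_L2_norm:
  assumes "\<And>n. u n \<in> L2" "f \<in> L2" "((\<lambda>n. L2_norm (\<lambda>x. f x - u n x)) \<longlongrightarrow> 0) G"
  shows "((\<lambda>n. L2_norm (u n)) \<longlongrightarrow> L2_norm f) G"
proof -
  have "((\<lambda>n. L2_norm f - L2_norm (u n)) \<longlongrightarrow> 0) G"
    by (rule Lim_null_comparison[OF _ assms(3)])
       (auto intro!: always_eventually L2_norm_diff_bound assms)
  from tendsto_diff[OF tendsto_const[of "L2_norm f"] this] show ?thesis by simp
qed

lemma tendsto_L2_inner_left:
  assumes "\<And>n. u n \<in> L2" "f \<in> L2" "g \<in> L2" "((\<lambda>n. L2_norm (\<lambda>x. f x - u n x)) \<longlongrightarrow> 0) G"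
  shows "((\<lambda>n. L2_inner (u n) g) \<longlongrightarrow> L2_inner f g) G"
proof -
  have "((\<lambda>n. L2_inner f g - L2_inner (u n) g) \<longlongrightarrow> 0) G"
  proof (rule Lim_null_comparison)
    show "\<forall>\<^sub>F n in G. norm (L2_inner f g - L2_inner (u n) g) \<le> L2_norm (\<lambda>x. f x - u n x) * L2_norm g"
      by (auto intro!: always_eventually L2_inner_Cauchy_Schwarz L2_diff assms
               simp: L2_inner_diff_left[symmetric] assms)
    show "((\<lambda>n. L2_norm (\<lambda>x. f x - u n x) * L2_norm g) \<longlongrightarrow> 0) G"
      using tendsto_mult_left_zero[OF assms(4)] by simp
  qed
  from tendsto_diff[OF tendsto_const[of "L2_inner f g"] this] show ?thesis by simp
qed

lemma tendsto_L2_inner_right: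
  assumes "\<And>n. u n \<in> L2" "f \<in> L2" "g \<in> L2" "((\<lambda>n. L2_norm (\<lambda>x. f x - u n x)) \<longlongrightarrow> 0) G"
  shows "((\<lambda>n. L2_inner g (u n)) \<longlongrightarrow> L2_inner g f) G"
  using tendsto_cnj[OF tendsto_L2_inner_left[OF assms]]
  by (simp add: L2_inner_commute[symmetric])

lemma L2_norm_eq_0_AE:
  assumes "f \<in> L2"
  shows "L2_norm f = 0 \<longleftrightarrow> (AE x in lebesgue. f x = 0)"
  using integral_nonneg_eq_0_iff_AE[OF L2_integrable_sq[OF assms]]
  by (simp add: L2_norm_def)

lemma L2_norm_cong_AE:
  assumes "f \<in> borel_measurable lebesgue" "g \<in> borel_measurable lebesgue" "AE x in lebesgue. f x = g x"
  shows "L2_norm f = L2_norm g"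
  unfolding L2_norm_def by (intro arg_cong[of _ _ sqrt] integral_cong_AE) (use assms in auto)

lemma L2_Fatou:
  assumes u: "\<And>n. u n \<in> L2" and f: "f \<in> borel_measurable lebesgue"
    and lim: "AE x in lebesgue. (\<lambda>n. u n x) \<longlonglongrightarrow> f x"
    and bound: "\<forall>\<^sub>F n in sequentially. L2_norm (u n) \<le> C"
  shows "f \<in> L2" "L2_norm f \<le> C"
proof -
  note [measurable] = L2_measurable[OF u] f
  have C: "0 \<le> C"
    using eventually_happens'[OF _ bound] L2_norm_nonneg order_trans
    by (metis sequentially_bot)
  have "(\<integral>\<^sup>+x. ennreal ((cmod (f x))\<^sup>2) \<partial>lebesgue) =
        (\<integral>\<^sup>+x. liminf (\<lambda>n. ennreal ((cmod (u n x))\<^sup>2)) \<partial>lebesgue)"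
  proof (rule nn_integral_cong_AE)
    show "AE x in lebesgue. ennreal ((cmod (f x))\<^sup>2) = liminf (\<lambda>n. ennreal ((cmod (u n x))\<^sup>2))"
      using lim
    proof eventually_elim
      case (elim x)
      then have "(\<lambda>n. ennreal ((cmod (u n x))\<^sup>2)) \<longlonglongrightarrow> ennreal ((cmod (f x))\<^sup>2)"
        by (intro tendsto_intros tendsto_ennrealI)
      then show ?case by (intro lim_imp_Liminf[symmetric]) auto
    qed
  qed
  also have "\<dots> \<le> liminf (\<lambda>n. \<integral>\<^sup>+x. ennreal ((cmod (u n x))\<^sup>2) \<partial>lebesgue)"
    by (rule nn_integral_liminf) measurable
  also have "\<dots> = liminf (\<lambda>n. ennreal ((L2_norm (u n))\<^sup>2))"
    by (simp add: L2_norm_sq nn_integral_eq_integral L2_integrable_sq u)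
  also have "\<dots> \<le> liminf (\<lambda>n::nat. ennreal (C\<^sup>2))"
    by (rule Liminf_mono, rule eventually_mono[OF bound]) (simp add: ennreal_leI power_mono)
  also have "\<dots> = ennreal (C\<^sup>2)"
    by (simp add: Liminf_const)
  finally have le: "(\<integral>\<^sup>+x. ennreal ((cmod (f x))\<^sup>2) \<partial>lebesgue) \<le> ennreal (C\<^sup>2)" .
  then have "integrable lebesgue (\<lambda>x. (cmod (f x))\<^sup>2)"
    by (intro integrableI_bounded) (auto intro: le_less_trans)
  then show mem: "f \<in> L2" using f by (simp add: L2_def)
  have "ennreal ((L2_norm f)\<^sup>2) \<le> ennreal (C\<^sup>2)"
    using le by (simp add: L2_norm_sq nn_integral_eq_integral L2_integrable_sq mem)
  then have "(L2_norm f)\<^sup>2 \<le> C\<^sup>2" by (simp add: ennreal_le_iff)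
  then show "L2_norm f \<le> C" using C by (rule power2_le_imp_le)
qed

lemma L2_complete:
  assumes u: "\<And>n. u n \<in> L2"
    and Cauchy: "\<And>e. e > 0 \<Longrightarrow> \<exists>N. \<forall>m\<ge>N. \<forall>n\<ge>N. L2_norm (\<lambda>x. u m x - u n x) < e"
  obtains f r where "f \<in> L2" "(\<lambda>n. L2_norm (\<lambda>x. f x - u n x)) \<longlonglongrightarrow> 0"
    "strict_mono r" "AE x in lebesgue. (\<lambda>n. u (r n) x) \<longlonglongrightarrow> f x"
proof -
  note [measurable] = L2_measurable[OF u]
  have "\<exists>r::nat\<Rightarrow>nat. \<forall>n. (\<forall>m\<ge>r n. L2_norm (\<lambda>x. u m x - u (r n) x) < (1/4)^n) \<and> r n < r (Suc n)"
  proof (rule dependent_nat_choice)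
    show "\<exists>N. \<forall>m\<ge>N. L2_norm (\<lambda>x. u m x - u N x) < (1/4)^0" using Cauchy[of 1] by auto
  next
    fix N n
    obtain M where "\<forall>m\<ge>M. \<forall>k\<ge>M. L2_norm (\<lambda>x. u m x - u k x) < (1/4)^Suc n"
      using Cauchy[of "(1/4)^Suc n"] by auto
    then show "\<exists>M. (\<forall>m\<ge>M. L2_norm (\<lambda>x. u m x - u M x) < (1/4)^Suc n) \<and> N < M"
      by (intro exI[of _ "max M (Suc N)"]) auto
  qed
  then obtain r :: "nat \<Rightarrow> nat" where r: "\<And>n m. m \<ge> r n \<Longrightarrow> L2_norm (\<lambda>x. u m x - u (r n) x) < (1/4)^n"
    and mono: "\<And>n. r n < r (Suc n)" by blast
  have smono: "strict_mono r" using mono by (simp add: strict_mono_Suc_iff)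
  define d where "d = (\<lambda>n x. u (r (Suc n)) x - u (r n) x)"
  have dL2: "d n \<in> L2" for n unfolding d_def by (intro L2_diff u)
  note [measurable] = L2_measurable[OF dL2]
  have dn: "(L2_norm (d n))\<^sup>2 \<le> (1/16)^n" for n
  proof -
    have "L2_norm (d n) \<le> (1/4)^n"
      using r[of n "r (Suc n)"] mono[of n] by (simp add: d_def)
    then have "(L2_norm (d n))\<^sup>2 \<le> ((1/4)^n)\<^sup>2" by (simp add: power_mono)
    also have "\<dots> = (1/16)^n" by (simp add: power2_eq_square power_mult_distrib[symmetric])
    finally show ?thesis .
  qed
  text \<open>The weights \<open>4^n\<close> still give a finite sum, which forces \<open>\<bar>d n x\<bar> = O(2^-n)\<close> almost everywhere.\<close>
  have "(\<integral>\<^sup>+x. (\<Sum>n. ennreal (4^n * (cmod (d n x))\<^sup>2)) \<partial>lebesgue) =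
        (\<Sum>n. \<integral>\<^sup>+x. ennreal (4^n * (cmod (d n x))\<^sup>2) \<partial>lebesgue)"
    by (rule nn_integral_suminf) measurable
  also have "\<dots> = (\<Sum>n. ennreal (4^n * (L2_norm (d n))\<^sup>2))"
    by (simp add: L2_norm_sq nn_integral_eq_integral L2_integrable_sq dL2)
  also have "\<dots> \<le> (\<Sum>n. ennreal ((1/4)^n))"
  proof (intro suminf_le ennreal_leI)
    fix n :: nat
    have "4^n * (L2_norm (d n))\<^sup>2 \<le> 4^n * (1/16)^n"
      using dn[of n] by (intro mult_left_mono) auto
    also have "\<dots> = (1/4)^n" by (simp add: power_mult_distrib[symmetric])
    finally show "4^n * (L2_norm (d n))\<^sup>2 \<le> (1/4)^n" .
  qed auto
  also have "\<dots> = ennreal (\<Sum>n. (1/4)^n)"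
    by (intro suminf_ennreal2 summable_geometric) auto
  also have "\<dots> < \<infinity>" by simp
  finally have "AE x in lebesgue. (\<Sum>n. ennreal (4^n * (cmod (d n x))\<^sup>2)) \<noteq> \<infinity>"
    by (intro nn_integral_PInf_AE) auto
  then have conv: "AE x in lebesgue. convergent (\<lambda>n. u (r n) x)"
  proof eventually_elim
    case (elim x)
    define g where "g = (\<lambda>n. ennreal (4^n * (cmod (d n x))\<^sup>2))"
    obtain c where c: "suminf g = ennreal c" "0 \<le> c"
      using elim by (cases "suminf g") (auto simp: g_def)
    have "cmod (d n x) \<le> sqrt c * (1/2)^n" for n
    proof -
      have "(\<Sum>i\<in>{n}. g i) \<le> suminf g" by (rule sum_le_suminf) auto
      then have "g n \<le> ennreal c" by (simp only: c sum.insert) auto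
      then have "4^n * (cmod (d n x))\<^sup>2 \<le> c"
        unfolding g_def by (simp only: ennreal_le_iff c)
      moreover have "(2^n)\<^sup>2 = (4::real)^n"
        by (simp add: power2_eq_square flip: power_mult_distrib)
      ultimately have "(2^n * cmod (d n x))\<^sup>2 \<le> c"
        by (simp only: power_mult_distrib)
      then have "2^n * cmod (d n x) \<le> sqrt c" by (rule real_le_rsqrt)
      then show ?thesis by (simp add: power_divide pos_le_divide_eq mult.commute)
    qed
    note bound = this
    have "summable (\<lambda>n. sqrt c * (1/2)^n)"
      by (intro summable_mult summable_geometric) simp
    then have "summable (\<lambda>n. d n x)"
      by (rule summable_comparison_test'[where N = 0]) (rule bound)
    moreover have "(\<Sum>i<n. d i x) = u (r n) x - u (r 0) x" for n
      unfolding d_def by (rule sum_lessThan_telescope)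
    ultimately have "convergent (\<lambda>n. u (r n) x - u (r 0) x)"
      by (simp add: summable_iff_convergent)
    from convergent_add[OF this convergent_const[of "u (r 0) x"]] show ?case by simp
  qed
  define f where "f = (\<lambda>x. lim (\<lambda>n. u (r n) x))"
  have f[measurable]: "f \<in> borel_measurable lebesgue"
    unfolding f_def by measurable
  have lim: "AE x in lebesgue. (\<lambda>n. u (r n) x) \<longlonglongrightarrow> f x"
    using conv by eventually_elim (simp add: f_def convergent_LIMSEQ_iff)
  have *: "(\<lambda>x. f x - u m x) \<in> L2 \<and> L2_norm (\<lambda>x. f x - u m x) \<le> e"
    if N: "\<forall>m\<ge>N. \<forall>n\<ge>N. L2_norm (\<lambda>x. u m x - u n x) < e" "m \<ge> N" for e N m
  proof -
    have ev: "\<forall>\<^sub>F n in sequentially. L2_norm (\<lambda>x. u (r n) x - u m x) \<le> e"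
      using eventually_ge_at_top[of N]
    proof eventually_elim
      case (elim n)
      then have "r n \<ge> N" using seq_suble[OF smono, of n] by linarith
      then show ?case using N by (simp add: less_imp_le)
    qed
    have "AE x in lebesgue. (\<lambda>n. u (r n) x - u m x) \<longlonglongrightarrow> f x - u m x"
      using lim by eventually_elim (intro tendsto_intros)
    from L2_Fatou[OF _ _ this ev] show ?thesis by (simp add: L2_diff u)
  qed
  obtain N1 where N1: "\<forall>m\<ge>N1. \<forall>n\<ge>N1. L2_norm (\<lambda>x. u m x - u n x) < 1" using Cauchy[of 1] by auto
  have fL2: "f \<in> L2" using L2_add[OF conjunct1[OF *[OF N1 order_refl]] u[of N1]] by simp
  have "(\<lambda>n. L2_norm (\<lambda>x. f x - u n x)) \<longlonglongrightarrow> 0"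
  proof (rule LIMSEQ_I)
    fix e :: real assume "e > 0"
    then obtain N where "\<forall>m\<ge>N. \<forall>n\<ge>N. L2_norm (\<lambda>x. u m x - u n x) < e/2"
      using Cauchy[of "e/2"] by auto
    from *[OF this] have "\<forall>m\<ge>N. L2_norm (\<lambda>x. f x - u m x) \<le> e/2" by blast
    then show "\<exists>N. \<forall>n\<ge>N. norm (L2_norm (\<lambda>x. f x - u n x) - 0) < e"
      using \<open>e > 0\<close> by (intro exI[of _ N]) force
  qed
  from that[OF fL2 this smono lim] show ?thesis .
qed

section \<open>Square-summable sequences and systems with an upper Riesz bound\<close>

lemma square_summable_finite_bound:
  assumes "square_summable c" "finite K"
  shows "(\<Sum>k\<in>K. (cmod (c k))\<^sup>2) \<le> (\<Sum>\<^sub>\<infinity>k. (cmod (c k))\<^sup>2)"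
  using assms by (intro finite_sum_le_infsum) (auto simp: square_summable_def)

lemma square_summableI:
  assumes "\<And>K. finite K \<Longrightarrow> (\<Sum>k\<in>K. (cmod (c k))\<^sup>2) \<le> C"
  shows "square_summable c"
  unfolding square_summable_def
  by (rule nonneg_bdd_above_summable_on) (use assms in \<open>auto intro!: bdd_aboveI2[where M = C]\<close>)

lemma filterlim_symmetric_int_intervals:
  "filterlim (\<lambda>N. {- int N..int N}) (finite_subsets_at_top UNIV) sequentially"
  unfolding filterlim_finite_subsets_at_top
proof (intro allI impI)
  fix X :: "int set" assume "finite X \<and> X \<subseteq> UNIV"
  then have fin: "finite ((\<lambda>k. nat \<bar>k\<bar>) ` X)" by simp
  show "\<forall>\<^sub>F N in sequentially. finite {- int N..int N} \<and> X \<subseteq> {- int N..int N} \<and> {- int N..int N} \<subseteq> UNIV"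
    using eventually_ge_at_top[of "Max (insert 0 ((\<lambda>k. nat \<bar>k\<bar>) ` X))"]
  proof eventually_elim
    case (elim N)
    have "nat \<bar>k\<bar> \<le> N" if "k \<in> X" for k
      using elim fin that by simp
    then show ?case by force
  qed
qed

lemma has_sum_imp_symmetric_limit:
  assumes "(f has_sum s) (UNIV :: int set)"
  shows "(\<lambda>N. \<Sum>k\<in>{- int N..int N}. f k) \<longlonglongrightarrow> s"
  using filterlim_compose[OF assms[unfolded has_sum_def] filterlim_symmetric_int_intervals] .

lemma square_summable_tail:
  assumes c: "square_summable c" and "e > 0"
  shows "\<exists>N. \<forall>K. finite K \<longrightarrow> K \<inter> {- int N..int N} = {} \<longrightarrow> (\<Sum>k\<in>K. (cmod (c k))\<^sup>2) < e"
proof -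
  let ?s = "\<Sum>\<^sub>\<infinity>k. (cmod (c k))\<^sup>2"
  have "(\<lambda>N. \<Sum>k\<in>{- int N..int N}. (cmod (c k))\<^sup>2) \<longlonglongrightarrow> ?s"
    using c by (intro has_sum_imp_symmetric_limit) (simp add: square_summable_def)
  then have "\<forall>\<^sub>F N in sequentially. ?s - e < (\<Sum>k\<in>{- int N..int N}. (cmod (c k))\<^sup>2)"
    using \<open>e > 0\<close> by (intro order_tendstoD(1)) auto
  then obtain N where N: "?s - e < (\<Sum>k\<in>{- int N..int N}. (cmod (c k))\<^sup>2)"
    by (meson eventually_happens sequentially_bot)
  show ?thesis
  proof (intro exI[of _ N] allI impI)
    fix K :: "int set" assume K: "finite K" "K \<inter> {- int N..int N} = {}"
    have "(\<Sum>k\<in>K. (cmod (c k))\<^sup>2) + (\<Sum>k\<in>{- int N..int N}. (cmod (c k))\<^sup>2) =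
      (\<Sum>k\<in>K \<union> {- int N..int N}. (cmod (c k))\<^sup>2)"
      using K by (subst sum.union_disjoint) auto
    also have "\<dots> \<le> ?s" using K by (intro square_summable_finite_bound c) auto
    finally show "(\<Sum>k\<in>K. (cmod (c k))\<^sup>2) < e" using N by linarith
  qed
qed

definition upper_bound_system :: "real \<Rightarrow> (int \<Rightarrow> real \<Rightarrow> complex) \<Rightarrow> bool" where
  "upper_bound_system B b \<longleftrightarrow> (\<forall>k. b k \<in> L2) \<and>
     (\<forall>K c. finite K \<longrightarrow> (L2_norm (\<lambda>x. \<Sum>k\<in>K. c k * b k x))\<^sup>2 \<le> B * (\<Sum>k\<in>K. (cmod (c k))\<^sup>2))"

definition partial_sum :: "(int \<Rightarrow> complex) \<Rightarrow> (int \<Rightarrow> real \<Rightarrow> complex) \<Rightarrow> nat \<Rightarrow> real \<Rightarrow> complex" where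
  "partial_sum c b N x = (\<Sum>k\<in>{- int N..int N}. c k * b k x)"

lemma partial_sum_L2: "(\<And>k. b k \<in> L2) \<Longrightarrow> partial_sum c b N \<in> L2"
  unfolding partial_sum_def[abs_def] by (intro L2_sum L2_cmult)

lemma upper_bound_system_L2: "upper_bound_system B b \<Longrightarrow> b k \<in> L2"
  by (simp add: upper_bound_system_def)

lemma upper_bound_system_D:
  "upper_bound_system B b \<Longrightarrow> finite K \<Longrightarrow>
    (L2_norm (\<lambda>x. \<Sum>k\<in>K. c k * b k x))\<^sup>2 \<le> B * (\<Sum>k\<in>K. (cmod (c k))\<^sup>2)"
  unfolding upper_bound_system_def by blast

lemma upper_bound_system_nonneg:
  assumes "upper_bound_system B b" shows "0 \<le> B"
proof -
  have "(L2_norm (b 0))\<^sup>2 \<le> B"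
    using upper_bound_system_D[OF assms, of "{0}" "\<lambda>_. 1"] by simp
  then show ?thesis using zero_le_power2 order_trans by blast
qed

lemma partial_sum_diff:
  assumes "M \<le> N"
  shows "partial_sum c b N x - partial_sum c b M x = (\<Sum>k\<in>{- int N..int N} - {- int M..int M}. c k * b k x)"
  unfolding partial_sum_def using assms by (subst sum_diff) auto

lemma upper_bound_system_Cauchy:
  assumes b: "upper_bound_system B b" and c: "square_summable c" and e: "e > 0"
  shows "\<exists>N. \<forall>m\<ge>N. \<forall>n\<ge>N. L2_norm (\<lambda>x. partial_sum c b m x - partial_sum c b n x) < e"
proof -
  have B0: "0 \<le> B" using upper_bound_system_nonneg[OF b] .
  have mem: "partial_sum c b N \<in> L2" for N
    using b by (intro partial_sum_L2) (simp add: upper_bound_system_def)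
  define d where "d = (e/2)\<^sup>2 / (B + 1)"
  have d: "d > 0" using e B0 by (simp add: d_def)
  obtain N where N: "\<And>K. finite K \<Longrightarrow> K \<inter> {- int N..int N} = {} \<Longrightarrow> (\<Sum>k\<in>K. (cmod (c k))\<^sup>2) < d"
    using square_summable_tail[OF c d] by blast
  have *: "L2_norm (\<lambda>x. partial_sum c b m x - partial_sum c b N x) < e/2" if "m \<ge> N" for m
  proof (rule power2_less_imp_less)
    let ?K = "{- int m..int m} - {- int N..int N}"
    have "(L2_norm (\<lambda>x. partial_sum c b m x - partial_sum c b N x))\<^sup>2 \<le> B * (\<Sum>k\<in>?K. (cmod (c k))\<^sup>2)"
      unfolding partial_sum_diff[OF that] by (rule upper_bound_system_D[OF b]) simp
    also have "\<dots> \<le> B * d"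
      using N[of ?K] B0 by (intro mult_left_mono less_imp_le[OF N]) auto
    also have "\<dots> < (B + 1) * d" using d by simp
    also have "\<dots> = (e/2)\<^sup>2" using B0 by (simp add: d_def)
    finally show "(L2_norm (\<lambda>x. partial_sum c b m x - partial_sum c b N x))\<^sup>2 < (e/2)\<^sup>2" .
  qed (use e in simp)
  show ?thesis
  proof (intro exI[of _ N] allI impI)
    fix m n assume "m \<ge> N" "n \<ge> N"
    then show "L2_norm (\<lambda>x. partial_sum c b m x - partial_sum c b n x) < e"
      using L2_norm_triangle_diff[OF mem mem mem, of m n N] *[of m] *[of n]
        L2_norm_commute[of "partial_sum c b n" "partial_sum c b N"] by linarith
  qed
qed

lemma upper_bound_system_Bessel:
  assumes b: "upper_bound_system B b" and u: "u \<in> L2"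
  shows "square_summable (\<lambda>k. L2_inner u (b k))"
proof (rule square_summableI)
  fix K :: "int set" assume K: "finite K"
  define a where "a = (\<lambda>k. L2_inner u (b k))"
  define s where "s = (\<Sum>k\<in>K. (cmod (a k))\<^sup>2)"
  have s0: "s \<ge> 0" unfolding s_def by (intro sum_nonneg) auto
  have bL2: "b k \<in> L2" for k using b by (rule upper_bound_system_L2)
  have mem: "(\<lambda>x. \<Sum>k\<in>K. a k * b k x) \<in> L2" by (intro L2_sum L2_cmult bL2)
  have "L2_inner u (\<lambda>x. \<Sum>k\<in>K. a k * b k x) = (\<Sum>k\<in>K. cnj (a k) * a k)"
    unfolding a_def by (rule L2_inner_sum_right[OF bL2 u])
  also have "\<dots> = of_real s"
    by (simp add: s_def complex_norm_square mult.commute del: of_real_power)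
  finally have "s = cmod (L2_inner u (\<lambda>x. \<Sum>k\<in>K. a k * b k x))" using s0 by simp
  also have "\<dots> \<le> L2_norm u * L2_norm (\<lambda>x. \<Sum>k\<in>K. a k * b k x)"
    by (rule L2_inner_Cauchy_Schwarz[OF u mem])
  finally have "s\<^sup>2 \<le> (L2_norm u * L2_norm (\<lambda>x. \<Sum>k\<in>K. a k * b k x))\<^sup>2"
    using s0 by (rule power_mono)
  also have "\<dots> \<le> (L2_norm u)\<^sup>2 * (B * s)"
    unfolding power_mult_distrib s_def
    by (intro mult_left_mono upper_bound_system_D[OF b K]) auto
  finally have "s * s \<le> (B * (L2_norm u)\<^sup>2) * s" by (simp add: power2_eq_square mult_ac)
  then have "s \<le> B * (L2_norm u)\<^sup>2"
    using s0 upper_bound_system_nonneg[OF b] by (cases "s = 0") (simp_all add: mult_le_cancel_right)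
  then show "(\<Sum>k\<in>K. (cmod (L2_inner u (b k)))\<^sup>2) \<le> B * (L2_norm u)\<^sup>2"
    by (simp add: s_def a_def)
qed

section \<open>Fourier series on the interval \<open>[-\<pi>, \<pi>]\<close>\<close>

lemma indicator_scaleR_complex: "indicator A w *\<^sub>R (z::complex) = indicator A w * z"
  by (simp add: indicator_def)

inductive trig_polynomial :: "(real \<Rightarrow> complex) \<Rightarrow> bool" where
  monom: "trig_polynomial (\<lambda>w. c * cis (of_int k * w))"
| add: "trig_polynomial f \<Longrightarrow> trig_polynomial g \<Longrightarrow> trig_polynomial (\<lambda>w. f w + g w)"

lemma trig_polynomial_mult:
  assumes "trig_polynomial f" "trig_polynomial g"
  shows "trig_polynomial (\<lambda>w. f w * g w)"
  using assms(1)
proof induction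
  case (monom c k)
  show ?case using assms(2)
  proof induction
    case (monom d l)
    have "(\<lambda>w. c * cis (of_int k * w) * (d * cis (of_int l * w))) = (\<lambda>w. (c * d) * cis (of_int (k + l) * w))"
      by (simp add: fun_eq_iff cis_mult distrib_left mult_ac)
    then show ?case by (simp only: trig_polynomial.monom)
  next
    case (add f g)
    then show ?case using trig_polynomial.add by (simp add: distrib_left)
  qed
next
  case (add f g)
  then show ?case using trig_polynomial.add by (simp add: distrib_right)
qed

lemma trig_polynomial_const: "trig_polynomial (\<lambda>w. c)"
  using trig_polynomial.monom[of c 0] by simp

lemma trig_polynomial_of_real_polynomial:
  assumes "real_polynomial_function p"
  shows "trig_polynomial (\<lambda>w. of_real (p (cis w)))"
  using assms
proof induction
  case (linear f)
  interpret bounded_linear f by fact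
  have "complex_of_real (f (cis w)) =
      (of_real (f 1) / 2 + of_real (f \<i>) / (2 * \<i>)) * cis (of_int 1 * w) +
      (of_real (f 1) / 2 - of_real (f \<i>) / (2 * \<i>)) * cis (of_int (-1) * w)" for w
  proof -
    have "f (cis w) = f (cos w *\<^sub>R 1 + sin w *\<^sub>R \<i>)"
      by (rule arg_cong[of _ _ f]) (simp add: complex_eq_iff)
    also have "\<dots> = cos w * f 1 + sin w * f \<i>" by (simp only: add scaleR real_scaleR_def)
    finally show ?thesis by (simp add: complex_eq_iff field_simps)
  qed
  then show ?case by (simp only: trig_polynomial.add[OF trig_polynomial.monom trig_polynomial.monom])
qed (simp_all add: trig_polynomial_const trig_polynomial.add trig_polynomial_mult)

lemma cis_measurable_lebesgue [measurable]: "(\<lambda>w. cis (a * w)) \<in> borel_measurable lebesgue"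
  by (intro measurable_completion) (simp add: borel_measurable_continuous_onI continuous_intros)

lemma integral_trig_polynomial_zero:
  fixes u :: "real \<Rightarrow> complex"
  assumes u: "integrable lebesgue u" and coeff: "\<And>k::int. (LINT w|lebesgue. u w * cis (of_int k * w)) = 0"
    and f: "trig_polynomial f"
  shows "integrable lebesgue (\<lambda>w. u w * f w) \<and> (LINT w|lebesgue. u w * f w) = 0"
  using f
proof induction
  case (monom c k)
  have [measurable]: "u \<in> borel_measurable lebesgue" using u by simp
  have "integrable lebesgue (\<lambda>w. u w * cis (of_int k * w))"
    by (rule Bochner_Integration.integrable_bound[OF u]) (auto simp: norm_mult)
  from integrable_mult_right[OF this, of c] coeff[of k] integral_mult_right_zero[of lebesgue c "\<lambda>w. u w * cis (of_int k * w)"]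
  show ?case by (simp add: mult_ac)
next
  case (add f g)
  then show ?case by (simp add: distrib_left)
qed

lemma integral_continuous_circle_zero:
  fixes u :: "real \<Rightarrow> complex" and h :: "complex \<Rightarrow> real"
  assumes u: "integrable lebesgue u" and coeff: "\<And>k::int. (LINT w|lebesgue. u w * cis (of_int k * w)) = 0"
    and h: "continuous_on UNIV h"
  shows "(LINT w|lebesgue. u w * of_real (h (cis w))) = 0"
proof -
  have [measurable]: "u \<in> borel_measurable lebesgue" using u by simp
  have "continuous_on UNIV (\<lambda>w. h (cis w))"
    by (intro continuous_on_compose2[OF h] continuous_intros) auto
  then have hm[measurable]: "(\<lambda>w. h (cis w)) \<in> borel_measurable lebesgue"
    by (intro measurable_completion) (simp add: borel_measurable_continuous_onI)
  have le: "cmod (LINT w|lebesgue. u w * of_real (h (cis w))) \<le> e * (LINT w|lebesgue. cmod (u w))" if e: "e > 0" for e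
  proof -
    obtain p where p: "real_polynomial_function p" "\<And>z. z \<in> sphere 0 1 \<Longrightarrow> \<bar>h z - p z\<bar> < e"
      using Stone_Weierstrass_real_polynomial_function[OF compact_sphere continuous_on_subset[OF h subset_UNIV] e, of 0 1]
      by metis
    note pz = integral_trig_polynomial_zero[OF u coeff trig_polynomial_of_real_polynomial[OF p(1)]]
    have pw: "\<bar>h (cis w) - p (cis w)\<bar> \<le> e" for w using p(2)[of "cis w"] by simp
    have pc: "continuous_on UNIV p" using p(1) by (simp add: real_polynomial_function_eq continuous_on_polymonial_function)
    have "continuous_on UNIV (\<lambda>w. p (cis w))"
      by (intro continuous_on_compose2[OF pc] continuous_intros) auto
    then have pm[measurable]: "(\<lambda>w. p (cis w)) \<in> borel_measurable lebesgue"
      by (intro measurable_completion) (simp add: borel_measurable_continuous_onI)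
    have bnd: "norm (u w * of_real (h (cis w) - p (cis w))) \<le> e * cmod (u w)" for w
      using mult_right_mono[OF pw[of w] norm_ge_zero[of "u w"]]
      by (simp only: norm_mult norm_of_real) (simp add: mult.commute)
    have int: "integrable lebesgue (\<lambda>w. u w * of_real (h (cis w) - p (cis w)))"
    proof (rule Bochner_Integration.integrable_bound)
      show "integrable lebesgue (\<lambda>w. e * cmod (u w))" using u by simp
      show "AE w in lebesgue. norm (u w * of_real (h (cis w) - p (cis w))) \<le> norm (e * cmod (u w))"
        using bnd by (auto intro: order_trans[OF _ abs_ge_self] simp del: of_real_diff)
    qed measurable
    have "(LINT w|lebesgue. u w * of_real (h (cis w))) =
       (LINT w|lebesgue. u w * of_real (h (cis w) - p (cis w)) + u w * of_real (p (cis w)))"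
      by (rule Bochner_Integration.integral_cong) (auto simp: algebra_simps)
    also have "\<dots> = (LINT w|lebesgue. u w * of_real (h (cis w) - p (cis w)))"
      using Bochner_Integration.integral_add[OF int conjunct1[OF pz]] conjunct2[OF pz] by simp
    also have "cmod \<dots> \<le> (LINT w|lebesgue. norm (u w * of_real (h (cis w) - p (cis w))))"
      by (rule integral_norm_bound)
    also have "\<dots> \<le> (LINT w|lebesgue. e * cmod (u w))"
      using int u by (intro integral_mono bnd) (auto simp del: of_real_diff)
    finally show ?thesis by simp
  qed
  have "cmod (LINT w|lebesgue. u w * of_real (h (cis w))) \<le> 0"
  proof (rule tendsto_lowerbound)
    show "((\<lambda>e. e * (LINT w|lebesgue. cmod (u w))) \<longlongrightarrow> 0) (at_right 0)"
      by (auto intro!: tendsto_eq_intros)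
    show "\<forall>\<^sub>F e in at_right 0. cmod (LINT w|lebesgue. u w * of_real (h (cis w))) \<le> e * (LINT w|lebesgue. cmod (u w))"
      using le by (auto simp: eventually_at_right_field intro!: exI[of _ 1])
  qed simp
  then show ?thesis by simp
qed

lemma cis_image_notin:
  assumes "K \<subseteq> {-pi<..<pi}" "w \<in> {-pi..pi}" "w \<notin> K"
  shows "cis w \<notin> cis ` K"
proof
  assume "cis w \<in> cis ` K"
  then obtain k where k: "k \<in> K" "cis w = cis k" by auto
  have Ak: "Arg (cis k) = k" using k(1) assms(1) by (intro cis_Arg_unique) (auto simp: sgn_eq)
  show False
  proof (cases "w = -pi")
    case True
    then have "Arg (cis w) = pi" by (intro cis_Arg_unique) (auto simp: sgn_eq complex_eq_iff)
    with Ak have "k = pi" unfolding k(2) by simp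
    then show False using k(1) assms(1) by auto
  next
    case False
    then have "Arg (cis w) = w" using assms(2) by (intro cis_Arg_unique) (auto simp: sgn_eq)
    with Ak have "k = w" unfolding k(2) by simp
    then show False using k(1) assms(3) by simp
  qed
qed

lemma integral_compact_zero:
  fixes u :: "real \<Rightarrow> complex"
  assumes u: "integrable lebesgue u" and supp: "\<And>w. w \<notin> {-pi..pi} \<Longrightarrow> u w = 0"
    and coeff: "\<And>k::int. (LINT w|lebesgue. u w * cis (of_int k * w)) = 0"
    and K: "compact K" "K \<subseteq> {-pi<..<pi}"
  shows "(LINT w|lebesgue. indicator K w * u w) = 0"
proof (cases "K = {}")
  case False
  have [measurable]: "u \<in> borel_measurable lebesgue" using u by simp
  define C where "C = cis ` K"
  have "compact C" unfolding C_def by (intro compact_continuous_image continuous_intros K)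
  then have C: "closed C" "C \<noteq> {}" using False by (auto simp: C_def compact_imp_closed)
  define h where "h = (\<lambda>n z. max 0 (1 - real n * infdist z C))"
  have h: "continuous_on UNIV (h n)" for n unfolding h_def by (intro continuous_intros)
  have "continuous_on UNIV (\<lambda>w. h n (cis w))" for n
    by (intro continuous_on_compose2[OF h] continuous_intros) auto
  then have hm[measurable]: "(\<lambda>w. h n (cis w)) \<in> borel_measurable lebesgue" for n
    by (intro measurable_completion) (simp add: borel_measurable_continuous_onI)
  have Km[measurable]: "K \<in> sets lebesgue" using K(1) by (simp add: compact_imp_closed)
  have h01: "\<bar>h n z\<bar> \<le> 1" for n z
    unfolding h_def using infdist_nonneg[of z C] by (auto simp: max_def)
  have "(\<lambda>n. LINT w|lebesgue. u w * of_real (h n (cis w))) \<longlonglongrightarrow> (LINT w|lebesgue. indicator K w * u w)"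
  proof (rule integral_dominated_convergence)
    show "integrable lebesgue (\<lambda>w. norm (u w))" using u by simp
    show "AE w in lebesgue. norm (u w * of_real (h n (cis w))) \<le> norm (u w)" for n
      using mult_left_mono[OF h01 norm_ge_zero[of "u _"]] by (auto simp: norm_mult)
    show "AE w in lebesgue. (\<lambda>n. u w * of_real (h n (cis w))) \<longlonglongrightarrow> indicator K w * u w"
    proof (rule AE_I2)
      fix w
      consider "w \<in> K" | "w \<notin> {-pi..pi}" | "w \<in> {-pi..pi}" "w \<notin> K" by blast
      then show "(\<lambda>n. u w * of_real (h n (cis w))) \<longlonglongrightarrow> indicator K w * u w"
      proof cases
        case 1
        then have "infdist (cis w) C = 0" by (simp add: C_def)
        then have "h n (cis w) = 1" for n by (simp add: h_def)
        then show ?thesis using 1 by simp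
      next
        case 2
        then show ?thesis using supp by simp
      next
        case 3
        then have "cis w \<notin> C" using cis_image_notin[OF K(2)] by (simp add: C_def)
        then have pos: "infdist (cis w) C > 0" using C by (simp add: infdist_pos_not_in_closed)
        obtain n0 where n0: "1 < real n0 * infdist (cis w) C" using reals_Archimedean3[OF pos] by blast
        have "h n (cis w) = 0" if "n \<ge> n0" for n
        proof -
          have "real n0 * infdist (cis w) C \<le> real n * infdist (cis w) C"
            using that pos by (intro mult_right_mono) auto
          then show ?thesis using n0 by (simp add: h_def)
        qed
        then have "\<forall>\<^sub>F n in sequentially. u w * of_real (h n (cis w)) = 0"
          by (intro eventually_sequentiallyI[of n0]) simp
        then show ?thesis using 3 by (simp add: tendsto_eventually)
      qed
    qed
  qed measurable
  moreover have "(LINT w|lebesgue. u w * of_real (h n (cis w))) = 0" for n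
    by (rule integral_continuous_circle_zero[OF u coeff h])
  ultimately show ?thesis using LIMSEQ_unique tendsto_const by (metis (no_types, lifting) ext)
qed simp

lemma AE_nonpos_if_compact_integrals_zero:
  fixes v :: "real \<Rightarrow> real"
  assumes v: "integrable lebesgue v"
    and zero: "\<And>K. compact K \<Longrightarrow> K \<subseteq> {a<..<b} \<Longrightarrow> (LINT w|lebesgue. indicator K w * v w) = 0"
  shows "AE w in lebesgue. w \<in> {a<..<b} \<longrightarrow> v w \<le> 0"
proof -
  have [measurable]: "v \<in> borel_measurable lebesgue" using v by simp
  define S where "S = {w. v w > 0} \<inter> {a<..<b}"
  have Sm: "S \<in> sets lebesgue"
  proof -
    have "{w \<in> space lebesgue. v w > 0} \<in> sets lebesgue" by measurable
    moreover have "{a<..<b} \<in> sets lebesgue" by simp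
    ultimately show ?thesis unfolding S_def by (simp add: sets.Int)
  qed
  have "emeasure lebesgue S = 0"
  proof (rule ccontr)
    assume ne: "emeasure lebesgue S \<noteq> 0"
    have fin: "emeasure lebesgue S \<noteq> \<infinity>"
    proof -
      have "emeasure lebesgue S \<le> emeasure lebesgue {a..b}"
        by (intro emeasure_mono) (auto simp: S_def)
      then show ?thesis by (auto simp: top_unique emeasure_lborel_Icc_eq split: if_splits)
    qed
    define e where "e = enn2real (emeasure lebesgue S)"
    have e: "e > 0" "emeasure lebesgue S = ennreal e"
      using ne fin by (auto simp: e_def enn2real_positive_iff less_top zero_less_iff_neq_zero)
    obtain T where T: "closed T" "T \<subseteq> S" "S - T \<in> lmeasurable" "emeasure lebesgue (S - T) < ennreal e"
      using sets_lebesgue_inner_closed[OF Sm e(1)] by blast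
    have "T \<subseteq> {a..b}" using T(2) by (auto simp: S_def)
    then have Tc: "compact T" using T(1) compact_Int_closed[OF compact_Icc[of a b], of T] by (simp add: Int_absorb1)
    have Tm[measurable]: "T \<in> sets lebesgue" using T(1) by simp
    have Tz: "(LINT w|lebesgue. indicator T w * v w) = 0"
      by (rule zero[OF Tc]) (use T(2) in \<open>auto simp: S_def\<close>)
    have int: "integrable lebesgue (\<lambda>w. indicator T w * v w)"
      using integrable_mult_indicator[OF Tm v] by simp
    have pos: "w \<in> T \<Longrightarrow> 0 < v w" for w using T(2) by (auto simp: S_def)
    have "0 \<le> indicator T w * v w" for w using pos[of w] by (cases "w \<in> T") auto
    then have "AE w in lebesgue. indicator T w * v w = 0"
      using integral_nonneg_eq_0_iff_AE[OF int] Tz by blast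
    then have "AE w in lebesgue. w \<notin> T"
      by eventually_elim (metis indicator_simps(1) mult_1 pos less_irrefl)
    then have "emeasure lebesgue T = 0"
      using AE_iff_measurable[OF Tm, of "\<lambda>w. w \<notin> T"] by auto
    then have "emeasure lebesgue S \<le> emeasure lebesgue (S - T)"
      using emeasure_subadditive[of "S - T" lebesgue T] T(2) Sm Tm
      by (simp add: Un_absorb2 sets.Diff)
    then show False using T(4) e(2) by simp
  qed
  then have "AE w in lebesgue. w \<notin> S"
    using Sm by (intro AE_not_in) (auto simp: null_sets_def)
  then show ?thesis by eventually_elim (auto simp: S_def)
qed

lemma fourier_coefficients_unique:
  fixes u :: "real \<Rightarrow> complex"
  assumes u: "integrable lebesgue u" and supp: "\<And>w. w \<notin> {-pi..pi} \<Longrightarrow> u w = 0"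
    and coeff: "\<And>k::int. (LINT w|lebesgue. u w * cis (of_int k * w)) = 0"
  shows "AE w in lebesgue. u w = 0"
proof -
  have *: "AE w in lebesgue. w \<in> {-pi<..<pi} \<longrightarrow> Re (c * u w) \<le> 0" for c
  proof (rule AE_nonpos_if_compact_integrals_zero)
    show "integrable lebesgue (\<lambda>w. Re (c * u w))" using u by (intro integrable_Re integrable_mult_right)
    fix K :: "real set" assume K: "compact K" "K \<subseteq> {-pi<..<pi}"
    have Km: "K \<in> sets lebesgue" using K(1) by (simp add: compact_imp_closed)
    have int: "integrable lebesgue (\<lambda>w. c * (indicator K w * u w))"
    proof -
      have "integrable lebesgue (\<lambda>w. indicator K w *\<^sub>R u w)" by (rule integrable_mult_indicator[OF Km u])
      then show ?thesis by (simp add: indicator_scaleR_complex)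
    qed
    have "(LINT w|lebesgue. indicator K w * Re (c * u w)) = (LINT w|lebesgue. Re (c * (indicator K w * u w)))"
      by (rule Bochner_Integration.integral_cong) (auto simp: indicator_def)
    also have "\<dots> = Re (LINT w|lebesgue. c * (indicator K w * u w))"
      using integral_Re[OF int] by simp
    also have "\<dots> = 0"
      using integral_compact_zero[OF u supp coeff K] by simp
    finally show "(LINT w|lebesgue. indicator K w * Re (c * u w)) = 0" .
  qed
  have "AE w in lebesgue. w \<noteq> pi" "AE w in lebesgue. w \<noteq> -pi"
    by (intro AE_completion AE_lborel_singleton)+
  with *[of 1] *[of "-1"] *[of \<i>] *[of "-\<i>"] show ?thesis
  proof eventually_elim
    case (elim w)
    then show ?case using supp[of w] by (cases "w \<in> {-pi..pi}") (auto simp: complex_eq_iff)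
  qed
qed


definition circle_exp :: "int \<Rightarrow> real \<Rightarrow> complex" where
  "circle_exp k w = indicator {-pi..pi} w * cis (- (of_int k * w))"

lemma circle_exp_measurable: "circle_exp k \<in> borel_measurable lebesgue"
proof -
  have [measurable]: "{-pi..pi} \<in> sets lebesgue" by simp
  show ?thesis
    using cis_measurable_lebesgue[of "- of_int k"] unfolding circle_exp_def[abs_def] by simp
qed

lemma circle_exp_L2: "circle_exp k \<in> L2"
proof (rule L2_dominated[OF circle_exp_measurable])
  show "integrable lebesgue (indicat_real {-pi..pi})"
    by (auto simp: emeasure_lborel_Icc_eq)
  show "AE x in lebesgue. (cmod (circle_exp k x))\<^sup>2 \<le> indicat_real {-pi..pi} x"
    by (auto simp: circle_exp_def norm_mult indicator_def)
qed

lemma integral_circle_cis: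
  "(LINT w|lebesgue. indicator {-pi..pi} w * cis (of_int k * w)) = (if k = 0 then 2 * pi else 0)"
proof -
  have eq: "(LINT w|lebesgue. indicator {-pi..pi} w * cis (of_int k * w)) = integral {-pi..pi} (\<lambda>w. cis (of_int k * w))"
  proof -
    have "set_integrable lebesgue {-pi..pi} (\<lambda>w. cis (of_int k * w))"
      by (intro absolutely_integrable_continuous_real continuous_intros)
    from set_lebesgue_integral_eq_integral(2)[OF this] show ?thesis
      unfolding set_lebesgue_integral_def by (simp add: indicator_scaleR_complex)
  qed
  show ?thesis
  proof (cases "k = 0")
    case True
    then show ?thesis unfolding eq by (simp add: scaleR_conv_of_real)
  next
    case False
    have "((\<lambda>w. cis (of_int k * w)) has_integral
        (cis (of_int k * pi) / (\<i> * of_int k) - cis (of_int k * (-pi)) / (\<i> * of_int k))) {-pi..pi}"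
    proof (rule fundamental_theorem_of_calculus)
      fix w :: real
      have "((\<lambda>z. exp (\<i> * of_int k * z) / (\<i> * of_int k)) has_field_derivative exp (\<i> * of_int k * of_real w))
          (at (of_real w))"
        using False by (auto intro!: derivative_eq_intros)
      from has_vector_derivative_real_field[OF this]
      show "((\<lambda>w. cis (of_int k * w) / (\<i> * of_int k)) has_vector_derivative cis (of_int k * w)) (at w within {-pi..pi})"
        by (simp add: cis_conv_exp mult.assoc)
    qed simp
    moreover have "cis (of_int k * pi) = cis (of_int k * (-pi))"
      by (simp add: complex_eq_iff mult.commute[of _ pi])
    ultimately have "integral {-pi..pi} (\<lambda>w. cis (of_int k * w)) = 0"
      by (intro integral_unique) simp
    then show ?thesis unfolding eq using False by simp
  qed
qed

lemma circle_exp_orthogonal: "L2_inner (circle_exp k) (circle_exp l) = (if k = l then 2 * pi else 0)"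
proof -
  have "circle_exp k w * cnj (circle_exp l w) = indicator {-pi..pi} w * cis (of_int (l - k) * w)" for w
    by (auto simp: circle_exp_def indicator_def cis_cnj cis_mult algebra_simps)
  then show ?thesis unfolding L2_inner_def by (simp only: integral_circle_cis) simp
qed

lemma circle_exp_norm_sum:
  assumes "finite K"
  shows "(L2_norm (\<lambda>w. \<Sum>k\<in>K. c k * circle_exp k w))\<^sup>2 = 2 * pi * (\<Sum>k\<in>K. (cmod (c k))\<^sup>2)"
proof -
  have mem: "(\<lambda>w. \<Sum>k\<in>K. c k * circle_exp k w) \<in> L2"
    by (intro L2_sum L2_cmult circle_exp_L2)
  have "complex_of_real ((L2_norm (\<lambda>w. \<Sum>k\<in>K. c k * circle_exp k w))\<^sup>2) =
     (\<Sum>k\<in>K. c k * (\<Sum>l\<in>K. cnj (c l) * L2_inner (circle_exp k) (circle_exp l)))"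
    unfolding L2_inner_self[symmetric]
    by (subst L2_inner_sum_left[OF circle_exp_L2 mem], subst L2_inner_sum_right[OF circle_exp_L2 circle_exp_L2]) simp
  also have "\<dots> = (\<Sum>k\<in>K. c k * (cnj (c k) * (2 * pi)))"
    using assms by (simp add: circle_exp_orthogonal if_distrib cong: if_cong)
  also have "\<dots> = of_real (2 * pi * (\<Sum>k\<in>K. (cmod (c k))\<^sup>2))"
    by (simp add: sum_distrib_left complex_norm_square mult_ac del: of_real_power)
  finally show ?thesis by (simp only: of_real_eq_iff)
qed

lemma circle_exp_upper_bound_system: "upper_bound_system (2 * pi) circle_exp"
  unfolding upper_bound_system_def by (simp add: circle_exp_L2 circle_exp_norm_sum)

lemma L2_cut:
  assumes "f \<in> L2" "A \<in> sets lebesgue"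
  shows "(\<lambda>w. indicator A w * f w) \<in> L2" "L2_norm (\<lambda>w. indicator A w * f w) \<le> L2_norm f"
  using L2_mult_bounded[OF assms(1), of "indicator A" 1] assms(2)
  by (auto simp: indicator_def)

lemma circle_Riesz_Fischer:
  fixes c :: "int \<Rightarrow> complex"
  assumes c: "square_summable c"
  obtains C r where "C \<in> L2" "\<And>w. w \<notin> {-pi..pi} \<Longrightarrow> C w = 0"
    "(\<lambda>N. L2_norm (\<lambda>w. C w - partial_sum c circle_exp N w)) \<longlonglongrightarrow> 0"
    "\<And>k. L2_inner C (circle_exp k) = of_real (2 * pi) * c k"
    "strict_mono r" "AE w in lebesgue. (\<lambda>n. partial_sum c circle_exp (r n) w) \<longlonglongrightarrow> C w"
proof -
  let ?u = "partial_sum c circle_exp"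
  let ?I = "{-pi..pi}"
  have mem: "?u N \<in> L2" for N by (intro partial_sum_L2 circle_exp_L2)
  obtain D r where D: "D \<in> L2" "(\<lambda>N. L2_norm (\<lambda>w. D w - ?u N w)) \<longlonglongrightarrow> 0" "strict_mono r"
     "AE w in lebesgue. (\<lambda>n. ?u (r n) w) \<longlonglongrightarrow> D w"
    using L2_complete[OF mem upper_bound_system_Cauchy[OF circle_exp_upper_bound_system c]] by blast
  have cut: "indicator ?I w * ?u N w = ?u N w" for N w
    by (auto simp: partial_sum_def circle_exp_def indicator_def)
  define C where "C = (\<lambda>w. indicator ?I w * D w)"
  have C: "C \<in> L2" unfolding C_def by (intro L2_cut D) simp
  have "C w - ?u N w = indicator ?I w * (D w - ?u N w)" for N w
    using cut[of w N] unfolding C_def by (simp add: right_diff_distrib)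
  then have le: "L2_norm (\<lambda>w. C w - ?u N w) \<le> L2_norm (\<lambda>w. D w - ?u N w)" for N
    using L2_cut(2)[OF L2_diff[OF D(1) mem], of ?I N] by simp
  have lim: "(\<lambda>N. L2_norm (\<lambda>w. C w - ?u N w)) \<longlonglongrightarrow> 0"
    by (rule tendsto_sandwich[OF _ _ tendsto_const D(2)]) (auto simp: le)
  have inner: "L2_inner C (circle_exp k) = of_real (2 * pi) * c k" for k
  proof (rule LIMSEQ_unique)
    show "(\<lambda>N. L2_inner (?u N) (circle_exp k)) \<longlonglongrightarrow> L2_inner C (circle_exp k)"
      by (rule tendsto_L2_inner_left[OF mem C circle_exp_L2 lim])
    have "L2_inner (?u N) (circle_exp k) = of_real (2 * pi) * c k" if "N \<ge> nat \<bar>k\<bar>" for N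
    proof -
      have "L2_inner (?u N) (circle_exp k) = (\<Sum>l\<in>{- int N..int N}. c l * L2_inner (circle_exp l) (circle_exp k))"
        unfolding partial_sum_def by (rule L2_inner_sum_left[OF circle_exp_L2 circle_exp_L2])
      also have "\<dots> = of_real (2 * pi) * c k"
        using that by (auto simp: circle_exp_orthogonal if_distrib cong: if_cong)
      finally show ?thesis .
    qed
    then show "(\<lambda>N. L2_inner (?u N) (circle_exp k)) \<longlonglongrightarrow> of_real (2 * pi) * c k"
      by (intro tendsto_eventually eventually_sequentiallyI)
  qed
  have "AE w in lebesgue. (\<lambda>n. ?u (r n) w) \<longlonglongrightarrow> C w"
    using D(4)
  proof eventually_elim
    case (elim w)
    from tendsto_mult_left[OF this, of "indicator ?I w"] show ?case by (simp add: cut C_def)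
  qed
  moreover have "C w = 0" if "w \<notin> ?I" for w using that by (simp add: C_def)
  ultimately show ?thesis using that[OF C _ lim inner D(3)] by blast
qed

lemma circle_inner_eq_0:
  assumes u: "u \<in> L2" "\<And>w. w \<notin> {-pi..pi} \<Longrightarrow> u w = 0"
    and zero: "\<And>k. L2_inner u (circle_exp k) = 0"
  shows "AE w in lebesgue. u w = 0"
proof (rule fourier_coefficients_unique)
  have eq: "u w * cnj (circle_exp k w) = u w * cis (of_int k * w)" for k w
    using u(2)[of w] by (auto simp: circle_exp_def indicator_def cis_cnj)
  have "(\<lambda>w. u w * cnj (circle_exp 0 w)) = u" unfolding eq by simp
  then show "integrable lebesgue u"
    using L2_inner_integrable[OF u(1) circle_exp_L2[of 0]] by (simp only:)
  show "(LINT w|lebesgue. u w * cis (of_int k * w)) = 0" for k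
    using zero[of k] unfolding L2_inner_def eq .
qed (use u in auto)

lemma circle_Parseval:
  assumes u: "u \<in> L2" "\<And>w. w \<notin> {-pi..pi} \<Longrightarrow> u w = 0"
  defines "c \<equiv> \<lambda>k. L2_inner u (circle_exp k) / (2 * pi)"
  shows "square_summable c"
    and "(\<lambda>N. L2_norm (\<lambda>w. u w - partial_sum c circle_exp N w)) \<longlonglongrightarrow> 0"
    and "\<exists>r. strict_mono r \<and> (AE w in lebesgue. (\<lambda>n. partial_sum c circle_exp (r n) w) \<longlonglongrightarrow> u w)"
    and "((\<lambda>k. (cmod (L2_inner u (circle_exp k)))\<^sup>2) has_sum (2 * pi * (L2_norm u)\<^sup>2)) UNIV"
proof -
  let ?S = "partial_sum c circle_exp"
  have sq: "(\<lambda>k. (cmod (L2_inner u (circle_exp k)))\<^sup>2) summable_on UNIV"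
    using upper_bound_system_Bessel[OF circle_exp_upper_bound_system u(1)] by (simp add: square_summable_def)
  have csq: "(cmod (c k))\<^sup>2 = (cmod (L2_inner u (circle_exp k)))\<^sup>2 * (1 / (2 * pi)\<^sup>2)" for k
    by (simp add: c_def norm_divide power_divide norm_mult)
  show c: "square_summable c"
    unfolding square_summable_def csq by (intro summable_on_cmult_left sq)
  obtain C r where C: "C \<in> L2" "\<And>w. w \<notin> {-pi..pi} \<Longrightarrow> C w = 0"
    "(\<lambda>N. L2_norm (\<lambda>w. C w - ?S N w)) \<longlonglongrightarrow> 0"
    "\<And>k. L2_inner C (circle_exp k) = of_real (2 * pi) * c k"
    "strict_mono r" "AE w in lebesgue. (\<lambda>n. ?S (r n) w) \<longlonglongrightarrow> C w"
    using circle_Riesz_Fischer[OF c] by blast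
  have mem: "?S N \<in> L2" for N by (intro partial_sum_L2 circle_exp_L2)
  have ae: "AE w in lebesgue. u w - C w = 0"
  proof (rule circle_inner_eq_0)
    show "L2_inner (\<lambda>w. u w - C w) (circle_exp k) = 0" for k
      using C(4) by (simp add: L2_inner_diff_left u C circle_exp_L2 c_def)
  qed (use u C in \<open>auto intro: L2_diff\<close>)
  have eq: "L2_norm (\<lambda>w. u w - ?S N w) = L2_norm (\<lambda>w. C w - ?S N w)" for N
    by (rule L2_norm_cong_AE) (use ae u(1) C(1) mem in \<open>auto intro: L2_measurable L2_diff\<close>)
  show lim: "(\<lambda>N. L2_norm (\<lambda>w. u w - ?S N w)) \<longlonglongrightarrow> 0"
    unfolding eq by (rule C(3))
  have "AE w in lebesgue. (\<lambda>n. ?S (r n) w) \<longlonglongrightarrow> u w"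
    using ae C(6) by eventually_elim simp
  then show "\<exists>r. strict_mono r \<and> (AE w in lebesgue. (\<lambda>n. ?S (r n) w) \<longlonglongrightarrow> u w)"
    using C(5) by blast
  have "(\<lambda>N. (L2_norm (?S N))\<^sup>2) \<longlonglongrightarrow> (L2_norm u)\<^sup>2"
    by (intro tendsto_power tendsto_L2_norm[OF mem u(1) lim])
  moreover have "(L2_norm (?S N))\<^sup>2 = (\<Sum>k\<in>{- int N..int N}. (cmod (L2_inner u (circle_exp k)))\<^sup>2) / (2 * pi)" for N
    unfolding partial_sum_def[abs_def]
    unfolding circle_exp_norm_sum[OF finite_atLeastAtMost_int] csq sum_distrib_right[symmetric]
    by (simp add: power2_eq_square)
  ultimately have "(\<lambda>N. (\<Sum>k\<in>{- int N..int N}. (cmod (L2_inner u (circle_exp k)))\<^sup>2) / (2 * pi)) \<longlonglongrightarrow> (L2_norm u)\<^sup>2"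
    by simp
  from tendsto_mult_left[OF this, of "2 * pi"]
  have "(\<lambda>N. \<Sum>k\<in>{- int N..int N}. (cmod (L2_inner u (circle_exp k)))\<^sup>2) \<longlonglongrightarrow> 2 * pi * (L2_norm u)\<^sup>2"
    by simp
  from LIMSEQ_unique[OF this has_sum_imp_symmetric_limit[OF has_sum_infsum[OF sq]]]
  show "((\<lambda>k. (cmod (L2_inner u (circle_exp k)))\<^sup>2) has_sum (2 * pi * (L2_norm u)\<^sup>2)) UNIV"
    using has_sum_infsum[OF sq] by simp
qed

section \<open>Affine substitutions and periodization\<close>

lemma borel_measurable_lebesgue_affine:
  fixes c :: real
  assumes "f \<in> borel_measurable lebesgue" "c \<noteq> 0"
  shows "(\<lambda>x. f (t + c * x)) \<in> borel_measurable lebesgue"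
proof -
  have "(\<lambda>x. t + c * x) \<in> lebesgue \<rightarrow>\<^sub>M lebesgue"
    using lebesgue_affine_measurable[where c = "\<lambda>x::real. c"] assms(2) by simp
  from measurable_compose[OF this assms(1)] show ?thesis .
qed

lemma AE_lebesgue_affine:
  fixes c :: real
  assumes "AE x in lebesgue. P x" "c \<noteq> 0"
  shows "AE x in lebesgue. P (t + c * x)"
proof -
  obtain N where N: "{x. \<not> P x} \<subseteq> N" "N \<in> null_sets lebesgue"
    using assms(1) unfolding eventually_ae_filter by auto
  have m: "(indicator N :: real \<Rightarrow> ennreal) \<in> borel_measurable lebesgue"
    using N(2) by (intro borel_measurable_indicator) auto
  have "(\<integral>\<^sup>+x. indicator N x \<partial>lebesgue) = 0"
    using N(2) by (subst nn_integral_indicator) auto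
  then have "(\<integral>\<^sup>+x. indicator N (t + c * x) \<partial>lebesgue) = 0"
    using nn_integral_real_affine_lebesgue[OF m assms(2), of t] assms(2) by simp
  then have "AE x in lebesgue. indicator N (t + c * x) = (0::ennreal)"
    using nn_integral_0_iff_AE[OF borel_measurable_lebesgue_affine[OF m assms(2), of t]] by simp
  then show ?thesis
    by eventually_elim (use N(1) in \<open>auto simp: indicator_def split: if_splits\<close>)
qed

lemma L2_affine:
  assumes f: "f \<in> L2" and c: "c \<noteq> 0"
  shows "(\<lambda>x. f (t + c * x)) \<in> L2"
  using borel_measurable_lebesgue_affine[OF L2_measurable[OF f] c]
    lebesgue_integrable_real_affine_iff[OF c, of "\<lambda>x. (cmod (f x))\<^sup>2" t] L2_integrable_sq[OF f]
  by (simp add: L2_def)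

lemma L2_norm_affine:
  assumes c: "c \<noteq> 0"
  shows "(L2_norm (\<lambda>x. f (t + c * x)))\<^sup>2 = (L2_norm f)\<^sup>2 / \<bar>c\<bar>"
  using lebesgue_integral_real_affine[OF c, of "\<lambda>x. (cmod (f x))\<^sup>2" t] c
  by (simp add: L2_norm_sq)

lemma L2_inner_affine:
  assumes c: "c \<noteq> 0"
  shows "L2_inner (\<lambda>x. f (t + c * x)) (\<lambda>x. g (t + c * x)) = L2_inner f g / of_real \<bar>c\<bar>"
  using lebesgue_integral_real_affine[OF c, of "\<lambda>x. f x * cnj (g x)" t] c
  by (simp add: L2_inner_def scaleR_conv_of_real)

lemma bij_int_decode: "bij int_decode"
  by (rule o_bij[of int_encode]) (auto simp: fun_eq_iff)

lemma unique_period_index: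
  fixes p :: real
  assumes p: "p > 0"
  shows "\<exists>!k::int. x - p * of_int k \<in> {a..<a+p}"
proof (rule ex1I)
  define k where "k = \<lfloor>(x - a) / p\<rfloor>"
  have "of_int k \<le> (x - a) / p" "(x - a) / p < of_int k + 1" unfolding k_def by linarith+
  then have "of_int k * p \<le> x - a" "x - a < (of_int k + 1) * p"
    using p by (simp_all only: pos_le_divide_eq pos_divide_less_eq)
  then show "x - p * of_int \<lfloor>(x - a) / p\<rfloor> \<in> {a..<a+p}"
    by (simp add: k_def[symmetric] algebra_simps)
  fix k :: int assume "x - p * of_int k \<in> {a..<a+p}"
  then have "of_int k \<le> (x - a) / p" "(x - a) / p < of_int k + 1"
    using p by (simp_all add: field_simps)
  then show "k = \<lfloor>(x - a) / p\<rfloor>" by linarith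
qed

lemma nn_integral_periodize:
  fixes G :: "real \<Rightarrow> ennreal" and p :: real
  assumes G: "G \<in> borel_measurable lebesgue" and p: "p > 0"
  shows "(\<integral>\<^sup>+x. G x \<partial>lebesgue) =
    (\<Sum>n. \<integral>\<^sup>+w. indicator {a..<a+p} w * G (w + p * of_int (int_decode n)) \<partial>lebesgue)"
proof -
  let ?J = "\<lambda>n x. indicator {a..<a+p} (x - p * of_int (int_decode n)) :: ennreal"
  have m: "(\<lambda>x. ?J n x * G x) \<in> borel_measurable lebesgue" for n
  proof -
    have "(indicator {a..<a+p} :: real \<Rightarrow> ennreal) \<in> borel_measurable lebesgue"
      by (intro borel_measurable_indicator) simp
    from borel_measurable_lebesgue_affine[OF this, of 1 "- p * of_int (int_decode n)"]
    show ?thesis using G by simp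
  qed
  have one: "(\<Sum>n. ?J n x * G x) = G x" for x
  proof -
    obtain k where k: "x - p * of_int k \<in> {a..<a+p}" "\<And>l. x - p * of_int l \<in> {a..<a+p} \<Longrightarrow> l = k"
      using unique_period_index[OF p, of x a] by blast
    have "(\<Sum>n. ?J n x * G x) = (\<Sum>n\<in>{int_encode k}. ?J n x * G x)"
    proof (rule suminf_finite)
      fix n assume "n \<notin> {int_encode k}"
      then have "int_decode n \<noteq> k" by auto
      then show "?J n x * G x = 0" using k(2)[of "int_decode n"] by (auto simp: indicator_def)
    qed simp
    then show ?thesis using k(1) by simp
  qed
  have "(\<integral>\<^sup>+x. G x \<partial>lebesgue) = (\<integral>\<^sup>+x. (\<Sum>n. ?J n x * G x) \<partial>lebesgue)"
    by (simp only: one)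
  also have "\<dots> = (\<Sum>n. \<integral>\<^sup>+x. ?J n x * G x \<partial>lebesgue)"
    by (rule nn_integral_suminf[OF m])
  also have "\<dots> = (\<Sum>n. \<integral>\<^sup>+w. indicator {a..<a+p} w * G (w + p * of_int (int_decode n)) \<partial>lebesgue)"
  proof (rule suminf_cong)
    fix n
    show "(\<integral>\<^sup>+x. ?J n x * G x \<partial>lebesgue) = (\<integral>\<^sup>+w. indicator {a..<a+p} w * G (w + p * of_int (int_decode n)) \<partial>lebesgue)"
      using nn_integral_real_affine_lebesgue[OF m, of 1 n "p * of_int (int_decode n)"] by (simp add: add.commute)
  qed
  finally show ?thesis .
qed

lemma has_sum_int_imp_sums:
  fixes f :: "int \<Rightarrow> 'a :: {comm_monoid_add, topological_space}"
  assumes "(f has_sum s) UNIV"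
  shows "(\<lambda>n. f (int_decode n)) sums s"
  using assms by (intro has_sum_imp_sums) (simp only: has_sum_reindex_bij_betw[OF bij_int_decode])

lemma integral_periodize:
  fixes H :: "real \<Rightarrow> complex" and p :: real
  assumes H: "integrable lebesgue H" and p: "p > 0"
  shows "AE w in lebesgue. w \<in> {a..<a+p} \<longrightarrow> (\<lambda>k::int. norm (H (w + p * of_int k))) summable_on UNIV" (is ?A)
    and "integrable lebesgue (\<lambda>w. indicator {a..<a+p} w * (\<Sum>\<^sub>\<infinity>k::int. H (w + p * of_int k)))" (is ?B)
    and "(LINT w|lebesgue. indicator {a..<a+p} w * (\<Sum>\<^sub>\<infinity>k::int. H (w + p * of_int k))) = (LINT x|lebesgue. H x)" (is ?C)
proof -
  let ?I = "{a..<a+p}"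
  let ?k = "\<lambda>n. p * of_int (int_decode n)"
  define h where "h = (\<lambda>n w. indicator ?I w * H (w + ?k n))"
  define g where "g = (\<lambda>n x. indicator ?I (x - ?k n) * H x)"
  have gh: "g n (?k n + 1 * w) = h n w" for n w
    by (simp add: g_def h_def add.commute)
  have Hm[measurable]: "H \<in> borel_measurable lebesgue" using H by simp
  have hm[measurable]: "h n \<in> borel_measurable lebesgue" for n
  proof -
    have "(\<lambda>w. H (w + ?k n)) \<in> borel_measurable lebesgue"
      using borel_measurable_lebesgue_affine[OF Hm, of 1 "?k n"] by (simp add: add.commute)
    moreover have "(indicator ?I :: real \<Rightarrow> complex) \<in> borel_measurable lebesgue"
      by (intro borel_measurable_indicator) simp
    ultimately show ?thesis unfolding h_def by (rule borel_measurable_times[rotated])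
  qed
  define N where "N = (\<lambda>n. \<integral>\<^sup>+w. ennreal (norm (h n w)) \<partial>lebesgue)"
  have N: "N n = (\<integral>\<^sup>+w. indicator ?I w * ennreal (norm (H (w + ?k n))) \<partial>lebesgue)" for n
    unfolding N_def h_def by (rule nn_integral_cong) (simp add: indicator_def)
  have "(\<integral>\<^sup>+x. ennreal (norm (H x)) \<partial>lebesgue) = suminf N"
    unfolding N by (rule nn_integral_periodize[OF _ p]) measurable
  then have fin: "suminf N \<noteq> \<infinity>"
    using H by (auto simp: integrable_iff_bounded)
  have Nfin: "N n < \<infinity>" for n
  proof -
    have "(\<Sum>i\<in>{n}. N i) \<le> suminf N" by (rule sum_le_suminf) auto
    then show ?thesis using fin by (auto simp: less_top[symmetric] top_unique)
  qed
  have hint: "integrable lebesgue (h n)" for n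
    by (rule integrableI_bounded[OF hm]) (use Nfin in \<open>simp add: N_def\<close>)
  have "(\<integral>\<^sup>+w. (\<Sum>n. ennreal (norm (h n w))) \<partial>lebesgue) = suminf N"
    unfolding N_def by (rule nn_integral_suminf) measurable
  then have "AE w in lebesgue. (\<Sum>n. ennreal (norm (h n w))) \<noteq> \<infinity>"
    using fin by (intro nn_integral_PInf_AE) auto
  then have summ: "AE w in lebesgue. summable (\<lambda>n. norm (h n w))"
    by eventually_elim (rule summable_suminf_not_top, auto)
  have "N = (\<lambda>n. ennreal (LINT w|lebesgue. norm (h n w)))"
    unfolding N_def by (rule ext, rule nn_integral_eq_integral) (use hint in auto)
  then have summ_int: "summable (\<lambda>n. LINT w|lebesgue. norm (h n w))"
    using fin by (intro summable_suminf_not_top) auto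
  have inf_eq: "(\<Sum>n. h n w) = indicator ?I w * (\<Sum>\<^sub>\<infinity>k::int. H (w + p * of_int k)) \<and>
      (w \<in> ?I \<longrightarrow> (\<lambda>k::int. norm (H (w + p * of_int k))) summable_on UNIV)"
    if "summable (\<lambda>n. norm (h n w))" for w
  proof (cases "w \<in> ?I")
    case True
    then have hw: "h n w = H (w + ?k n)" for n by (simp only: h_def indicator_simps mult_1)
    have "(\<lambda>n. norm (H (w + ?k n))) summable_on UNIV"
      using that unfolding hw by (subst summable_on_UNIV_nonneg_real_iff) auto
    then have abs: "(\<lambda>k::int. norm (H (w + p * of_int k))) summable_on UNIV"
      by (simp only: summable_on_reindex_bij_betw[OF bij_int_decode, of "\<lambda>k. norm (H (w + p * of_int k))"])
    have "(\<lambda>n. H (w + ?k n)) sums (\<Sum>\<^sub>\<infinity>k::int. H (w + p * of_int k))"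
      by (rule has_sum_int_imp_sums[OF has_sum_infsum[OF abs_summable_summable[OF abs]]])
    then have "(\<Sum>n. h n w) = (\<Sum>\<^sub>\<infinity>k::int. H (w + p * of_int k))"
      unfolding hw by (rule sums_unique[symmetric])
    then show ?thesis using True abs by simp
  next
    case False
    then show ?thesis by (auto simp: h_def)
  qed
  show ?A using summ by eventually_elim (rule conjunct2[OF inf_eq])
  have ae: "AE w in lebesgue. (\<Sum>n. h n w) = indicator ?I w * (\<Sum>\<^sub>\<infinity>k::int. H (w + p * of_int k))"
    using summ by eventually_elim (rule conjunct1[OF inf_eq])
  have int: "integrable lebesgue (\<lambda>w. \<Sum>n. h n w)"
    by (rule integrable_suminf[OF hint summ summ_int])
  have meas: "(\<lambda>w. indicator ?I w * (\<Sum>\<^sub>\<infinity>k::int. H (w + p * of_int k))) \<in> borel_measurable lebesgue"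
    by (rule borel_measurable_AE[OF borel_measurable_integrable[OF int] ae])
  show ?B by (rule integrable_cong_AE_imp[OF int meas ae])
  have "(LINT w|lebesgue. indicator ?I w * (\<Sum>\<^sub>\<infinity>k::int. H (w + p * of_int k))) = (LINT w|lebesgue. (\<Sum>n. h n w))"
    using ae by (intro integral_cong_AE meas borel_measurable_integrable[OF int]) auto
  also have "\<dots> = (\<Sum>n. LINT w|lebesgue. h n w)"
    by (rule integral_suminf[OF hint summ summ_int])
  also have "(\<lambda>n. LINT w|lebesgue. h n w) = (\<lambda>n. LINT x|lebesgue. g n x)"
  proof
    fix n
    show "(LINT w|lebesgue. h n w) = (LINT x|lebesgue. g n x)"
      using lebesgue_integral_real_affine[OF one_neq_zero, of "g n" "?k n"]
      by (simp only: gh abs_one scaleR_one)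
  qed
  also have "(\<Sum>n. LINT x|lebesgue. g n x) = (LINT x|lebesgue. (\<Sum>n. g n x))"
  proof (rule integral_suminf[symmetric])
    show gint: "integrable lebesgue (g n)" for n
      using lebesgue_integrable_real_affine_iff[OF one_neq_zero, of "g n" "?k n"] hint[of n] by (simp only: gh)
    have "(LINT x|lebesgue. norm (g n x)) = (LINT w|lebesgue. norm (h n w))" for n
      using lebesgue_integral_real_affine[OF one_neq_zero, of "\<lambda>x. norm (g n x)" "?k n"]
      by (simp only: gh abs_one scaleR_one)
    then show "summable (\<lambda>n. LINT x|lebesgue. norm (g n x))" using summ_int by (simp only:)
    show "AE x in lebesgue. summable (\<lambda>n. norm (g n x))"
    proof (rule AE_I2)
      fix x
      obtain k where k: "\<And>l. x - p * of_int l \<in> ?I \<Longrightarrow> l = k"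
        using unique_period_index[OF p, of x a] by blast
      show "summable (\<lambda>n. norm (g n x))"
      proof (rule summable_finite)
        fix n assume "n \<notin> {int_encode k}"
        then have "int_decode n \<noteq> k" by auto
        then have "x - ?k n \<notin> ?I" using k by blast
        then show "norm (g n x) = 0" by (simp add: g_def)
      qed simp
    qed
  qed
  also have "(\<lambda>x. \<Sum>n. g n x) = H"
  proof
    fix x
    obtain k where k: "x - p * of_int k \<in> ?I" "\<And>l. x - p * of_int l \<in> ?I \<Longrightarrow> l = k"
      using unique_period_index[OF p, of x a] by blast
    have "(\<Sum>n. g n x) = (\<Sum>n\<in>{int_encode k}. g n x)"
    proof (rule suminf_finite)
      fix n assume "n \<notin> {int_encode k}"
      then have "int_decode n \<noteq> k" by auto
      then have "x - ?k n \<notin> ?I" using k(2) by blast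
      then show "g n x = 0" by (simp add: g_def)
    qed simp
    also have "\<dots> = H x" using k(1) by (simp add: g_def)
    finally show "(\<Sum>n. g n x) = H x" .
  qed
  finally show ?C .
qed

section \<open>The Fourier transform on \<open>L\<^sup>2\<close>\<close>

definition fourier_integral :: "(real \<Rightarrow> complex) \<Rightarrow> real \<Rightarrow> complex" where
  "fourier_integral f w = (LINT x|lebesgue. f x * cis (- (w * x)))"

lemma cis_measurable_lebesgue' [measurable]: "(\<lambda>x. cis (- (a * x))) \<in> borel_measurable lebesgue"
  using cis_measurable_lebesgue[of "-a"] by simp

lemma integrable_mult_cis:
  assumes "integrable lebesgue f"
  shows "integrable lebesgue (\<lambda>x. f x * cis (- (a * x)))"
proof -
  have [measurable]: "f \<in> borel_measurable lebesgue" using assms by simp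
  show ?thesis
    by (rule Bochner_Integration.integrable_bound[OF assms]) (auto simp: norm_mult)
qed

lemma L2_mult_cis:
  assumes "f \<in> L2"
  shows "(\<lambda>x. cis (- (a * x)) * f x) \<in> L2"
  by (rule L2_mult_bounded(1)[OF assms, where K = 1]) auto

lemma fourier_integral_measurable:
  assumes f: "integrable lebesgue f"
  shows "fourier_integral f \<in> borel_measurable lebesgue"
proof -
  have [measurable]: "f \<in> borel_measurable lebesgue" using f by simp
  have "isCont (fourier_integral f) w" for w
    unfolding continuous_at_sequentially comp_def
  proof (intro allI impI)
    fix v assume v: "v \<longlonglongrightarrow> w"
    show "(\<lambda>n. fourier_integral f (v n)) \<longlonglongrightarrow> fourier_integral f w"
      unfolding fourier_integral_def
    proof (rule integral_dominated_convergence)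
      show "integrable lebesgue (\<lambda>x. norm (f x))" using f by simp
      show "AE x in lebesgue. (\<lambda>n. f x * cis (- (v n * x))) \<longlonglongrightarrow> f x * cis (- (w * x))"
        by (intro AE_I2 tendsto_intros v)
    qed (auto simp: norm_mult)
  qed
  then have "continuous_on UNIV (fourier_integral f)" by (simp add: continuous_at_imp_continuous_on)
  then show ?thesis by (intro measurable_completion) (simp add: borel_measurable_continuous_onI)
qed

lemma L2_integrable_compact_support:
  assumes u: "u \<in> L2" "\<And>x. x \<notin> {a..b} \<Longrightarrow> u x = 0"
  shows "integrable lebesgue u"
proof -
  have [measurable]: "{a..b} \<in> sets lebesgue" by simp
  have "(\<lambda>x. indicator {a..b} x :: complex) \<in> L2"
  proof (rule L2_dominated)
    show "(\<lambda>x. indicator {a..b} x :: complex) \<in> borel_measurable lebesgue"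
      by (intro borel_measurable_indicator) simp
    show "integrable lebesgue (indicat_real {a..b})"
      by (auto simp: emeasure_lborel_Icc_eq)
  qed (auto simp: indicator_def)
  from L2_integrable_mult[OF u(1) this]
  have "integrable lebesgue (\<lambda>x. u x * indicator {a..b} x)" .
  moreover have "(\<lambda>x. u x * indicator {a..b} x) = u"
    using u(2) by (fastforce simp: indicator_def)
  ultimately show ?thesis by simp
qed

text \<open>For each shift \<open>t\<close>, Parseval on the circle evaluates the sum of the squares of the transform
  over \<open>t + \<int>\<close>; integrating over a period of \<open>t\<close> gives Plancherel.\<close>

lemma Plancherel_circle:
  assumes f: "f \<in> L2" "\<And>x. x \<notin> {-pi..pi} \<Longrightarrow> f x = 0"
  shows "fourier_integral f \<in> L2" "(L2_norm (fourier_integral f))\<^sup>2 = 2 * pi * (L2_norm f)\<^sup>2"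
proof -
  have fi: "integrable lebesgue f" by (rule L2_integrable_compact_support[OF f])
  note m[measurable] = fourier_integral_measurable[OF fi]
  have "((\<lambda>k. (cmod (fourier_integral f (t + of_int k)))\<^sup>2) has_sum (2 * pi * (L2_norm f)\<^sup>2)) UNIV" for t
  proof -
    let ?u = "\<lambda>x. cis (- (t * x)) * f x"
    have u: "?u \<in> L2" by (rule L2_mult_cis[OF f(1)])
    have inner: "L2_inner ?u (circle_exp k) = fourier_integral f (t + of_int (- k))" for k
    proof -
      have "?u x * cnj (circle_exp k x) = f x * cis (- ((t + of_int (- k)) * x))" for x
        using f(2)[of x] by (cases "x \<in> {-pi..pi}") (auto simp: circle_exp_def cis_cnj cis_mult algebra_simps)
      then show ?thesis unfolding L2_inner_def fourier_integral_def by (simp only:)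
    qed
    have n: "L2_norm ?u = L2_norm f" by (simp add: L2_norm_def norm_mult)
    have "((\<lambda>k. (cmod (fourier_integral f (t + of_int (- k))))\<^sup>2) has_sum (2 * pi * (L2_norm f)\<^sup>2)) UNIV"
      using circle_Parseval(4)[OF u] f(2) unfolding inner n by simp
    then show ?thesis
      using has_sum_reindex_bij_betw[OF bij_uminus, of "\<lambda>k. (cmod (fourier_integral f (t + of_int k)))\<^sup>2"] by simp
  qed
  then have "((\<lambda>n. (cmod (fourier_integral f (t + of_int (int_decode n))))\<^sup>2) has_sum (2 * pi * (L2_norm f)\<^sup>2)) UNIV" for t
    using has_sum_reindex_bij_betw[OF bij_int_decode, of "\<lambda>k. (cmod (fourier_integral f (t + of_int k)))\<^sup>2"] by simp
  then have sums: "(\<Sum>n. ennreal ((cmod (fourier_integral f (t + of_int (int_decode n))))\<^sup>2)) = ennreal (2 * pi * (L2_norm f)\<^sup>2)" for t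
    by (intro suminf_ennreal_eq has_sum_imp_sums) auto
  have "(\<integral>\<^sup>+w. ennreal ((cmod (fourier_integral f w))\<^sup>2) \<partial>lebesgue) =
    (\<Sum>n. \<integral>\<^sup>+w. indicator {0..<0+1} w * ennreal ((cmod (fourier_integral f (w + 1 * of_int (int_decode n))))\<^sup>2) \<partial>lebesgue)"
    by (rule nn_integral_periodize) auto
  also have "\<dots> = (\<integral>\<^sup>+w. (\<Sum>n. indicator {0..<0+1} w * ennreal ((cmod (fourier_integral f (w + 1 * of_int (int_decode n))))\<^sup>2)) \<partial>lebesgue)"
  proof (rule nn_integral_suminf[symmetric])
    fix n
    have [measurable]: "(\<lambda>w. fourier_integral f (w + 1 * of_int (int_decode n))) \<in> borel_measurable lebesgue"
      using borel_measurable_lebesgue_affine[OF m, of 1 "of_int (int_decode n)"] by (simp add: add.commute)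
    have [measurable]: "{0..<0+1::real} \<in> sets lebesgue" by simp
    show "(\<lambda>w. indicator {0..<0+1} w * ennreal ((cmod (fourier_integral f (w + 1 * of_int (int_decode n))))\<^sup>2)) \<in> borel_measurable lebesgue"
      by measurable
  qed
  also have "\<dots> = (\<integral>\<^sup>+w. ennreal (2 * pi * (L2_norm f)\<^sup>2) * indicator {0..<1::real} w \<partial>lebesgue)"
    by (simp add: sums mult.commute)
  also have "\<dots> = ennreal (2 * pi * (L2_norm f)\<^sup>2)"
    by (subst nn_integral_cmult_indicator) auto
  finally have nn: "(\<integral>\<^sup>+w. ennreal ((cmod (fourier_integral f w))\<^sup>2) \<partial>lebesgue) = ennreal (2 * pi * (L2_norm f)\<^sup>2)" .
  then have "integrable lebesgue (\<lambda>w. (cmod (fourier_integral f w))\<^sup>2)"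
    by (intro integrableI_bounded) auto
  then show mem: "fourier_integral f \<in> L2" using m by (simp add: L2_def)
  show "(L2_norm (fourier_integral f))\<^sup>2 = 2 * pi * (L2_norm f)\<^sup>2"
    using nn nn_integral_eq_integral[OF L2_integrable_sq[OF mem]]
    by (simp add: L2_norm_sq ennreal_inj flip: L2_norm_sq)
qed

lemma fourier_integral_dilate:
  assumes "c > 0"
  shows "fourier_integral (\<lambda>x. f (c * x)) w = fourier_integral f (w / c) / of_real c"
  using lebesgue_integral_real_affine[of c "\<lambda>x. f x * cis (- (w / c * x))" 0] assms
  by (simp add: fourier_integral_def scaleR_conv_of_real)

lemma fourier_integral_translate:
  "fourier_integral (\<lambda>x. f (x - a)) w = cis (- (a * w)) * fourier_integral f w"
proof -
  have eq: "f x * cis (- (w * (x + a))) = cis (- (a * w)) * (f x * cis (- (w * x)))" for x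
    by (simp add: cis_mult algebra_simps)
  show ?thesis
    using lebesgue_integral_real_affine[of 1 "\<lambda>x. f (x - a) * cis (- (w * x))" a]
    unfolding fourier_integral_def by (simp add: add.commute[of a] eq)
qed

lemma Plancherel_compact_support:
  assumes f: "f \<in> L2" "\<And>x. T < \<bar>x\<bar> \<Longrightarrow> f x = 0"
  shows "fourier_integral f \<in> L2" "(L2_norm (fourier_integral f))\<^sup>2 = 2 * pi * (L2_norm f)\<^sup>2"
proof -
  define c where "c = max 1 T / pi"
  have c: "c > 0" by (simp add: c_def)
  define g where "g = (\<lambda>x. f (c * x))"
  have g: "g \<in> L2" using L2_affine[OF f(1), of c 0] c by (simp add: g_def)
  have g0: "g x = 0" if "x \<notin> {-pi..pi}" for x
  proof -
    have "pi < \<bar>x\<bar>" using that by auto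
    then have "c * pi < c * \<bar>x\<bar>" using c by simp
    then have "T < \<bar>c * x\<bar>" using c by (simp add: c_def abs_mult)
    then show ?thesis by (simp add: g_def f(2))
  qed
  note P = Plancherel_circle[OF g g0]
  have eq: "fourier_integral f w = of_real c * fourier_integral g (0 + c * w)" for w
    unfolding g_def using fourier_integral_dilate[OF c, of f "c * w"] c by simp
  show "fourier_integral f \<in> L2"
    unfolding eq[abs_def] using c by (intro L2_cmult L2_affine P) auto
  have "(L2_norm (fourier_integral f))\<^sup>2 = c\<^sup>2 * (2 * pi * (L2_norm g)\<^sup>2 / c)"
    unfolding eq[abs_def] L2_norm_cmult power_mult_distrib
    by (subst L2_norm_affine) (use c P in \<open>auto simp: norm_of_real\<close>)
  also have "(L2_norm g)\<^sup>2 = (L2_norm f)\<^sup>2 / c"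
    using L2_norm_affine[of c f 0] c by (simp add: g_def)
  finally show "(L2_norm (fourier_integral f))\<^sup>2 = 2 * pi * (L2_norm f)\<^sup>2"
    using c by (simp add: power2_eq_square)
qed

lemma fourier_integral_add:
  assumes "integrable lebesgue f" "integrable lebesgue g"
  shows "fourier_integral (\<lambda>x. f x + g x) w = fourier_integral f w + fourier_integral g w"
  unfolding fourier_integral_def distrib_right
  by (rule Bochner_Integration.integral_add) (intro integrable_mult_cis assms)+

lemma fourier_integral_cmult: "fourier_integral (\<lambda>x. c * f x) w = c * fourier_integral f w"
  unfolding fourier_integral_def mult.assoc by (rule integral_mult_right_zero)

definition compactly_supported :: "(real \<Rightarrow> complex) \<Rightarrow> bool" where
  "compactly_supported u \<longleftrightarrow> (\<exists>T. \<forall>x. T < \<bar>x\<bar> \<longrightarrow> u x = 0)"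

lemma compactly_supported_affine:
  assumes "compactly_supported u" "c \<noteq> 0"
  shows "compactly_supported (\<lambda>x. u (t + c * x))"
proof -
  obtain T where T: "\<And>x. T < \<bar>x\<bar> \<Longrightarrow> u x = 0" using assms(1) by (auto simp: compactly_supported_def)
  have "u (t + c * x) = 0" if "(T + \<bar>t\<bar>) / \<bar>c\<bar> < \<bar>x\<bar>" for x
  proof (rule T)
    have "T + \<bar>t\<bar> < \<bar>c * x\<bar>"
      using that assms(2) by (simp add: pos_divide_less_eq abs_mult mult.commute)
    then show "T < \<bar>t + c * x\<bar>" by linarith
  qed
  then show ?thesis unfolding compactly_supported_def by blast
qed

lemma compactly_supported_add:
  assumes "compactly_supported u" "compactly_supported v"
  shows "compactly_supported (\<lambda>x. u x + v x)"
proof -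
  obtain S T where "\<And>x. S < \<bar>x\<bar> \<Longrightarrow> u x = 0" "\<And>x. T < \<bar>x\<bar> \<Longrightarrow> v x = 0"
    using assms by (auto simp: compactly_supported_def)
  then show ?thesis unfolding compactly_supported_def by (intro exI[of _ "max S T"]) auto
qed

lemma compactly_supported_cmult:
  "compactly_supported u \<Longrightarrow> compactly_supported (\<lambda>x. c * u x)"
  unfolding compactly_supported_def by auto

lemma compactly_supported_Plancherel:
  assumes "u \<in> L2" "compactly_supported u"
  shows "fourier_integral u \<in> L2" "(L2_norm (fourier_integral u))\<^sup>2 = 2 * pi * (L2_norm u)\<^sup>2"
proof -
  obtain T where T: "\<And>x. T < \<bar>x\<bar> \<Longrightarrow> u x = 0" using assms(2) by (auto simp: compactly_supported_def)
  show "fourier_integral u \<in> L2" "(L2_norm (fourier_integral u))\<^sup>2 = 2 * pi * (L2_norm u)\<^sup>2"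
    by (rule Plancherel_compact_support[OF assms(1) T], assumption)+
qed

lemma compactly_supported_integrable:
  assumes "u \<in> L2" "compactly_supported u"
  shows "integrable lebesgue u"
proof -
  obtain T where "\<And>x. T < \<bar>x\<bar> \<Longrightarrow> u x = 0" using assms(2) by (auto simp: compactly_supported_def)
  then show ?thesis by (intro L2_integrable_compact_support[OF assms(1), of "-T" T]) auto
qed

definition L2_fourier :: "(real \<Rightarrow> complex) \<Rightarrow> (real \<Rightarrow> complex) \<Rightarrow> bool" where
  "L2_fourier f F \<longleftrightarrow> f \<in> L2 \<and> F \<in> L2 \<and>
     (\<exists>u. (\<forall>n. u n \<in> L2 \<and> compactly_supported (u n)) \<and>
        (\<lambda>n. L2_norm (\<lambda>x. f x - u n x)) \<longlonglongrightarrow> 0 \<and>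
        (\<lambda>n. L2_norm (\<lambda>w. F w - fourier_integral (u n) w)) \<longlonglongrightarrow> 0)"

lemma L2_fourierE:
  assumes "L2_fourier f F"
  obtains u where "f \<in> L2" "F \<in> L2" "\<And>n. u n \<in> L2" "\<And>n. compactly_supported (u n)"
    "(\<lambda>n. L2_norm (\<lambda>x. f x - u n x)) \<longlonglongrightarrow> 0"
    "(\<lambda>n. L2_norm (\<lambda>w. F w - fourier_integral (u n) w)) \<longlonglongrightarrow> 0"
    "\<And>n. fourier_integral (u n) \<in> L2" "\<And>n. integrable lebesgue (u n)"
proof -
  obtain u where u: "\<forall>n. u n \<in> L2 \<and> compactly_supported (u n)"
    and lim: "(\<lambda>n. L2_norm (\<lambda>x. f x - u n x)) \<longlonglongrightarrow> 0"
     "(\<lambda>n. L2_norm (\<lambda>w. F w - fourier_integral (u n) w)) \<longlonglongrightarrow> 0"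
    using assms unfolding L2_fourier_def by blast
  have u': "u n \<in> L2" "compactly_supported (u n)" for n using u by blast+
  show ?thesis
    by (rule that[OF _ _ u' lim compactly_supported_Plancherel(1)[OF u'] compactly_supported_integrable[OF u']])
       (use assms in \<open>auto simp: L2_fourier_def\<close>)
qed

lemma L2_norm_indicator_complement:
  assumes f: "f \<in> L2"
  shows "(\<lambda>n. L2_norm (\<lambda>x. f x - indicator {- real n..real n} x * f x)) \<longlonglongrightarrow> 0"
proof -
  note [measurable] = L2_measurable[OF f]
  define s where "s = (\<lambda>(n::nat) x. (cmod (f x - indicator {- real n..real n} x * f x))\<^sup>2)"
  have "(\<lambda>n. integral\<^sup>L lebesgue (s n)) \<longlonglongrightarrow> integral\<^sup>L lebesgue (\<lambda>x::real. 0)"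
  proof (rule integral_dominated_convergence)
    show "integrable lebesgue (\<lambda>x. (cmod (f x))\<^sup>2)" by (rule L2_integrable_sq[OF f])
    show "s n \<in> borel_measurable lebesgue" for n
    proof -
      have [measurable]: "(indicator {- real n..real n} :: real \<Rightarrow> complex) \<in> borel_measurable lebesgue"
        by (intro borel_measurable_indicator) simp
      show ?thesis unfolding s_def by measurable
    qed
    show "AE x in lebesgue. norm (s n x) \<le> (cmod (f x))\<^sup>2" for n
      by (intro AE_I2) (simp add: indicator_def s_def)
    show "AE x in lebesgue. (\<lambda>n. s n x) \<longlonglongrightarrow> 0"
    proof (rule AE_I2)
      fix x :: real
      obtain N :: nat where N: "\<bar>x\<bar> \<le> real N" using real_arch_simple by blast
      have "s n x = 0" if "n \<ge> N" for n
      proof -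
        have "x \<in> {- real n..real n}" using N that by auto
        then show ?thesis by (simp add: s_def)
      qed
      then show "(\<lambda>n. s n x) \<longlonglongrightarrow> 0"
        by (intro tendsto_eventually eventually_sequentiallyI)
    qed
  qed simp
  from tendsto_real_sqrt[OF this] show ?thesis unfolding L2_norm_def s_def by simp
qed

lemma fourier_transform_imp_L2_fourier:
  assumes "fourier_transform f F"
  shows "L2_fourier f F"
proof -
  have f: "f \<in> L2" and F: "F \<in> L2"
    and lim: "((\<lambda>T. L2_norm (\<lambda>w. F w - set_lebesgue_integral lebesgue {-T..T} (\<lambda>x. f x * exp (- (\<i> * of_real (w * x)))))) \<longlongrightarrow> 0) at_top"
    using assms by (auto simp: fourier_transform_def)
  define u where "u = (\<lambda>n::nat. \<lambda>x. indicator {- real n..real n} x * f x)"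
  have u: "u n \<in> L2" for n unfolding u_def by (rule L2_cut(1)[OF f]) simp
  have cs: "compactly_supported (u n)" for n
    unfolding compactly_supported_def u_def by (intro exI[of _ "real n"]) (auto simp: indicator_def)
  have eq: "set_lebesgue_integral lebesgue {- real n..real n} (\<lambda>x. f x * exp (- (\<i> * of_real (w * x)))) =
      fourier_integral (u n) w" for n w
    unfolding set_lebesgue_integral_def fourier_integral_def u_def
    by (rule Bochner_Integration.integral_cong) (auto simp: cis_conv_exp indicator_def)
  have "(\<lambda>n. L2_norm (\<lambda>w. F w - fourier_integral (u n) w)) \<longlonglongrightarrow> 0"
    using filterlim_compose[OF lim filterlim_real_sequentially] unfolding eq .
  moreover have "(\<lambda>n. L2_norm (\<lambda>x. f x - u n x)) \<longlonglongrightarrow> 0"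
    unfolding u_def by (rule L2_norm_indicator_complement[OF f])
  ultimately show ?thesis unfolding L2_fourier_def using f F u cs by blast
qed

lemma L2_fourier_norm:
  assumes "L2_fourier f F"
  shows "(L2_norm F)\<^sup>2 = 2 * pi * (L2_norm f)\<^sup>2"
  using assms
proof (rule L2_fourierE)
  fix u assume u: "f \<in> L2" "F \<in> L2" "\<And>n. u n \<in> L2" "\<And>n. compactly_supported (u n)"
    "(\<lambda>n. L2_norm (\<lambda>x. f x - u n x)) \<longlonglongrightarrow> 0"
    "(\<lambda>n. L2_norm (\<lambda>w. F w - fourier_integral (u n) w)) \<longlonglongrightarrow> 0"
    "\<And>n. fourier_integral (u n) \<in> L2"
  have "(\<lambda>n. (L2_norm (fourier_integral (u n)))\<^sup>2) \<longlonglongrightarrow> (L2_norm F)\<^sup>2"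
    by (intro tendsto_power tendsto_L2_norm u)
  moreover have "(\<lambda>n. 2 * pi * (L2_norm (u n))\<^sup>2) \<longlonglongrightarrow> 2 * pi * (L2_norm f)\<^sup>2"
    by (intro tendsto_power tendsto_mult_left tendsto_L2_norm u)
  ultimately show ?thesis
    unfolding compactly_supported_Plancherel(2)[OF u(3,4)] by (rule LIMSEQ_unique)
qed

lemma tendsto_L2_norm_add:
  assumes "f \<in> L2" "g \<in> L2" "\<And>n. u n \<in> L2" "\<And>n. v n \<in> L2"
    and "(\<lambda>n. L2_norm (\<lambda>x. f x - u n x)) \<longlonglongrightarrow> 0" "(\<lambda>n. L2_norm (\<lambda>x. g x - v n x)) \<longlonglongrightarrow> 0"
  shows "(\<lambda>n. L2_norm (\<lambda>x. (f x + g x) - (u n x + v n x))) \<longlonglongrightarrow> 0"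
proof (rule tendsto_sandwich[OF _ _ tendsto_const])
  show "(\<lambda>n. L2_norm (\<lambda>x. f x - u n x) + L2_norm (\<lambda>x. g x - v n x)) \<longlonglongrightarrow> 0"
    using tendsto_add[OF assms(5,6)] by simp
  show "\<forall>\<^sub>F n in sequentially. L2_norm (\<lambda>x. (f x + g x) - (u n x + v n x)) \<le>
      L2_norm (\<lambda>x. f x - u n x) + L2_norm (\<lambda>x. g x - v n x)"
  proof (intro always_eventually allI)
    fix n
    have "(\<lambda>x. (f x + g x) - (u n x + v n x)) = (\<lambda>x. (f x - u n x) + (g x - v n x))"
      by (simp add: fun_eq_iff)
    then show "L2_norm (\<lambda>x. (f x + g x) - (u n x + v n x)) \<le>
        L2_norm (\<lambda>x. f x - u n x) + L2_norm (\<lambda>x. g x - v n x)"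
      using L2_norm_triangle[OF L2_diff[OF assms(1) assms(3)[of n]] L2_diff[OF assms(2) assms(4)[of n]]]
      by (simp only:)
  qed
qed simp

lemma L2_fourier_add:
  assumes "L2_fourier f F" "L2_fourier g G"
  shows "L2_fourier (\<lambda>x. f x + g x) (\<lambda>w. F w + G w)"
proof -
  obtain u where u: "f \<in> L2" "F \<in> L2" "\<And>n. u n \<in> L2" "\<And>n. compactly_supported (u n)"
    "(\<lambda>n. L2_norm (\<lambda>x. f x - u n x)) \<longlonglongrightarrow> 0"
    "(\<lambda>n. L2_norm (\<lambda>w. F w - fourier_integral (u n) w)) \<longlonglongrightarrow> 0"
    "\<And>n. fourier_integral (u n) \<in> L2" "\<And>n. integrable lebesgue (u n)" by (rule L2_fourierE[OF assms(1)]) (rule that)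
  obtain v where v: "g \<in> L2" "G \<in> L2" "\<And>n. v n \<in> L2" "\<And>n. compactly_supported (v n)"
    "(\<lambda>n. L2_norm (\<lambda>x. g x - v n x)) \<longlonglongrightarrow> 0"
    "(\<lambda>n. L2_norm (\<lambda>w. G w - fourier_integral (v n) w)) \<longlonglongrightarrow> 0"
    "\<And>n. fourier_integral (v n) \<in> L2" "\<And>n. integrable lebesgue (v n)" by (rule L2_fourierE[OF assms(2)]) (rule that)
  show ?thesis
    unfolding L2_fourier_def
  proof (intro conjI exI[of _ "\<lambda>n x. u n x + v n x"] allI)
    show "(\<lambda>n. L2_norm (\<lambda>w. F w + G w - fourier_integral (\<lambda>x. u n x + v n x) w)) \<longlonglongrightarrow> 0"
      unfolding fourier_integral_add[OF u(8) v(8)] by (intro tendsto_L2_norm_add u v)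
  qed (intro L2_add u v compactly_supported_add tendsto_L2_norm_add)+
qed

lemma L2_fourier_cmult:
  assumes "L2_fourier f F"
  shows "L2_fourier (\<lambda>x. c * f x) (\<lambda>w. c * F w)"
proof -
  obtain u where u: "f \<in> L2" "F \<in> L2" "\<And>n. u n \<in> L2" "\<And>n. compactly_supported (u n)"
    "(\<lambda>n. L2_norm (\<lambda>x. f x - u n x)) \<longlonglongrightarrow> 0"
    "(\<lambda>n. L2_norm (\<lambda>w. F w - fourier_integral (u n) w)) \<longlonglongrightarrow> 0" by (rule L2_fourierE[OF assms]) (rule that)
  show ?thesis
    unfolding L2_fourier_def
  proof (intro conjI exI[of _ "\<lambda>n x. c * u n x"] allI)
    show "(\<lambda>n. L2_norm (\<lambda>w. c * F w - fourier_integral (\<lambda>x. c * u n x) w)) \<longlonglongrightarrow> 0"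
      unfolding fourier_integral_cmult right_diff_distrib[symmetric] L2_norm_cmult
      by (rule tendsto_mult_right_zero[OF u(6)])
    show "(\<lambda>n. L2_norm (\<lambda>x. c * f x - c * u n x)) \<longlonglongrightarrow> 0"
      unfolding right_diff_distrib[symmetric] L2_norm_cmult
      by (rule tendsto_mult_right_zero[OF u(5)])
  qed (intro L2_cmult u compactly_supported_cmult)+
qed

lemma L2_fourier_zero: "L2_fourier (\<lambda>x. 0) (\<lambda>w. 0)"
  unfolding L2_fourier_def
  by (intro conjI exI[of _ "\<lambda>n x. 0"]) (auto simp: compactly_supported_def fourier_integral_def)

lemma L2_fourier_sum:
  "finite K \<Longrightarrow> (\<And>k. k \<in> K \<Longrightarrow> L2_fourier (f k) (F k)) \<Longrightarrow>
    L2_fourier (\<lambda>x. \<Sum>k\<in>K. c k * f k x) (\<lambda>w. \<Sum>k\<in>K. c k * F k w)"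
proof (induction K rule: finite_induct)
  case empty
  show ?case unfolding sum.empty by (rule L2_fourier_zero)
next
  case (insert k K)
  have "L2_fourier (\<lambda>x. c k * f k x + (\<Sum>k\<in>K. c k * f k x)) (\<lambda>w. c k * F k w + (\<Sum>k\<in>K. c k * F k w))"
    by (intro L2_fourier_add L2_fourier_cmult insert) auto
  then show ?case by (simp only: sum.insert[OF insert(1,2)])
qed

lemma L2_fourier_diff:
  assumes "L2_fourier f F" "L2_fourier g G"
  shows "L2_fourier (\<lambda>x. f x - g x) (\<lambda>w. F w - G w)"
  using L2_fourier_add[OF assms(1) L2_fourier_cmult[OF assms(2), of "-1"]] by simp

lemma tendsto_L2_norm_affine:
  assumes "c \<noteq> 0" "(\<lambda>n. L2_norm (\<lambda>x. f x - u n x)) \<longlonglongrightarrow> 0"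
  shows "(\<lambda>n. L2_norm (\<lambda>x. f (t + c * x) - u n (t + c * x))) \<longlonglongrightarrow> 0"
proof -
  have "L2_norm (\<lambda>x. f (t + c * x) - u n (t + c * x)) = sqrt ((L2_norm (\<lambda>x. f x - u n x))\<^sup>2 / \<bar>c\<bar>)" for n
    unfolding L2_norm_affine[OF assms(1), of "\<lambda>x. f x - u n x" t, symmetric] by simp
  moreover have "(\<lambda>n. sqrt ((L2_norm (\<lambda>x. f x - u n x))\<^sup>2 / \<bar>c\<bar>)) \<longlonglongrightarrow> sqrt (0\<^sup>2 / \<bar>c\<bar>)"
    by (intro tendsto_intros assms(2)) (use assms in auto)
  ultimately show ?thesis by simp
qed

lemma L2_fourier_translate:
  assumes "L2_fourier f F"
  shows "L2_fourier (\<lambda>x. f (x - a)) (\<lambda>w. cis (- (a * w)) * F w)"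
proof -
  obtain u where u: "f \<in> L2" "F \<in> L2" "\<And>n. u n \<in> L2" "\<And>n. compactly_supported (u n)"
    "(\<lambda>n. L2_norm (\<lambda>x. f x - u n x)) \<longlonglongrightarrow> 0"
    "(\<lambda>n. L2_norm (\<lambda>w. F w - fourier_integral (u n) w)) \<longlonglongrightarrow> 0" by (rule L2_fourierE[OF assms]) (rule that)
  have sh: "(\<lambda>x. g (x - a)) = (\<lambda>x. g (- a + 1 * x))" for g :: "real \<Rightarrow> complex" by simp
  show ?thesis
    unfolding L2_fourier_def
  proof (intro conjI exI[of _ "\<lambda>n x. u n (x - a)"] allI)
    show "(\<lambda>x. f (x - a)) \<in> L2" unfolding sh by (rule L2_affine[OF u(1)]) simp
    show "(\<lambda>w. cis (- (a * w)) * F w) \<in> L2" by (rule L2_mult_cis[OF u(2)])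
    show "(\<lambda>x. u n (x - a)) \<in> L2" for n unfolding sh by (rule L2_affine[OF u(3)]) simp
    show "compactly_supported (\<lambda>x. u n (x - a))" for n
      unfolding sh by (rule compactly_supported_affine[OF u(4)]) simp
    show "(\<lambda>n. L2_norm (\<lambda>x. f (x - a) - u n (x - a))) \<longlonglongrightarrow> 0"
      using tendsto_L2_norm_affine[OF one_neq_zero u(5), of "-a"] by simp
    have "L2_norm (\<lambda>w. cis (- (a * w)) * F w - fourier_integral (\<lambda>x. u n (x - a)) w) =
        L2_norm (\<lambda>w. F w - fourier_integral (u n) w)" for n
      unfolding fourier_integral_translate right_diff_distrib[symmetric]
      by (simp add: L2_norm_def norm_mult)
    then show "(\<lambda>n. L2_norm (\<lambda>w. cis (- (a * w)) * F w - fourier_integral (\<lambda>x. u n (x - a)) w)) \<longlonglongrightarrow> 0"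
      using u(6) by (simp only:)
  qed
qed

lemma L2_fourier_dilate:
  assumes "L2_fourier f F" and c: "c > 0"
  shows "L2_fourier (\<lambda>x. f (c * x)) (\<lambda>w. F (w / c) / of_real c)"
proof -
  obtain u where u: "f \<in> L2" "F \<in> L2" "\<And>n. u n \<in> L2" "\<And>n. compactly_supported (u n)"
    "(\<lambda>n. L2_norm (\<lambda>x. f x - u n x)) \<longlonglongrightarrow> 0"
    "(\<lambda>n. L2_norm (\<lambda>w. F w - fourier_integral (u n) w)) \<longlonglongrightarrow> 0" by (rule L2_fourierE[OF assms(1)]) (rule that)
  have c0: "c \<noteq> 0" "1 / c \<noteq> 0" using c by auto
  have di: "(\<lambda>x. g (c * x)) = (\<lambda>x. g (0 + c * x))" for g :: "real \<Rightarrow> complex" by simp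
  have dj: "(\<lambda>w. g (w / c) / of_real c) = (\<lambda>w. (1 / of_real c) * g (0 + (1/c) * w))" for g :: "real \<Rightarrow> complex"
    by simp
  show ?thesis
    unfolding L2_fourier_def
  proof (intro conjI exI[of _ "\<lambda>n x. u n (c * x)"] allI)
    show "(\<lambda>x. f (c * x)) \<in> L2" unfolding di by (rule L2_affine[OF u(1) c0(1)])
    show "(\<lambda>w. F (w / c) / of_real c) \<in> L2" unfolding dj by (rule L2_cmult[OF L2_affine[OF u(2) c0(2)]])
    show "(\<lambda>x. u n (c * x)) \<in> L2" for n unfolding di by (rule L2_affine[OF u(3) c0(1)])
    show "compactly_supported (\<lambda>x. u n (c * x))" for n
      unfolding di by (rule compactly_supported_affine[OF u(4) c0(1)])
    show "(\<lambda>n. L2_norm (\<lambda>x. f (c * x) - u n (c * x))) \<longlonglongrightarrow> 0"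
      using tendsto_L2_norm_affine[OF c0(1) u(5), of 0] by simp
    have "(\<lambda>w. F (w / c) / of_real c - fourier_integral (\<lambda>x. u n (c * x)) w) =
        (\<lambda>w. (1 / of_real c) * (F (0 + (1/c) * w) - fourier_integral (u n) (0 + (1/c) * w)))" for n
      unfolding fourier_integral_dilate[OF c] by (simp add: fun_eq_iff diff_divide_distrib)
    then show "(\<lambda>n. L2_norm (\<lambda>w. F (w / c) / of_real c - fourier_integral (\<lambda>x. u n (c * x)) w)) \<longlonglongrightarrow> 0"
      using tendsto_mult_right_zero[OF tendsto_L2_norm_affine[OF c0(2) u(6), of 0], of "cmod (1 / of_real c)"]
      by (simp only: L2_norm_cmult)
  qed
qed

lemma L2_fourier_inner:
  assumes "L2_fourier f F" "L2_fourier g G"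
  shows "L2_inner F G = of_real (2 * pi) * L2_inner f g"
proof -
  have mem: "f \<in> L2" "F \<in> L2" "g \<in> L2" "G \<in> L2" using assms by (auto simp: L2_fourier_def)
  have re: "Re (L2_inner F' G) = 2 * pi * Re (L2_inner f' g)" if "L2_fourier f' F'" for f' F'
  proof -
    have mem': "f' \<in> L2" "F' \<in> L2" using that by (auto simp: L2_fourier_def)
    have "(L2_norm F')\<^sup>2 + (L2_norm G)\<^sup>2 + 2 * Re (L2_inner F' G) =
       2 * pi * ((L2_norm f')\<^sup>2 + (L2_norm g)\<^sup>2 + 2 * Re (L2_inner f' g))"
      using L2_fourier_norm[OF L2_fourier_add[OF that assms(2)]]
      by (simp only: L2_norm_add_sq mem mem')
    then show ?thesis
      unfolding L2_fourier_norm[OF that] L2_fourier_norm[OF assms(2)] by (simp add: algebra_simps)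
  qed
  have "Re (\<i> * L2_inner F G) = 2 * pi * Re (\<i> * L2_inner f g)"
    using re[OF L2_fourier_cmult[OF assms(1), of \<i>]] by (simp only: L2_inner_cmult_left)
  then show ?thesis using re[OF assms(1)] by (simp add: complex_eq_iff)
qed

section \<open>Riesz bases in reproducing kernel spaces\<close>

lemma rkhs_L2: "rkhs V \<Longrightarrow> f \<in> V \<Longrightarrow> f \<in> L2"
  by (auto simp: rkhs_def)

lemma rkhs_zero: "rkhs V \<Longrightarrow> (\<lambda>x. 0) \<in> V"
  by (simp add: rkhs_def)

lemma rkhs_add: "rkhs V \<Longrightarrow> f \<in> V \<Longrightarrow> g \<in> V \<Longrightarrow> (\<lambda>x. f x + g x) \<in> V"
  by (simp add: rkhs_def)

lemma rkhs_cmult: "rkhs V \<Longrightarrow> f \<in> V \<Longrightarrow> (\<lambda>x. c * f x) \<in> V"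
  by (simp add: rkhs_def)

lemma rkhs_diff: "rkhs V \<Longrightarrow> f \<in> V \<Longrightarrow> g \<in> V \<Longrightarrow> (\<lambda>x. f x - g x) \<in> V"
  using rkhs_add[OF _ _ rkhs_cmult[of V g "-1"], of f] by simp

lemma rkhs_sum: "rkhs V \<Longrightarrow> (\<And>k. k \<in> K \<Longrightarrow> f k \<in> V) \<Longrightarrow> (\<lambda>x. \<Sum>k\<in>K. f k x) \<in> V"
  by (induction K rule: infinite_finite_induct) (auto intro: rkhs_add rkhs_zero)

lemma rkhs_partial_sum: "rkhs V \<Longrightarrow> (\<And>k. b k \<in> V) \<Longrightarrow> partial_sum c b N \<in> V"
  unfolding partial_sum_def[abs_def] by (intro rkhs_sum rkhs_cmult)

lemma rkhs_eval_bound: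
  assumes "rkhs V"
  obtains C where "\<And>f. f \<in> V \<Longrightarrow> cmod (f x) \<le> C * L2_norm f"
  using assms unfolding rkhs_def by meson

lemma rkhs_pointwise_limit:
  assumes V: "rkhs V" and u: "\<And>n. u n \<in> V" and f: "f \<in> V"
    and lim: "(\<lambda>n. L2_norm (\<lambda>x. f x - u n x)) \<longlonglongrightarrow> 0"
  shows "(\<lambda>n. u n x) \<longlonglongrightarrow> f x"
proof -
  obtain C where C: "\<And>f. f \<in> V \<Longrightarrow> cmod (f x) \<le> C * L2_norm f" using rkhs_eval_bound[OF V] by blast
  have "(\<lambda>n. f x - u n x) \<longlonglongrightarrow> 0"
  proof (rule Lim_null_comparison)
    show "\<forall>\<^sub>F n in sequentially. norm (f x - u n x) \<le> C * L2_norm (\<lambda>x. f x - u n x)"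
      using C[OF rkhs_diff[OF V f u]] by (intro always_eventually allI)
    show "(\<lambda>n. C * L2_norm (\<lambda>x. f x - u n x)) \<longlonglongrightarrow> 0"
      by (rule tendsto_mult_right_zero[OF lim])
  qed
  from tendsto_diff[OF tendsto_const[of "f x"] this] show ?thesis by simp
qed

lemma rkhs_eq_zero:
  assumes V: "rkhs V" and f: "f \<in> V" "L2_norm f = 0"
  shows "f = (\<lambda>x. 0)"
proof
  fix x
  obtain C where "\<And>f. f \<in> V \<Longrightarrow> cmod (f x) \<le> C * L2_norm f" using rkhs_eval_bound[OF V] by blast
  from this[OF f(1)] f(2) show "f x = 0" by simp
qed

lemma rkhs_series:
  assumes V: "rkhs V" and b: "upper_bound_system B b" "\<And>k. b k \<in> V" and c: "square_summable c"
  obtains f where "f \<in> V" "(\<lambda>N. L2_norm (\<lambda>x. f x - partial_sum c b N x)) \<longlonglongrightarrow> 0"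
proof -
  have mem: "partial_sum c b N \<in> V" for N by (rule rkhs_partial_sum[OF V b(2)])
  have memL: "partial_sum c b N \<in> L2" for N by (rule rkhs_L2[OF V mem])
  obtain g where g: "g \<in> L2" "(\<lambda>N. L2_norm (\<lambda>x. g x - partial_sum c b N x)) \<longlonglongrightarrow> 0"
    using L2_complete[OF memL upper_bound_system_Cauchy[OF b(1) c]] by blast
  have "\<exists>f\<in>V. L2_norm (\<lambda>x. g x - f x) < e" if "e > 0" for e
  proof -
    have "\<forall>\<^sub>F N in sequentially. L2_norm (\<lambda>x. g x - partial_sum c b N x) < e"
      using order_tendstoD(2)[OF g(2) that] .
    then obtain N where "L2_norm (\<lambda>x. g x - partial_sum c b N x) < e"
      by (meson eventually_happens sequentially_bot)
    then show ?thesis using mem by blast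
  qed
  then obtain f where f: "f \<in> V" "AE x in lebesgue. f x = g x"
    using V g(1) unfolding rkhs_def by blast
  have "L2_norm (\<lambda>x. f x - partial_sum c b N x) = L2_norm (\<lambda>x. g x - partial_sum c b N x)" for N
  proof (rule L2_norm_cong_AE)
    show "AE x in lebesgue. f x - partial_sum c b N x = g x - partial_sum c b N x"
      using f(2) by eventually_elim simp
  qed (intro L2_measurable L2_diff memL g rkhs_L2[OF V f(1)])+
  then have "(\<lambda>N. L2_norm (\<lambda>x. f x - partial_sum c b N x)) \<longlonglongrightarrow> 0" using g(2) by (simp only:)
  with f(1) show ?thesis by (rule that)
qed

lemma riesz_basis_bounds:
  assumes V: "rkhs V" and b: "riesz_basis V b"
  obtains A B where "A > 0" "upper_bound_system B b"
    "\<And>K c. finite K \<Longrightarrow> A * (\<Sum>k\<in>K. (cmod (c k))\<^sup>2) \<le> (L2_norm (\<lambda>x. \<Sum>k\<in>K. c k * b k x))\<^sup>2"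
proof -
  obtain A B where AB: "A > 0" "\<And>K c. finite K \<Longrightarrow>
        A * (\<Sum>k\<in>K. (cmod (c k))\<^sup>2) \<le> (L2_norm (\<lambda>x. \<Sum>k\<in>K. c k * b k x))\<^sup>2 \<and>
        (L2_norm (\<lambda>x. \<Sum>k\<in>K. c k * b k x))\<^sup>2 \<le> B * (\<Sum>k\<in>K. (cmod (c k))\<^sup>2)"
    using b unfolding riesz_basis_def by blast
  have "b k \<in> L2" for k using b rkhs_L2[OF V] unfolding riesz_basis_def by blast
  then have "upper_bound_system B b" unfolding upper_bound_system_def using AB(2) by blast
  with AB show ?thesis by (intro that) auto
qed

lemma lower_bound_limit:
  assumes A: "A > 0"
    and low: "\<And>K c. finite K \<Longrightarrow> A * (\<Sum>k\<in>K. (cmod (c k))\<^sup>2) \<le> (L2_norm (\<lambda>x. \<Sum>k\<in>K. c k * b k x))\<^sup>2"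
    and lim: "(\<lambda>n. L2_norm (partial_sum c b (r n))) \<longlonglongrightarrow> l" and r: "strict_mono r"
    and K: "finite K"
  shows "A * (\<Sum>k\<in>K. (cmod (c k))\<^sup>2) \<le> l\<^sup>2"
proof (rule tendsto_lowerbound)
  show "(\<lambda>n. (L2_norm (partial_sum c b (r n)))\<^sup>2) \<longlonglongrightarrow> l\<^sup>2" by (rule tendsto_power[OF lim])
  have "\<forall>\<^sub>F N in sequentially. K \<subseteq> {- int N..int N}"
    using filterlim_symmetric_int_intervals K unfolding filterlim_finite_subsets_at_top
    by (auto elim!: eventually_mono)
  then have "\<forall>\<^sub>F n in sequentially. K \<subseteq> {- int (r n)..int (r n)}"
    using filterlim_subseq[OF r] unfolding filterlim_iff by blast
  then show "\<forall>\<^sub>F n in sequentially. A * (\<Sum>k\<in>K. (cmod (c k))\<^sup>2) \<le> (L2_norm (partial_sum c b (r n)))\<^sup>2"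
  proof eventually_elim
    case (elim n)
    have "A * (\<Sum>k\<in>K. (cmod (c k))\<^sup>2) \<le> A * (\<Sum>k\<in>{- int (r n)..int (r n)}. (cmod (c k))\<^sup>2)"
      using A elim by (intro mult_left_mono sum_mono2) auto
    also have "\<dots> \<le> (L2_norm (partial_sum c b (r n)))\<^sup>2"
      unfolding partial_sum_def[abs_def] by (rule low) simp
    finally show ?case .
  qed
qed simp

locale interpolating_generator =
  fixes V :: "(real \<Rightarrow> complex) set" and S :: "real \<Rightarrow> complex"
  assumes V: "rkhs V"
    and riesz: "riesz_basis V (translates S)"
    and expansion_net: "f \<in> V \<Longrightarrow>
      ((\<lambda>K. L2_norm (\<lambda>x. f x - (\<Sum>k\<in>K. f (of_int k) * translates S k x))) \<longlongrightarrow> 0) (finite_subsets_at_top UNIV)"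
begin

lemma translates_V: "translates S k \<in> V"
  using riesz by (simp add: riesz_basis_def)

lemma translates_L2: "translates S k \<in> L2"
  by (rule rkhs_L2[OF V translates_V])

lemma S_V: "S \<in> V"
  using translates_V[of 0] by (simp add: translates_def[abs_def])

lemma expansion:
  assumes "f \<in> V"
  shows "(\<lambda>N. L2_norm (\<lambda>x. f x - partial_sum (\<lambda>k. f (of_int k)) (translates S) N x)) \<longlonglongrightarrow> 0"
  unfolding partial_sum_def
  by (rule filterlim_compose[OF expansion_net[OF assms] filterlim_symmetric_int_intervals])

lemma samples_bound:
  obtains A where "A > 0"
    "\<And>f K. f \<in> V \<Longrightarrow> finite K \<Longrightarrow> A * (\<Sum>k\<in>K. (cmod (f (of_int k)))\<^sup>2) \<le> (L2_norm f)\<^sup>2"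
proof -
  obtain A B where AB: "A > 0" "upper_bound_system B (translates S)"
    "\<And>K c. finite K \<Longrightarrow> A * (\<Sum>k\<in>K. (cmod (c k))\<^sup>2) \<le> (L2_norm (\<lambda>x. \<Sum>k\<in>K. c k * translates S k x))\<^sup>2"
    using riesz_basis_bounds[OF V riesz] by blast
  have "A * (\<Sum>k\<in>K. (cmod (f (of_int k)))\<^sup>2) \<le> (L2_norm f)\<^sup>2" if f: "f \<in> V" and K: "finite K" for f K
  proof (rule lower_bound_limit[OF AB(1,3) _ strict_mono_id K])
    show "(\<lambda>n. L2_norm (partial_sum (\<lambda>k. f (of_int k)) (translates S) (id n))) \<longlonglongrightarrow> L2_norm f"
      unfolding id_apply
      by (rule tendsto_L2_norm[OF partial_sum_L2[OF translates_L2] rkhs_L2[OF V f] expansion[OF f]])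
  qed
  with AB(1) show ?thesis by (rule that)
qed

lemma square_summable_samples:
  assumes "f \<in> V"
  shows "square_summable (\<lambda>k. f (of_int k))"
proof -
  obtain A where A: "A > 0"
    "\<And>f K. f \<in> V \<Longrightarrow> finite K \<Longrightarrow> A * (\<Sum>k\<in>K. (cmod (f (of_int k)))\<^sup>2) \<le> (L2_norm f)\<^sup>2"
    using samples_bound by blast
  show ?thesis
  proof (rule square_summableI)
    fix K :: "int set" assume "finite K"
    from A(2)[OF assms this] show "(\<Sum>k\<in>K. (cmod (f (of_int k)))\<^sup>2) \<le> (L2_norm f)\<^sup>2 / A"
      using A(1) by (simp add: pos_le_divide_eq mult.commute)
  qed
qed

lemma S_of_int: "S (of_int n) = (if n = 0 then 1 else 0)"
proof -
  obtain A B where AB: "A > 0" "upper_bound_system B (translates S)"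
    "\<And>K c. finite K \<Longrightarrow> A * (\<Sum>k\<in>K. (cmod (c k))\<^sup>2) \<le> (L2_norm (\<lambda>x. \<Sum>k\<in>K. c k * translates S k x))\<^sup>2"
    using riesz_basis_bounds[OF V riesz] by blast
  define c where "c = (\<lambda>k::int. S (of_int k) - (if k = 0 then 1 else 0))"
  have ps: "partial_sum c (translates S) N x = - (S x - partial_sum (\<lambda>k. S (of_int k)) (translates S) N x)" for N x
  proof -
    have "partial_sum c (translates S) N x = partial_sum (\<lambda>k. S (of_int k)) (translates S) N x -
       (\<Sum>k\<in>{- int N..int N}. (if k = 0 then 1 else 0) * translates S k x)"
      unfolding partial_sum_def c_def left_diff_distrib sum_subtractf ..
    also have "(\<Sum>k\<in>{- int N..int N}. (if k = 0 then 1 else 0) * translates S k x) =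
        (\<Sum>k\<in>{- int N..int N}. if k = 0 then S x else 0)"
      by (rule sum.cong) (auto simp: translates_def)
    also have "\<dots> = S x" by (subst sum.delta) auto
    finally show ?thesis by simp
  qed
  have "(\<lambda>N. L2_norm (partial_sum c (translates S) (id N))) \<longlonglongrightarrow> 0"
    using expansion[OF S_V] unfolding id_apply ps[abs_def] L2_norm_uminus .
  from lower_bound_limit[OF AB(1,3) this strict_mono_id, of "{n}"]
  have "A * (cmod (c n))\<^sup>2 \<le> 0" by simp
  then have "c n = 0" using AB(1) by (simp add: mult_le_0_iff not_less)
  then show ?thesis by (simp add: c_def split: if_splits)
qed

lemma series_sample:
  assumes f: "f \<in> V" and a: "inj a"
    and lim: "(\<lambda>N. L2_norm (\<lambda>x. f x - partial_sum c (\<lambda>m. translates S (a m)) N x)) \<longlonglongrightarrow> 0"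
  shows "f (of_int (a m)) = c m" "n \<notin> range a \<Longrightarrow> f (of_int n) = 0"
proof -
  have lim: "(\<lambda>N. partial_sum c (\<lambda>m. translates S (a m)) N x) \<longlonglongrightarrow> f x" for x
    by (rule rkhs_pointwise_limit[OF V _ f lim]) (rule rkhs_partial_sum[OF V translates_V])
  have S: "translates S k (of_int n) = (if k = n then 1 else 0)" for k n
    using S_of_int[of "n - k"] by (simp add: translates_def)
  show "f (of_int (a m)) = c m"
  proof (rule LIMSEQ_unique[OF lim])
    have "partial_sum c (\<lambda>m. translates S (a m)) N (of_int (a m)) = c m" if "N \<ge> nat \<bar>m\<bar>" for N
    proof -
      have "partial_sum c (\<lambda>m. translates S (a m)) N (of_int (a m)) =
          (\<Sum>k\<in>{- int N..int N}. if k = m then c k else 0)"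
        unfolding partial_sum_def S by (rule sum.cong) (auto dest: injD[OF a])
      also have "\<dots> = c m" using that by (subst sum.delta) auto
      finally show ?thesis .
    qed
    then show "(\<lambda>N. partial_sum c (\<lambda>m. translates S (a m)) N (of_int (a m))) \<longlonglongrightarrow> c m"
      by (intro tendsto_eventually eventually_sequentiallyI)
  qed
  show "f (of_int n) = 0" if "n \<notin> range a"
  proof (rule LIMSEQ_unique[OF lim])
    have "partial_sum c (\<lambda>m. translates S (a m)) N (of_int n) = 0" for N
      unfolding partial_sum_def S by (rule sum.neutral) (use that in auto)
    then show "(\<lambda>N. partial_sum c (\<lambda>m. translates S (a m)) N (of_int n)) \<longlonglongrightarrow> 0" by simp
  qed
qed

lemma translates_upper_bound_subsystem:
  assumes "inj a"
  obtains B where "upper_bound_system B (\<lambda>m. translates S (a m))"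
proof -
  obtain B where B: "upper_bound_system B (translates S)"
    using riesz_basis_bounds[OF V riesz] by blast
  have "(L2_norm (\<lambda>x. \<Sum>k\<in>K. c k * translates S (a k) x))\<^sup>2 \<le> B * (\<Sum>k\<in>K. (cmod (c k))\<^sup>2)"
    if "finite K" for K c
  proof -
    have ai: "inj_on a K" using assms by (rule inj_on_subset) simp
    have inv: "inv a (a k) = k" for k using assms by simp
    have "(L2_norm (\<lambda>x. \<Sum>k\<in>a ` K. c (inv a k) * translates S k x))\<^sup>2 \<le> B * (\<Sum>k\<in>a ` K. (cmod (c (inv a k)))\<^sup>2)"
      by (rule upper_bound_system_D[OF B]) (use that in simp)
    then show ?thesis by (simp only: sum.reindex[OF ai] o_def inv)
  qed
  then have "upper_bound_system B (\<lambda>m. translates S (a m))"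
    unfolding upper_bound_system_def using translates_L2 by blast
  then show ?thesis by (rule that)
qed

definition half_translates :: "int \<Rightarrow> real \<Rightarrow> complex" where
  "half_translates k x = S (x / 2 - of_int k)"

lemma half_translates_eq: "half_translates k = (\<lambda>x. translates S k (0 + (1/2) * x))"
  by (simp add: half_translates_def translates_def fun_eq_iff)

lemma half_translates_L2: "half_translates k \<in> L2"
  unfolding half_translates_eq by (rule L2_affine[OF translates_L2]) simp

lemma half_translates_upper_bound:
  obtains B where "upper_bound_system B half_translates"
proof -
  obtain B where B: "upper_bound_system B (translates S)"
    using riesz_basis_bounds[OF V riesz] by blast
  have "(L2_norm (\<lambda>x. \<Sum>k\<in>K. c k * half_translates k x))\<^sup>2 \<le> 2 * B * (\<Sum>k\<in>K. (cmod (c k))\<^sup>2)"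
    if K: "finite K" for K c
  proof -
    have "(L2_norm (\<lambda>x. \<Sum>k\<in>K. c k * half_translates k x))\<^sup>2 = (L2_norm (\<lambda>x. \<Sum>k\<in>K. c k * translates S k x))\<^sup>2 / \<bar>1/2\<bar>"
      unfolding half_translates_eq by (rule L2_norm_affine) simp
    then show ?thesis using upper_bound_system_D[OF B K, of c] by simp
  qed
  then have "upper_bound_system (2 * B) half_translates"
    unfolding upper_bound_system_def using half_translates_L2 by blast
  then show ?thesis by (rule that)
qed

end

text \<open>The Gram matrix of the even translates of \<open>S\<close> against the translates generating the coarser
  space is the Laurent matrix of the symbol \<open>Q\<close>; invertibility of \<open>Q\<close> makes the interpolation
  problem at the odd integers uniquely solvable in the orthogonal complement.\<close>

locale invertible_symbol = interpolating_generator +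
  fixes Q :: "real \<Rightarrow> complex" and A B :: real
  assumes Q_measurable: "Q \<in> borel_measurable lebesgue"
    and Q_support: "w \<notin> {-pi..pi} \<Longrightarrow> Q w = 0"
    and A: "A > 0"
    and Q_bounds: "w \<in> {-pi..pi} \<Longrightarrow> A \<le> cmod (Q w)" "w \<in> {-pi..pi} \<Longrightarrow> cmod (Q w) \<le> B"
    and gram: "L2_inner (translates S (2 * m)) (half_translates k) = L2_inner Q (circle_exp (k - m)) / (2 * pi)"
begin

lemma Q_le: "cmod (Q w) \<le> max B 0"
  using Q_bounds(2)[of w] Q_support[of w] by (cases "w \<in> {-pi..pi}") auto

lemma Q_nonzero: "w \<in> {-pi..pi} \<Longrightarrow> Q w \<noteq> 0"
  using Q_bounds(1)[of w] A by auto

lemma Q_mult_L2: "C \<in> L2 \<Longrightarrow> (\<lambda>w. Q w * C w) \<in> L2"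
  by (rule L2_mult_bounded(1)[OF _ Q_measurable Q_le])

lemma series_inner:
  assumes h: "h \<in> V" "(\<lambda>N. L2_norm (\<lambda>x. h x - partial_sum c (\<lambda>m. translates S (2 * m)) N x)) \<longlonglongrightarrow> 0"
    and C: "C \<in> L2" "(\<lambda>N. L2_norm (\<lambda>w. C w - partial_sum c circle_exp N w)) \<longlonglongrightarrow> 0"
  shows "L2_inner h (half_translates k) = L2_inner (\<lambda>w. Q w * C w) (circle_exp k) / (2 * pi)"
proof (rule LIMSEQ_unique)
  show "(\<lambda>N. L2_inner (partial_sum c (\<lambda>m. translates S (2 * m)) N) (half_translates k)) \<longlonglongrightarrow> L2_inner h (half_translates k)"
    by (rule tendsto_L2_inner_left[OF partial_sum_L2[OF translates_L2] rkhs_L2[OF V h(1)] half_translates_L2 h(2)])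
  have ps: "partial_sum c circle_exp N \<in> L2" for N by (rule partial_sum_L2[OF circle_exp_L2])
  have "(\<lambda>N. L2_norm (\<lambda>w. Q w * C w - Q w * partial_sum c circle_exp N w)) \<longlonglongrightarrow> 0"
  proof (rule tendsto_sandwich[OF _ _ tendsto_const])
    show "(\<lambda>N. max B 0 * L2_norm (\<lambda>w. C w - partial_sum c circle_exp N w)) \<longlonglongrightarrow> 0"
      by (rule tendsto_mult_right_zero[OF C(2)])
    show "\<forall>\<^sub>F N in sequentially. L2_norm (\<lambda>w. Q w * C w - Q w * partial_sum c circle_exp N w)
        \<le> max B 0 * L2_norm (\<lambda>w. C w - partial_sum c circle_exp N w)"
      unfolding right_diff_distrib[symmetric]
      by (intro always_eventually allI L2_mult_bounded(2)[OF _ Q_measurable Q_le] L2_diff C ps)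
  qed simp
  from tendsto_L2_inner_left[OF Q_mult_L2[OF ps] Q_mult_L2[OF C(1)] circle_exp_L2[of k] this]
  have "(\<lambda>N. L2_inner (\<lambda>w. Q w * partial_sum c circle_exp N w) (circle_exp k) / (2 * pi)) \<longlonglongrightarrow>
      L2_inner (\<lambda>w. Q w * C w) (circle_exp k) / (2 * pi)"
    by (intro tendsto_divide tendsto_const) simp_all
  moreover have "L2_inner (\<lambda>w. Q w * partial_sum c circle_exp N w) (circle_exp k) / (2 * pi) =
      L2_inner (partial_sum c (\<lambda>m. translates S (2 * m)) N) (half_translates k)" for N
  proof -
    have eq: "L2_inner (\<lambda>w. Q w * circle_exp m w) (circle_exp k) = L2_inner Q (circle_exp (k - m))" for m
    proof -
      have "Q w * circle_exp m w * cnj (circle_exp k w) = Q w * cnj (circle_exp (k - m) w)" for w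
        by (cases "w \<in> {-pi..pi}") (auto simp: circle_exp_def cis_cnj cis_mult algebra_simps)
      then show ?thesis unfolding L2_inner_def by (simp only:)
    qed
    have "(\<lambda>w. Q w * partial_sum c circle_exp N w) = (\<lambda>w. \<Sum>m\<in>{- int N..int N}. c m * (Q w * circle_exp m w))"
      unfolding partial_sum_def sum_distrib_left by (simp add: mult.left_commute)
    then have "L2_inner (\<lambda>w. Q w * partial_sum c circle_exp N w) (circle_exp k) =
        (\<Sum>m\<in>{- int N..int N}. c m * L2_inner Q (circle_exp (k - m)))"
      by (simp only: L2_inner_sum_left[OF Q_mult_L2[OF circle_exp_L2] circle_exp_L2] eq)
    moreover have "L2_inner (partial_sum c (\<lambda>m. translates S (2 * m)) N) (half_translates k) =
        (\<Sum>m\<in>{- int N..int N}. c m * (L2_inner Q (circle_exp (k - m)) / (2 * pi)))"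
      unfolding partial_sum_def[abs_def]
      by (simp only: L2_inner_sum_left[OF translates_L2 half_translates_L2] gram)
    ultimately show ?thesis by (simp only: sum_divide_distrib times_divide_eq_right)
  qed
  ultimately show "(\<lambda>N. L2_inner (partial_sum c (\<lambda>m. translates S (2 * m)) N) (half_translates k)) \<longlonglongrightarrow>
      L2_inner (\<lambda>w. Q w * C w) (circle_exp k) / (2 * pi)" by (simp only:)
qed

lemma odd_interpolation_unique:
  assumes f: "f \<in> V" and orth: "\<And>k. L2_inner f (half_translates k) = 0"
    and odd: "\<And>k::int. f (of_int (2 * k + 1)) = 0"
  shows "f = (\<lambda>x. 0)"
proof -
  define c where "c = (\<lambda>m::int. f (of_int (2 * m)))"
  have "square_summable c"
  proof (rule square_summableI)
    fix K :: "int set" assume "finite K"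
    have "(\<Sum>k\<in>K. (cmod (c k))\<^sup>2) = (\<Sum>k\<in>(*) 2 ` K. (cmod (f (of_int k)))\<^sup>2)"
      by (subst sum.reindex) (auto simp: c_def inj_on_def)
    also have "\<dots> \<le> (\<Sum>\<^sub>\<infinity>k. (cmod (f (of_int k)))\<^sup>2)"
      by (rule square_summable_finite_bound[OF square_summable_samples[OF f]]) (use \<open>finite K\<close> in simp)
    finally show "(\<Sum>k\<in>K. (cmod (c k))\<^sup>2) \<le> (\<Sum>\<^sub>\<infinity>k. (cmod (f (of_int k)))\<^sup>2)" .
  qed
  then obtain C where C: "C \<in> L2" "\<And>w. w \<notin> {-pi..pi} \<Longrightarrow> C w = 0"
    "(\<lambda>N. L2_norm (\<lambda>w. C w - partial_sum c circle_exp N w)) \<longlonglongrightarrow> 0"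
    "\<And>k. L2_inner C (circle_exp k) = of_real (2 * pi) * c k"
    using circle_Riesz_Fischer by blast
  have ps: "partial_sum (\<lambda>k. f (of_int k)) (translates S) (2 * N) x = partial_sum c (\<lambda>m. translates S (2 * m)) N x" for N x
  proof -
    have "partial_sum (\<lambda>k. f (of_int k)) (translates S) (2 * N) x =
        (\<Sum>k\<in>(*) 2 ` {- int N..int N}. f (of_int k) * translates S k x)"
      unfolding partial_sum_def
    proof (rule sum.mono_neutral_right)
      show "\<forall>k\<in>{- int (2 * N)..int (2 * N)} - (*) 2 ` {- int N..int N}. f (of_int k) * translates S k x = 0"
      proof
        fix k assume k: "k \<in> {- int (2 * N)..int (2 * N)} - (*) 2 ` {- int N..int N}"
        have "Parity.odd k"
        proof
          assume "even k"
          then obtain m where "k = 2 * m" by (elim evenE)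
          with k show False by auto
        qed
        then obtain m where "k = 2 * m + 1" by (elim oddE)
        then show "f (of_int k) * translates S k x = 0" using odd[of m] by simp
      qed
    qed auto
    also have "\<dots> = partial_sum c (\<lambda>m. translates S (2 * m)) N x"
      unfolding partial_sum_def by (subst sum.reindex) (auto simp: c_def inj_on_def)
    finally show ?thesis .
  qed
  have lim: "(\<lambda>N. L2_norm (\<lambda>x. f x - partial_sum c (\<lambda>m. translates S (2 * m)) N x)) \<longlonglongrightarrow> 0"
  proof -
    have "filterlim (\<lambda>N::nat. 2 * N) sequentially sequentially"
      by (rule filterlim_subseq) (simp add: strict_mono_def)
    from filterlim_compose[OF expansion[OF f] this] show ?thesis unfolding ps .
  qed
  have "L2_inner (\<lambda>w. Q w * C w) (circle_exp k) = 0" for k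
    using series_inner[OF f lim C(1,3), of k] orth[of k] by simp
  from circle_inner_eq_0[OF Q_mult_L2[OF C(1)] _ this]
  have "AE w in lebesgue. Q w * C w = 0" using C(2) by simp
  then have "AE w in lebesgue. C w = 0"
  proof eventually_elim
    case (elim w)
    then show ?case using Q_nonzero[of w] C(2)[of w] by (cases "w \<in> {-pi..pi}") auto
  qed
  then have "L2_inner C (circle_exp k) = 0" for k
    unfolding L2_inner_def by (intro integral_eq_zero_AE) (auto elim: eventually_mono)
  then have c0: "c k = 0" for k using C(4)[of k] by simp
  have "(\<lambda>N. L2_norm f) \<longlonglongrightarrow> 0" using lim unfolding partial_sum_def c0 by simp
  then have "L2_norm f = 0" by (simp add: LIMSEQ_const_iff)
  then show ?thesis by (rule rkhs_eq_zero[OF V f])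
qed

lemma odd_interpolation_exists:
  assumes F: "square_summable F"
  obtains f where "f \<in> V" "\<And>k. L2_inner f (half_translates k) = 0"
    "\<And>k::int. f (of_int (2 * k + 1)) = F k"
proof -
  have inj: "inj (\<lambda>m::int. 2 * m)" "inj (\<lambda>m::int. 2 * m + 1)" by (auto simp: inj_def)
  obtain B1 where B1: "upper_bound_system B1 (\<lambda>m. translates S (2 * m))"
    using translates_upper_bound_subsystem[OF inj(1)] by blast
  obtain B2 where B2: "upper_bound_system B2 (\<lambda>m. translates S (2 * m + 1))"
    using translates_upper_bound_subsystem[OF inj(2)] by blast
  obtain g where g: "g \<in> V" "(\<lambda>N. L2_norm (\<lambda>x. g x - partial_sum F (\<lambda>m. translates S (2 * m + 1)) N x)) \<longlonglongrightarrow> 0"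
    using rkhs_series[OF V B2 translates_V F] by blast
  obtain B3 where B3: "upper_bound_system B3 half_translates" using half_translates_upper_bound by blast
  define b where "b = (\<lambda>k. - L2_inner g (half_translates k))"
  have "square_summable b"
    using upper_bound_system_Bessel[OF B3 rkhs_L2[OF V g(1)]] by (simp add: b_def square_summable_def)
  then obtain D where D: "D \<in> L2" "\<And>w. w \<notin> {-pi..pi} \<Longrightarrow> D w = 0"
    "\<And>k. L2_inner D (circle_exp k) = of_real (2 * pi) * b k"
    using circle_Riesz_Fischer by blast
  define C where "C = (\<lambda>w. inverse (Q w) * D w)"
  have C: "C \<in> L2"
    unfolding C_def
  proof (rule L2_mult_bounded(1)[OF D(1)])
    note [measurable] = Q_measurable
    show "(\<lambda>w. inverse (Q w)) \<in> borel_measurable lebesgue" by measurable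
    show "cmod (inverse (Q w)) \<le> inverse A" for w
    proof (cases "w \<in> {-pi..pi}")
      case True
      then show ?thesis using Q_bounds(1)[OF True] A by (simp add: norm_inverse le_imp_inverse_le)
    next
      case False
      then show ?thesis using Q_support[OF False] A by simp
    qed
  qed
  have C0: "C w = 0" if "w \<notin> {-pi..pi}" for w using D(2)[OF that] by (simp add: C_def)
  have QC: "Q w * C w = D w" for w
    using Q_nonzero[of w] D(2)[of w] by (cases "w \<in> {-pi..pi}") (auto simp: C_def)
  define c where "c = (\<lambda>k. L2_inner C (circle_exp k) / (2 * pi))"
  have c: "square_summable c" "(\<lambda>N. L2_norm (\<lambda>w. C w - partial_sum c circle_exp N w)) \<longlonglongrightarrow> 0"
    unfolding c_def by (rule circle_Parseval(1,2)[OF C C0], assumption)+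
  obtain h where h: "h \<in> V" "(\<lambda>N. L2_norm (\<lambda>x. h x - partial_sum c (\<lambda>m. translates S (2 * m)) N x)) \<longlonglongrightarrow> 0"
    using rkhs_series[OF V B1 translates_V c(1)] by blast
  have hb: "L2_inner h (half_translates k) = b k" for k
    unfolding series_inner[OF h C c(2)] QC D(3) by simp
  show ?thesis
  proof (rule that)
    show "(\<lambda>x. g x + h x) \<in> V" by (rule rkhs_add[OF V g(1) h(1)])
    show "L2_inner (\<lambda>x. g x + h x) (half_translates k) = 0" for k
      using L2_inner_add_left[OF rkhs_L2[OF V g(1)] rkhs_L2[OF V h(1)] half_translates_L2] hb[of k]
      by (simp add: b_def)
    show "g (of_int (2 * k + 1)) + h (of_int (2 * k + 1)) = F k" for k
    proof -
      have "2 * k + 1 \<notin> range (\<lambda>m::int. 2 * m)" by auto presburger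
      from series_sample(2)[OF h(1) inj(1) h(2) this] series_sample(1)[OF g(1) inj(2) g(2), of k]
      show ?thesis by simp
    qed
  qed
qed

end

section \<open>The symbols of the interpolating generator\<close>

lemma cis_int_periodic:
  fixes k l :: int
  shows "cis (- (of_int k * (w + 2 * pi * of_int l))) = cis (- (of_int k * w))"
proof -
  have "- (of_int k * (w + 2 * pi * of_int l)) = - (of_int k * w) + 2 * pi * of_int (- (k * l))"
    by (simp add: algebra_simps)
  then have "cis (- (of_int k * (w + 2 * pi * of_int l))) = cis (- (of_int k * w)) * cis (2 * pi * of_int (- (k * l)))"
    by (simp only: cis_mult)
  also have "cis (2 * pi * of_int (- (k * l))) = 1" by (rule cis_multiple_2pi) simp
  finally show ?thesis by simp
qed

lemma periodic_int_multiple: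
  fixes f :: "real \<Rightarrow> 'a" and p :: real
  assumes "\<And>w. f (w + p) = f w"
  shows "f (w + p * of_int k) = f w"
proof (induction k rule: int_induct[where k = 0])
  case (step1 i)
  have "f (w + p * of_int (i + 1)) = f (w + p * of_int i + p)" by (simp add: algebra_simps)
  then show ?case using assms step1(2) by simp
next
  case (step2 i)
  have "f (w + p * of_int (i - 1)) = f (w + p * of_int (i - 1) + p)" by (rule assms[symmetric])
  also have "\<dots> = f (w + p * of_int i)" by (simp add: algebra_simps)
  finally show ?case using step2(2) by simp
qed simp

lemma AE_all_int_shifts:
  fixes p :: real
  assumes "AE w in lebesgue. P w"
  shows "AE w in lebesgue. \<forall>k::int. P (w + p * of_int k)"
  unfolding AE_all_countable
proof
  fix k :: int
  show "AE w in lebesgue. P (w + p * of_int k)"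
    using AE_lebesgue_affine[OF assms one_neq_zero, of "p * of_int k"]
    by (simp add: add.commute)
qed

lemma L2_fourier_translates:
  "L2_fourier f F \<Longrightarrow> L2_fourier (translates f k) (\<lambda>w. cis (- (of_int k * w)) * F w)"
  unfolding translates_def[abs_def] by (rule L2_fourier_translate)

lemma L2_fourier_partial_sum:
  assumes "L2_fourier f F"
  shows "L2_fourier (partial_sum c (translates f) N) (partial_sum c (\<lambda>k w. cis (- (of_int k * w)) * F w) N)"
  unfolding partial_sum_def[abs_def] by (intro L2_fourier_sum L2_fourier_translates assms) simp

lemma partial_sum_modulated:
  "partial_sum c (\<lambda>k w. cis (- (of_int k * w)) * F w) N w = (\<Sum>k\<in>{- int N..int N}. c k * cis (- (of_int k * w))) * F w"
  unfolding partial_sum_def by (simp add: sum_distrib_right mult.assoc)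

lemma trig_sum_measurable: "(\<lambda>w. \<Sum>k\<in>K. c k * cis (- (of_int k * w))) \<in> borel_measurable lebesgue"
  by measurable

lemma (in interpolating_generator) fourier_multiplier:
  assumes S: "L2_fourier S Shat" and g: "g \<in> V" "L2_fourier g G"
    and lim: "\<And>w. (\<lambda>N. \<Sum>k\<in>{- int N..int N}. g (of_int k) * cis (- (of_int k * w))) \<longlonglongrightarrow> \<Psi> w"
  shows "AE w in lebesgue. G w = \<Psi> w * Shat w"
proof -
  define u where "u = (\<lambda>N w. G w - partial_sum (\<lambda>k. g (of_int k)) (\<lambda>k w. cis (- (of_int k * w)) * Shat w) N w)"
  have ft: "L2_fourier (\<lambda>x. g x - partial_sum (\<lambda>k. g (of_int k)) (translates S) N x) (u N)" for N
    unfolding u_def by (rule L2_fourier_diff[OF g(2) L2_fourier_partial_sum[OF S]])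
  have uL2: "u N \<in> L2" for N using ft by (simp add: L2_fourier_def)
  have L2: "G \<in> L2" "Shat \<in> L2" using g(2) S by (simp_all add: L2_fourier_def)
  note [measurable] = L2_measurable[OF L2(1)] L2_measurable[OF L2(2)]
  have "(\<lambda>N. sqrt (2 * pi * (L2_norm (\<lambda>x. g x - partial_sum (\<lambda>k. g (of_int k)) (translates S) N x))\<^sup>2)) \<longlonglongrightarrow> sqrt (2 * pi * 0\<^sup>2)"
    by (intro tendsto_intros expansion g(1))
  then have norm0: "(\<lambda>N. L2_norm (u N)) \<longlonglongrightarrow> 0"
    unfolding L2_fourier_norm[OF ft, symmetric] by simp
  have "\<Psi> \<in> borel_measurable lebesgue"
    by (rule borel_measurable_LIMSEQ_metric[OF trig_sum_measurable lim])
  then have meas: "(\<lambda>w. G w - \<Psi> w * Shat w) \<in> borel_measurable lebesgue" by measurable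
  have ae: "AE w in lebesgue. (\<lambda>N. u N w) \<longlonglongrightarrow> G w - \<Psi> w * Shat w"
    unfolding u_def partial_sum_modulated by (intro AE_I2 tendsto_intros lim)
  have *: "(\<lambda>w. G w - \<Psi> w * Shat w) \<in> L2 \<and> L2_norm (\<lambda>w. G w - \<Psi> w * Shat w) \<le> e" if "e > 0" for e
  proof -
    have "\<forall>\<^sub>F N in sequentially. L2_norm (u N) < e" using order_tendstoD(2)[OF norm0 that] .
    then have "\<forall>\<^sub>F N in sequentially. L2_norm (u N) \<le> e" by (rule eventually_mono) simp
    from L2_Fatou[OF uL2 meas ae this] show ?thesis by blast
  qed
  have "L2_norm (\<lambda>w. G w - \<Psi> w * Shat w) \<le> 0"
  proof (rule field_le_epsilon)
    fix e :: real assume "e > 0"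
    from *[OF this] show "L2_norm (\<lambda>w. G w - \<Psi> w * Shat w) \<le> 0 + e" by (simp only: add_0_left)
  qed
  then have "L2_norm (\<lambda>w. G w - \<Psi> w * Shat w) = 0"
    using L2_norm_nonneg[of "\<lambda>w. G w - \<Psi> w * Shat w"] by linarith
  moreover have "(\<lambda>w. G w - \<Psi> w * Shat w) \<in> L2" using *[OF zero_less_one] by blast
  ultimately have "AE w in lebesgue. G w - \<Psi> w * Shat w = 0"
    using L2_norm_eq_0_AE by blast
  then show ?thesis by eventually_elim simp
qed

text \<open>If the multiplier \<open>\<Phi>\<close> vanished on a periodic set of positive measure, the Fourier coefficients of
  the indicator of that set would give a nontrivial square-summable relation between the translates of \<open>f\<close>.\<close>

lemma riesz_multiplier_nonzero:
  assumes V: "rkhs V" and riesz: "riesz_basis V (translates f)" and ft: "L2_fourier f F"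
    and zero: "AE w in lebesgue. \<Phi> w = 0 \<longrightarrow> F w = 0"
    and meas: "\<Phi> \<in> borel_measurable lebesgue" and per: "\<And>w. \<Phi> (w + 2 * pi) = (\<Phi> w :: complex)"
  shows "AE w in lebesgue. \<Phi> w \<noteq> 0"
proof -
  obtain A B where AB: "A > 0" "upper_bound_system B (translates f)"
    "\<And>K c. finite K \<Longrightarrow> A * (\<Sum>k\<in>K. (cmod (c k))\<^sup>2) \<le> (L2_norm (\<lambda>x. \<Sum>k\<in>K. c k * translates f k x))\<^sup>2"
    using riesz_basis_bounds[OF V riesz] by blast
  define Z where "Z = {w. \<Phi> w = 0}"
  have Zm: "Z \<in> sets lebesgue"
  proof -
    have "{w \<in> space lebesgue. \<Phi> w = 0} \<in> sets lebesgue" using meas by measurable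
    then show ?thesis by (simp add: Z_def)
  qed
  have Zper: "w + 2 * pi * of_int k \<in> Z \<longleftrightarrow> w \<in> Z" for w k
    unfolding Z_def using periodic_int_multiple[of \<Phi> "2 * pi", OF per] by simp
  define u :: "real \<Rightarrow> complex" where "u = (\<lambda>w. indicator {-pi..pi} w * indicator Z w)"
  have um: "u \<in> borel_measurable lebesgue"
    unfolding u_def by (intro borel_measurable_times borel_measurable_indicator Zm) simp
  have u: "u \<in> L2"
  proof (rule L2_dominated[OF um])
    show "integrable lebesgue (indicat_real {-pi..pi})" by (auto simp: emeasure_lborel_Icc_eq)
  qed (auto simp: u_def indicator_def)
  have u0: "u w = 0" if "w \<notin> {-pi..pi}" for w using that by (simp add: u_def)
  define z where "z = (\<lambda>k. L2_inner u (circle_exp k) / (2 * pi))"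
  have zs: "square_summable z" unfolding z_def by (rule circle_Parseval(1)[OF u u0])
  obtain r where r: "strict_mono r" "AE w in lebesgue. (\<lambda>n. partial_sum z circle_exp (r n) w) \<longlonglongrightarrow> u w"
    using circle_Parseval(3)[OF u u0] unfolding z_def by blast
  define D where "D = (\<lambda>N w. \<Sum>k\<in>{- int N..int N}. z k * cis (- (of_int k * w)))"
  have DI: "D N w = partial_sum z circle_exp N w" if "w \<in> {-pi..pi}" for N w
    unfolding D_def partial_sum_def circle_exp_def indicator_simps(1)[OF that] mult_1 ..
  have Dper: "D N (w + 2 * pi * of_int l) = D N w" for N w and l :: int
    unfolding D_def cis_int_periodic ..
  have Dlim: "AE w in lebesgue. (\<lambda>n. D (r n) w) \<longlonglongrightarrow> indicator Z w"
    using AE_all_int_shifts[OF r(2), of "2 * pi"]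
  proof eventually_elim
    case (elim w)
    obtain k :: int where "w - 2 * pi * of_int k \<in> {-pi..<-pi + 2 * pi}"
      using unique_period_index[of "2 * pi" w "-pi"] by auto
    then have v: "w + 2 * pi * of_int (- k) \<in> {-pi..pi}" by auto
    from elim[rule_format, of "- k"]
    have "(\<lambda>n. D (r n) (w + 2 * pi * of_int (- k))) \<longlonglongrightarrow> u (w + 2 * pi * of_int (- k))"
      unfolding DI[OF v] .
    moreover have "u (w + 2 * pi * of_int (- k)) = indicator Z w"
      unfolding u_def indicator_simps(1)[OF v] mult_1 using Zper[of w "- k"] by (simp only: indicator_def)
    ultimately show ?case unfolding Dper by (simp only:)
  qed
  define b where "b = (\<lambda>k::int. \<lambda>w. cis (- (of_int k * w)) * F w)"
  have bL2: "b k \<in> L2" for k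
    using L2_fourier_translates[OF ft, of k] by (simp add: b_def L2_fourier_def)
  have b: "upper_bound_system (2 * pi * B) b"
    unfolding upper_bound_system_def
  proof (intro conjI allI impI bL2)
    fix K :: "int set" and c assume K: "finite K"
    have "L2_fourier (\<lambda>x. \<Sum>k\<in>K. c k * translates f k x) (\<lambda>w. \<Sum>k\<in>K. c k * b k w)"
      unfolding b_def by (intro L2_fourier_sum[OF K] L2_fourier_translates ft)
    from L2_fourier_norm[OF this]
    show "(L2_norm (\<lambda>w. \<Sum>k\<in>K. c k * b k w))\<^sup>2 \<le> 2 * pi * B * (\<Sum>k\<in>K. (cmod (c k))\<^sup>2)"
      using upper_bound_system_D[OF AB(2) K, of c] by simp
  qed
  have psL2: "partial_sum z b N \<in> L2" for N by (rule partial_sum_L2[OF bL2])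
  have Cauchy: "\<exists>N. \<forall>m\<ge>N. \<forall>n\<ge>N. L2_norm (\<lambda>x. partial_sum z b (r m) x - partial_sum z b (r n) x) < e" if "e > 0" for e
  proof -
    obtain N where N: "\<forall>m\<ge>N. \<forall>n\<ge>N. L2_norm (\<lambda>x. partial_sum z b m x - partial_sum z b n x) < e"
      using upper_bound_system_Cauchy[OF b zs \<open>e > 0\<close>] by blast
    have "r m \<ge> N" if "m \<ge> N" for m using seq_suble[OF r(1), of m] that by linarith
    then show ?thesis using N by blast
  qed
  obtain G r' where G: "G \<in> L2" "(\<lambda>n. L2_norm (\<lambda>x. G x - partial_sum z b (r n) x)) \<longlonglongrightarrow> 0"
    "strict_mono r'" "AE x in lebesgue. (\<lambda>n. partial_sum z b (r (r' n)) x) \<longlonglongrightarrow> G x"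
    using L2_complete[OF psL2 Cauchy] by blast
  have "AE x in lebesgue. G x = 0"
    using G(4) Dlim zero
  proof eventually_elim
    case (elim w)
    have "(\<lambda>n. D (r (r' n)) w * F w) \<longlonglongrightarrow> indicator Z w * F w"
      by (rule tendsto_mult_right[OF LIMSEQ_subseq_LIMSEQ[OF elim(2) G(3), unfolded o_def]])
    moreover have "indicator Z w * F w = 0" using elim(3) by (cases "w \<in> Z") (auto simp: Z_def)
    moreover have "(\<lambda>n. D (r (r' n)) w * F w) \<longlonglongrightarrow> G w"
      using elim(1) unfolding b_def partial_sum_modulated D_def .
    ultimately show ?case using LIMSEQ_unique by metis
  qed
  then have "L2_norm G = 0" using L2_norm_eq_0_AE[OF G(1)] by blast
  with tendsto_L2_norm[OF psL2 G(1,2)] have lim0: "(\<lambda>n. L2_norm (partial_sum z b (r n))) \<longlonglongrightarrow> 0" by (simp only:)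
  have n: "L2_norm (partial_sum z (translates f) N) = sqrt ((L2_norm (partial_sum z b N))\<^sup>2 / (2 * pi))" for N
    using L2_fourier_norm[OF L2_fourier_partial_sum[OF ft, of z N]] unfolding b_def by simp
  have "(\<lambda>n. sqrt ((L2_norm (partial_sum z b (r n)))\<^sup>2 / (2 * pi))) \<longlonglongrightarrow> sqrt (0\<^sup>2 / (2 * pi))"
    by (intro tendsto_intros lim0) simp
  then have "(\<lambda>n. L2_norm (partial_sum z (translates f) (r n))) \<longlonglongrightarrow> 0" unfolding n by simp
  note low = lower_bound_limit[OF AB(1,3) this r(1)]
  have z0: "z k = 0" for k
    using low[of "{k}"] AB(1) by (simp add: mult_le_0_iff)
  have "AE w in lebesgue. u w = 0"
  proof (rule circle_inner_eq_0[OF u])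
    show "L2_inner u (circle_exp k) = 0" for k using z0[of k] by (simp add: z_def)
  qed (rule u0)
  from AE_all_int_shifts[OF this, of "2 * pi"] show ?thesis
  proof eventually_elim
    case (elim w)
    obtain k :: int where "w - 2 * pi * of_int k \<in> {-pi..<-pi + 2 * pi}"
      using unique_period_index[of "2 * pi" w "-pi"] by auto
    then have v: "w + 2 * pi * of_int (- k) \<in> {-pi..pi}" by auto
    have "indicator Z (w + 2 * pi * of_int (- k)) = (0::complex)"
      using elim[rule_format, of "- k"] unfolding u_def indicator_simps(1)[OF v] mult_1 .
    then have "w + 2 * pi * of_int (- k) \<notin> Z" by (simp only: indicator_def split: if_splits) simp
    then show "\<Phi> w \<noteq> 0" using Zper[of w "- k"] by (simp add: Z_def)
  qed
qed

lemma bisums_unique: "bisums a s \<Longrightarrow> bisums a t \<Longrightarrow> s = t"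
  unfolding bisums_def by (rule LIMSEQ_unique)

lemma bisum_eq: "bisums a s \<Longrightarrow> bisum a = s"
  unfolding bisum_def by (rule the_equality) (auto dest: bisums_unique)

text \<open>Averaging over the half period removes the odd terms, so the convergence of the series at the
  half-integers gives that of the series at the integers.\<close>

lemma bisums_even_part:
  assumes "\<And>w. bisums (\<lambda>k. a k * cis (- (w * of_int k / 2))) (s w)"
  shows "(\<lambda>N. \<Sum>k\<in>{- int N..int N}. a (2 * k) * cis (- (of_int k * w))) \<longlonglongrightarrow> (s w + s (w + 2 * pi)) / 2"
proof -
  define T where "T = (\<lambda>N w. \<Sum>k\<in>{- int N..int N}. a k * cis (- (w * of_int k / 2)))"
  have T: "(\<lambda>N. T N w) \<longlonglongrightarrow> s w" for w
    using assms[of w] unfolding bisums_def T_def .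
  have eq: "(T (2 * N) w + T (2 * N) (w + 2 * pi)) / 2 = (\<Sum>k\<in>{- int N..int N}. a (2 * k) * cis (- (of_int k * w)))" for N
  proof -
    let ?g = "\<lambda>k. a k * (cis (- (w * of_int k / 2)) + cis (- ((w + 2 * pi) * of_int k / 2)))"
    have "T (2 * N) w + T (2 * N) (w + 2 * pi) = (\<Sum>k\<in>{- int (2 * N)..int (2 * N)}. ?g k)"
      unfolding T_def sum.distrib[symmetric] distrib_left ..
    also have "\<dots> = (\<Sum>k\<in>(*) 2 ` {- int N..int N}. ?g k)"
    proof (rule sum.mono_neutral_right)
      show "\<forall>k\<in>{- int (2 * N)..int (2 * N)} - (*) 2 ` {- int N..int N}. ?g k = 0"
      proof
        fix k assume k: "k \<in> {- int (2 * N)..int (2 * N)} - (*) 2 ` {- int N..int N}"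
        have "odd k"
        proof
          assume "even k"
          then obtain m where "k = 2 * m" by (elim evenE)
          with k show False by auto
        qed
        then obtain m where m: "k = 2 * m + 1" by (elim oddE)
        have "- ((w + 2 * pi) * of_int k / 2) = (- (w * of_int k / 2) - pi) + 2 * pi * of_int (- m)"
          by (simp add: m field_simps)
        then have "cis (- ((w + 2 * pi) * of_int k / 2)) = cis (- (w * of_int k / 2) - pi) * cis (2 * pi * of_int (- m))"
          by (simp only: cis_mult)
        also have "cis (2 * pi * of_int (- m)) = 1" by (rule cis_multiple_2pi) simp
        also have "cis (- (w * of_int k / 2) - pi) = - cis (- (w * of_int k / 2))"
          by (simp add: complex_eq_iff cos_diff sin_diff)
        finally show "?g k = 0" by simp
      qed
    qed auto
    also have "\<dots> = (\<Sum>k\<in>{- int N..int N}. ?g (2 * k))"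
      by (subst sum.reindex) (auto simp: inj_on_def)
    also have "\<dots> = (\<Sum>k\<in>{- int N..int N}. 2 * (a (2 * k) * cis (- (of_int k * w))))"
    proof (rule sum.cong)
      fix k :: int
      have "cis (- ((w + 2 * pi) * of_int (2 * k) / 2)) = cis (- (of_int k * w))"
        using cis_int_periodic[of k w 1] by (simp add: mult.commute)
      moreover have "cis (- (w * of_int (2 * k) / 2)) = cis (- (of_int k * w))" by (simp add: mult.commute)
      ultimately show "?g (2 * k) = 2 * (a (2 * k) * cis (- (of_int k * w)))" by (simp only:) simp
    qed simp
    finally show ?thesis unfolding sum_distrib_left[symmetric] by simp
  qed
  have "(\<lambda>N. T (2 * N) w) \<longlonglongrightarrow> s w" for w
  proof -
    have "filterlim (\<lambda>N::nat. 2 * N) sequentially sequentially"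
      by (rule filterlim_subseq) (simp add: strict_mono_def)
    from filterlim_compose[OF T this] show ?thesis .
  qed
  then have "(\<lambda>N. (T (2 * N) w + T (2 * N) (w + 2 * pi)) / 2) \<longlonglongrightarrow> (s w + s (w + 2 * pi)) / 2"
    by (intro tendsto_intros) auto
  then show ?thesis unfolding eq .
qed

lemma (in interpolating_generator) refinement_symbol:
  assumes S: "L2_fourier S Shat" and \<phi>: "L2_fourier \<phi> \<phi>hat" "\<phi> \<in> V" "(\<lambda>x. \<phi> (x / 2)) \<in> V"
    and \<phi>riesz: "riesz_basis V (translates \<phi>)" and poisson: "poisson_summation \<phi> \<phi>hat"
  obtains P where "\<And>w. P (w + 4 * pi) = P w" "AE w in lebesgue. Shat w = P w * Shat (w / 2)"
    "AE w in lebesgue. P_symbol Shat w = P w"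
proof -
  have "\<forall>w. \<exists>s. bisums (\<lambda>k. \<phi> (of_int k / 2) * cis (- (w * of_int k / 2))) s \<and>
      bisums (\<lambda>k. \<phi>hat (w + 4 * of_int k * pi)) (s / 2)"
  proof
    fix w
    obtain s t where st: "bisums (\<lambda>k. \<phi> (of_int k / 2) * exp (- (\<i> * of_real (w * of_int k / 2)))) s"
      "bisums (\<lambda>k. \<phi>hat (w + 4 * of_int k * pi)) t" "1 / 2 * s = t"
      using poisson unfolding poisson_summation_def by blast
    have "exp (- (\<i> * of_real y)) = cis (- y)" for y by (simp add: cis_conv_exp)
    then have "bisums (\<lambda>k. \<phi> (of_int k / 2) * cis (- (w * of_int k / 2))) s"
      using st(1) by (simp only:)
    moreover have "t = s / 2" using st(3) by simp
    ultimately show "\<exists>s. bisums (\<lambda>k. \<phi> (of_int k / 2) * cis (- (w * of_int k / 2))) s \<and>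
      bisums (\<lambda>k. \<phi>hat (w + 4 * of_int k * pi)) (s / 2)"
      using st(2) by blast
  qed
  from choice[OF this] obtain s where
    s': "\<forall>w. bisums (\<lambda>k. \<phi> (of_int k / 2) * cis (- (w * of_int k / 2))) (s w) \<and>
      bisums (\<lambda>k. \<phi>hat (w + 4 * of_int k * pi)) (s w / 2)" ..
  have s: "bisums (\<lambda>k. \<phi> (of_int k / 2) * cis (- (w * of_int k / 2))) (s w)"
    "bisums (\<lambda>k. \<phi>hat (w + 4 * of_int k * pi)) (s w / 2)" for w
    using s'[rule_format, of w] by (rule conjunct1, rule conjunct2)
  have sper: "s (w + 4 * pi) = s w" for w
  proof (rule bisums_unique[OF _ s(1)])
    have "cis (- ((w + 4 * pi) * of_int k / 2)) = cis (- (w * of_int k / 2))" for k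
      using cis_int_periodic[of k "w/2" 1] by (simp add: algebra_simps add_divide_distrib)
    then show "bisums (\<lambda>k. \<phi> (of_int k / 2) * cis (- (w * of_int k / 2))) (s (w + 4 * pi))"
      using s(1)[of "w + 4 * pi"] by (simp only:)
  qed
  define \<Phi> where "\<Phi> = (\<lambda>w. (s w + s (w + 2 * pi)) / 2)"
  have \<Phi>per: "\<Phi> (w + 2 * pi) = \<Phi> w" for w
    using sper[of w] by (simp add: \<Phi>_def add.commute add.left_commute)
  have lim\<Phi>: "(\<lambda>N. \<Sum>k\<in>{- int N..int N}. \<phi> (of_int k) * cis (- (of_int k * w))) \<longlonglongrightarrow> \<Phi> w" for w
    using bisums_even_part[OF s(1), of w] unfolding \<Phi>_def by simp
  have \<Phi>m: "\<Phi> \<in> borel_measurable lebesgue"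
    by (rule borel_measurable_LIMSEQ_metric[OF trig_sum_measurable lim\<Phi>])
  have eq1: "AE w in lebesgue. \<phi>hat w = \<Phi> w * Shat w"
    by (rule fourier_multiplier[OF S \<phi>(2,1) lim\<Phi>])
  have eq2: "AE w in lebesgue. 2 * \<phi>hat w = s w * Shat (w / 2)"
  proof -
    have "L2_fourier (\<lambda>x. \<phi> (x / 2)) (\<lambda>w. \<phi>hat (w / (1/2)) / of_real (1/2))"
      using L2_fourier_dilate[OF \<phi>(1), of "1/2"] by simp
    moreover have "(\<lambda>N. \<Sum>k\<in>{- int N..int N}. \<phi> (of_int k / 2) * cis (- (of_int k * w))) \<longlonglongrightarrow> s (2 * w)" for w
      using s(1)[of "2 * w"] unfolding bisums_def by (simp add: mult.commute)
    ultimately have "AE w in lebesgue. \<phi>hat (w / (1/2)) / of_real (1/2) = s (2 * w) * Shat w"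
      by (rule fourier_multiplier[OF S \<phi>(3)])
    from AE_lebesgue_affine[OF this, of "1/2" 0] show ?thesis by (simp add: mult.commute)
  qed
  have nz: "AE w in lebesgue. \<Phi> w \<noteq> 0"
  proof (rule riesz_multiplier_nonzero[OF V \<phi>riesz \<phi>(1) _ \<Phi>m \<Phi>per])
    show "AE w in lebesgue. \<Phi> w = 0 \<longrightarrow> \<phi>hat w = 0" using eq1 by eventually_elim simp
  qed
  define P where "P = (\<lambda>w. s w / (2 * \<Phi> w))"
  show ?thesis
  proof (rule that)
    show "P (w + 4 * pi) = P w" for w
    proof -
      have "w + 4 * pi = (w + 2 * pi) + 2 * pi" by simp
      then have "\<Phi> (w + 4 * pi) = \<Phi> w" by (simp only: \<Phi>per)
      then show ?thesis by (simp only: P_def sper)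
    qed
    show "AE w in lebesgue. Shat w = P w * Shat (w / 2)"
      using eq1 eq2 nz
    proof eventually_elim
      case (elim w)
      have "2 * (\<Phi> w * Shat w) = s w * Shat (w / 2)" using elim(1,2) by (simp only:)
      then show ?case using elim(3) by (simp add: P_def nonzero_eq_divide_eq mult_ac)
    qed
    have div_helper: "c \<noteq> 0 \<Longrightarrow> a = c * b \<Longrightarrow> b = a / c" for a b c :: complex by simp
    show "AE w in lebesgue. P_symbol Shat w = P w"
      using AE_all_int_shifts[OF eq1, of "4 * pi"] nz
    proof eventually_elim
      case (elim w)
      have "Shat (w + 4 * of_int k * pi) = \<phi>hat (w + 4 * of_int k * pi) / \<Phi> w" for k :: int
      proof -
        have "\<Phi> (w + 4 * pi * of_int k) = \<Phi> w"
          using periodic_int_multiple[of \<Phi> "2 * pi", OF \<Phi>per, of w "2 * k"] by (simp add: mult_ac)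
        then have "\<phi>hat (w + 4 * pi * of_int k) = \<Phi> w * Shat (w + 4 * pi * of_int k)"
          using elim(1)[rule_format, of k] by (simp only:)
        moreover have "w + 4 * pi * of_int k = w + 4 * of_int k * pi" by simp
        ultimately have "\<phi>hat (w + 4 * of_int k * pi) = \<Phi> w * Shat (w + 4 * of_int k * pi)" by (simp only:)
        then show ?thesis by (rule div_helper[OF elim(2)])
      qed
      then have "(\<Sum>k\<in>{- int N..int N}. Shat (w + 4 * of_int k * pi)) =
          (\<Sum>k\<in>{- int N..int N}. \<phi>hat (w + 4 * of_int k * pi)) / \<Phi> w" for N
        by (simp only: sum_divide_distrib)
      then have "bisums (\<lambda>k. Shat (w + 4 * of_int k * pi)) (s w / 2 / \<Phi> w)"
        using tendsto_divide[OF s(2)[of w, unfolded bisums_def] tendsto_const elim(2)]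
        unfolding bisums_def by (simp only:)
      then show ?case unfolding P_symbol_def by (simp add: bisum_eq P_def)
    qed
  qed
qed

lemma has_sum_int_even_odd:
  fixes f :: "int \<Rightarrow> 'a :: topological_comm_monoid_add"
  assumes "((\<lambda>n. f (2 * n)) has_sum a) UNIV" "((\<lambda>n. f (2 * n + 1)) has_sum b) UNIV"
  shows "(f has_sum (a + b)) UNIV"
proof -
  have "(f has_sum a) (range (\<lambda>n. 2 * n))" "(f has_sum b) (range (\<lambda>n. 2 * n + 1))"
    using assms by (simp_all add: has_sum_reindex inj_def o_def)
  moreover have "range (\<lambda>n::int. 2 * n) \<inter> range (\<lambda>n. 2 * n + 1) = {}" by auto presburger
  moreover have "range (\<lambda>n::int. 2 * n) \<union> range (\<lambda>n. 2 * n + 1) = UNIV"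
  proof -
    have "n \<in> range (\<lambda>n. 2 * n) \<union> range (\<lambda>n. 2 * n + 1)" for n :: int
      by (cases "even n") (auto elim: evenE oddE)
    then show ?thesis by blast
  qed
  ultimately show ?thesis using has_sum_Un_disjoint by metis
qed

lemma AE_summable_periodization:
  assumes "F \<in> L2"
  shows "AE w in lebesgue. (\<lambda>k::int. (cmod (F (w + 2 * of_int k * pi)))\<^sup>2) summable_on UNIV"
proof -
  have "integrable lebesgue (\<lambda>w. complex_of_real ((cmod (F w))\<^sup>2))"
    using L2_integrable_sq[OF assms] by (rule integrable_of_real)
  note per = integral_periodize(1)[OF this, of "2 * pi"]
  have "AE w in lebesgue. \<forall>l::int. w \<in> {2 * pi * of_int l..<2 * pi * of_int l + 2 * pi} \<longrightarrow>
     (\<lambda>k::int. norm (complex_of_real ((cmod (F (w + 2 * pi * of_int k)))\<^sup>2))) summable_on UNIV"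
    unfolding AE_all_countable by (intro allI per) simp
  then show ?thesis
  proof eventually_elim
    case (elim w)
    obtain l :: int where "w - 2 * pi * of_int l \<in> {0..<0 + 2 * pi}"
      using unique_period_index[of "2 * pi" w 0] by auto
    then have "w \<in> {2 * pi * of_int l..<2 * pi * of_int l + 2 * pi}" by auto
    from elim[rule_format, OF this]
    have "(\<lambda>k::int. norm (complex_of_real ((cmod (F (w + 2 * pi * of_int k)))\<^sup>2))) summable_on UNIV" .
    moreover have "norm (complex_of_real ((cmod (F (w + 2 * pi * of_int k)))\<^sup>2)) = (cmod (F (w + 2 * of_int k * pi)))\<^sup>2" for k :: int
    proof -
      have "w + 2 * pi * of_int k = w + 2 * of_int k * pi" by simp
      then show ?thesis by (simp only: norm_of_real abs_power2)
    qed
    ultimately show ?case by (simp only:)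
  qed
qed

lemma E_symbol_has_sum:
  assumes "(\<lambda>k::int. (cmod (Shat (v / 2 + 2 * of_int k * pi)))\<^sup>2) summable_on UNIV"
  shows "((\<lambda>k::int. complex_of_real ((cmod (Shat (v / 2 + 2 * of_int k * pi)))\<^sup>2)) has_sum of_real (E_symbol Shat v)) UNIV"
  unfolding E_symbol_def by (rule has_sum_of_real[OF has_sum_infsum[OF assms]])

locale fourier_interpolating_generator = interpolating_generator +
  fixes Shat P :: "real \<Rightarrow> complex"
  assumes ft: "L2_fourier S Shat"
    and P_per: "P (w + 4 * pi) = P w"
    and P_refine: "AE w in lebesgue. Shat w = P w * Shat (w / 2)"
    and P_eq: "AE w in lebesgue. P_symbol Shat w = P w"
begin

definition gram_density :: "int \<Rightarrow> real \<Rightarrow> complex" where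
  "gram_density k v = cis (- (of_int k * v)) * (Shat (v / 2) * cnj (Shat v))"

lemma Shat_L2: "Shat \<in> L2"
  using ft by (simp add: L2_fourier_def)

lemma gram_density_integrable: "integrable lebesgue (gram_density k)"
proof -
  have "(\<lambda>v. Shat (0 + (1/2) * v)) \<in> L2" by (rule L2_affine[OF Shat_L2]) simp
  then have "(\<lambda>v. Shat (v / 2)) \<in> L2" by simp
  from L2_inner_integrable[OF L2_mult_cis[OF this, of "of_int k"] Shat_L2]
  show ?thesis unfolding gram_density_def[abs_def] by (simp only: mult.assoc)
qed

lemma inner_eq_gram_density_integral:
  "L2_inner (translates S (2 * m)) (half_translates k) = (LINT v|lebesgue. gram_density (m - k) v) / (2 * pi)"
proof -
  have "L2_fourier (\<lambda>x. S (1/2 * x)) (\<lambda>w. Shat (w / (1/2)) / of_real (1/2))"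
    by (rule L2_fourier_dilate[OF ft]) simp
  from L2_fourier_translate[OF this, of "2 * of_int k"]
  have half: "L2_fourier (half_translates k) (\<lambda>w. cis (- (2 * of_int k * w)) * (2 * Shat (2 * w)))"
    unfolding half_translates_def[abs_def] by (simp add: mult.commute right_diff_distrib)
  have "of_real (2 * pi) * L2_inner (translates S (2 * m)) (half_translates k) =
     L2_inner (\<lambda>w. cis (- (of_int (2 * m) * w)) * Shat w) (\<lambda>w. cis (- (2 * of_int k * w)) * (2 * Shat (2 * w)))"
    by (rule L2_fourier_inner[OF L2_fourier_translates[OF ft] half, symmetric])
  also have "\<dots> = (LINT w|lebesgue. (cis (- (of_int (2 * m) * w)) * Shat w) * cnj (cis (- (2 * of_int k * w)) * (2 * Shat (2 * w))))"
    unfolding L2_inner_def ..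
  also have "\<dots> = \<bar>1/2\<bar> *\<^sub>R (LINT v|lebesgue. (cis (- (of_int (2 * m) * (0 + 1/2 * v))) * Shat (0 + 1/2 * v)) *
      cnj (cis (- (2 * of_int k * (0 + 1/2 * v))) * (2 * Shat (2 * (0 + 1/2 * v)))))"
    by (rule lebesgue_integral_real_affine) simp
  also have "\<dots> = \<bar>1/2\<bar> *\<^sub>R (LINT v|lebesgue. 2 * gram_density (m - k) v)"
  proof -
    have "(cis (- (of_int (2 * m) * (0 + 1/2 * v))) * Shat (0 + 1/2 * v)) *
      cnj (cis (- (2 * of_int k * (0 + 1/2 * v))) * (2 * Shat (2 * (0 + 1/2 * v)))) = 2 * gram_density (m - k) v" for v
    proof -
      have "cis (- (of_int (2 * m) * (0 + 1/2 * v))) * cnj (cis (- (2 * of_int k * (0 + 1/2 * v)))) = cis (- (of_int (m - k) * v))"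
      proof -
        have "of_int (2 * m) * (0 + 1/2 * v) = of_int m * v" "2 * of_int k * (0 + 1/2 * v) = of_int k * v" by simp_all
        then show ?thesis by (simp only: cis_cnj cis_mult minus_minus) (simp add: left_diff_distrib)
      qed
      moreover have "0 + 1/2 * v = v / 2" "2 * (0 + 1/2 * v) = v" by simp_all
      moreover have "(a * x) * cnj (b * (2 * y)) = 2 * ((a * cnj b) * (x * cnj y))" for a b x y by simp
      ultimately show ?thesis unfolding gram_density_def by (simp only:)
    qed
    then show ?thesis by (simp only:)
  qed
  also have "\<dots> = (LINT v|lebesgue. gram_density (m - k) v)"
    by (simp add: scaleR_conv_of_real)
  finally show ?thesis by (simp add: nonzero_eq_divide_eq mult.commute)
qed

lemma AE_gram_density_has_sum:
  "AE v in lebesgue. \<forall>k. ((\<lambda>l::int. gram_density k (v + 2 * pi * of_int l)) has_sum (PE_symbol Shat v * cis (- (of_int k * v)))) UNIV"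
proof -
  have half: "AE v in lebesgue. (\<lambda>k::int. (cmod (Shat (v / 2 + 2 * of_int k * pi)))\<^sup>2) summable_on UNIV"
    using AE_lebesgue_affine[OF AE_summable_periodization[OF Shat_L2], of "1/2" 0] by simp
  have shift: "AE v in lebesgue. Q (v + 2 * pi)" if "AE v in lebesgue. Q v" for Q
    using AE_lebesgue_affine[OF that one_neq_zero, of "2 * pi"] by (simp add: add.commute)
  show ?thesis
    using half shift[OF half] P_eq shift[OF P_eq] AE_all_int_shifts[OF P_refine, of "2 * pi"]
  proof eventually_elim
    case (elim v)
    note E = E_symbol_has_sum[OF elim(1)] E_symbol_has_sum[OF elim(2)]
    have ref: "Shat (v + 2 * pi * of_int l) = P (v + 2 * pi * of_int l) * Shat ((v + 2 * pi * of_int l) / 2)" for l :: int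
      using elim(5) by blast
    have g: "gram_density k (v + 2 * pi * of_int l) = cis (- (of_int k * v)) *
       (cnj (P (v + 2 * pi * of_int l)) * complex_of_real ((cmod (Shat ((v + 2 * pi * of_int l) / 2)))\<^sup>2))" for k l :: int
      unfolding gram_density_def cis_int_periodic ref[of l] complex_norm_square
      by (simp only: complex_cnj_mult mult_ac)
    have even: "gram_density k (v + 2 * pi * of_int (2 * n)) = cis (- (of_int k * v)) *
       (cnj (P v) * complex_of_real ((cmod (Shat (v / 2 + 2 * of_int n * pi)))\<^sup>2))" for k n :: int
    proof -
      have "(v + 2 * pi * of_int (2 * n)) / 2 = v / 2 + 2 * of_int n * pi" by (simp add: add_divide_distrib)
      moreover have "P (v + 2 * pi * of_int (2 * n)) = P v"
        using periodic_int_multiple[of P "4 * pi", OF P_per, of v n] by (simp add: mult_ac)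
      ultimately show ?thesis unfolding g by (simp only:)
    qed
    have odd: "gram_density k (v + 2 * pi * of_int (2 * n + 1)) = cis (- (of_int k * v)) *
       (cnj (P (v + 2 * pi)) * complex_of_real ((cmod (Shat ((v + 2 * pi) / 2 + 2 * of_int n * pi)))\<^sup>2))" for k n :: int
    proof -
      have "(v + 2 * pi * of_int (2 * n + 1)) / 2 = (v + 2 * pi) / 2 + 2 * of_int n * pi"
        by (simp add: field_simps)
      moreover have "P (v + 2 * pi * of_int (2 * n + 1)) = P (v + 2 * pi)"
      proof -
        have "v + 2 * pi * of_int (2 * n + 1) = (v + 2 * pi) + 4 * pi * of_int n" by (simp add: algebra_simps)
        then show ?thesis using periodic_int_multiple[of P "4 * pi", OF P_per, of "v + 2 * pi" n] by (simp only:)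
      qed
      ultimately show ?thesis unfolding g by (simp only:)
    qed
    show ?case
    proof
      fix k :: int
      have "((\<lambda>l::int. gram_density k (v + 2 * pi * of_int l)) has_sum
          (cis (- (of_int k * v)) * (cnj (P v) * of_real (E_symbol Shat v)) +
           cis (- (of_int k * v)) * (cnj (P (v + 2 * pi)) * of_real (E_symbol Shat (v + 2 * pi))))) UNIV"
        by (rule has_sum_int_even_odd; unfold even odd; intro has_sum_cmult_right E)
      also have "cis (- (of_int k * v)) * (cnj (P v) * of_real (E_symbol Shat v)) +
           cis (- (of_int k * v)) * (cnj (P (v + 2 * pi)) * of_real (E_symbol Shat (v + 2 * pi))) =
          PE_symbol Shat v * cis (- (of_int k * v))"
        unfolding PE_symbol_def elim(3,4) by (simp add: algebra_simps)
      finally show "((\<lambda>l::int. gram_density k (v + 2 * pi * of_int l)) has_sum (PE_symbol Shat v * cis (- (of_int k * v)))) UNIV" .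
    qed
  qed
qed

definition cut_PE :: "real \<Rightarrow> complex" where
  "cut_PE v = indicator {-pi..pi} v * PE_symbol Shat v"

lemma AE_cut_PE:
  "AE v in lebesgue. \<forall>k. indicator {-pi..<-pi + 2 * pi} v * (\<Sum>\<^sub>\<infinity>l::int. gram_density k (v + 2 * pi * of_int l)) =
     cut_PE v * cis (- (of_int k * v))"
proof -
  have "AE v in lebesgue. v \<noteq> pi" by (intro AE_completion AE_lborel_singleton)
  with AE_gram_density_has_sum show ?thesis
  proof eventually_elim
    case (elim v)
    have "indicator {-pi..<-pi + 2 * pi} v = (indicator {-pi..pi} v :: complex)"
      using elim(2) by (auto simp: indicator_def)
    then show ?case
      unfolding cut_PE_def using infsumI[OF elim(1)[rule_format]] by (simp only: mult.assoc) simp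
  qed
qed

lemma cut_PE_measurable: "cut_PE \<in> borel_measurable lebesgue"
proof (rule borel_measurable_AE)
  show "(\<lambda>v. indicator {-pi..<-pi + 2 * pi} v * (\<Sum>\<^sub>\<infinity>l::int. gram_density 0 (v + 2 * pi * of_int l))) \<in> borel_measurable lebesgue"
    by (rule borel_measurable_integrable[OF integral_periodize(2)[OF gram_density_integrable]]) simp
  show "AE v in lebesgue. indicator {-pi..<-pi + 2 * pi} v * (\<Sum>\<^sub>\<infinity>l::int. gram_density 0 (v + 2 * pi * of_int l)) = cut_PE v"
    using AE_cut_PE by eventually_elim (drule spec[of _ 0], simp)
qed

lemma gram_cut_PE:
  "L2_inner (translates S (2 * m)) (half_translates k) = L2_inner cut_PE (circle_exp (k - m)) / (2 * pi)"
proof -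
  have p: "0 < 2 * pi" by simp
  note [measurable] = cut_PE_measurable
  have "(LINT v|lebesgue. gram_density (m - k) v) =
      (LINT v|lebesgue. indicator {-pi..<-pi + 2 * pi} v * (\<Sum>\<^sub>\<infinity>l::int. gram_density (m - k) (v + 2 * pi * of_int l)))"
    by (rule integral_periodize(3)[OF gram_density_integrable p, symmetric])
  also have "\<dots> = (LINT v|lebesgue. cut_PE v * cis (- (of_int (m - k) * v)))"
  proof (rule integral_cong_AE)
    show "(\<lambda>v. indicator {-pi..<-pi + 2 * pi} v * (\<Sum>\<^sub>\<infinity>l::int. gram_density (m - k) (v + 2 * pi * of_int l))) \<in> borel_measurable lebesgue"
      by (rule borel_measurable_integrable[OF integral_periodize(2)[OF gram_density_integrable p]])
    show "(\<lambda>v. cut_PE v * cis (- (of_int (m - k) * v))) \<in> borel_measurable lebesgue" by measurable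
    show "AE v in lebesgue. indicator {-pi..<-pi + 2 * pi} v * (\<Sum>\<^sub>\<infinity>l::int. gram_density (m - k) (v + 2 * pi * of_int l)) =
        cut_PE v * cis (- (of_int (m - k) * v))"
      using AE_cut_PE by eventually_elim (erule spec)
  qed
  also have "\<dots> = L2_inner cut_PE (circle_exp (k - m))"
    unfolding L2_inner_def
  proof (rule Bochner_Integration.integral_cong)
    fix v
    show "cut_PE v * cis (- (of_int (m - k) * v)) = cut_PE v * cnj (circle_exp (k - m) v)"
      by (cases "v \<in> {-pi..pi}") (auto simp: cut_PE_def circle_exp_def cis_cnj algebra_simps)
  qed simp
  finally show ?thesis unfolding inner_eq_gram_density_integral by (simp only:)
qed

lemma invertible_symbol_cut_PE:
  assumes "0 < A" and bounds: "\<And>w. A \<le> (cmod (PE_symbol Shat w))\<^sup>2" "\<And>w. (cmod (PE_symbol Shat w))\<^sup>2 \<le> B"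
  shows "invertible_symbol V S cut_PE (sqrt A) (sqrt B)"
proof unfold_locales
  fix w
  show "cut_PE w = 0" if "w \<notin> {-pi..pi}" using that by (simp add: cut_PE_def)
  have eq: "cut_PE w = PE_symbol Shat w" if "w \<in> {-pi..pi}"
    unfolding cut_PE_def indicator_simps(1)[OF that] by simp
  show "sqrt A \<le> cmod (cut_PE w)" if "w \<in> {-pi..pi}"
    unfolding eq[OF that] by (rule real_le_lsqrt) (use bounds(1)[of w] \<open>0 < A\<close> in auto)
  show "cmod (cut_PE w) \<le> sqrt B" if "w \<in> {-pi..pi}"
    unfolding eq[OF that] by (rule real_le_rsqrt[OF bounds(2)])
qed (use \<open>0 < A\<close> in \<open>simp_all add: cut_PE_measurable gram_cut_PE\<close>)

end

section \<open>Dilation of the wavelet spaces\<close>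

lemma multiresolution_double:
  assumes "multiresolution_analysis V \<phi>"
  shows "f \<in> V i \<longleftrightarrow> (\<lambda>x. f (2 * x)) \<in> V (i + 1)"
proof -
  have "\<forall>j f. f \<in> V j \<longleftrightarrow> (\<lambda>x. f (2 * x)) \<in> V (j + 1)"
    using assms unfolding multiresolution_analysis_def by (elim conjE)
  then show ?thesis by (rule allE) (erule spec)
qed

lemma multiresolution_dilate:
  assumes mra: "multiresolution_analysis V \<phi>"
  shows "f \<in> V i \<longleftrightarrow> (\<lambda>x. f (2 powi n * x)) \<in> V (i + n)"
proof (induction n rule: int_induct[where k = 0])
  case (step1 n)
  have "(\<lambda>x. f (2 powi n * x)) \<in> V (i + n) \<longleftrightarrow> (\<lambda>x. f (2 powi n * (2 * x))) \<in> V (i + n + 1)"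
    by (rule multiresolution_double[OF mra])
  also have "(\<lambda>x. f (2 powi n * (2 * x))) = (\<lambda>x. f (2 powi (n + 1) * x))"
    by (simp add: power_int_add mult_ac)
  finally show ?case using step1(2) by (simp only: add.assoc)
next
  case (step2 n)
  have "(\<lambda>x. f (2 powi (n - 1) * x)) \<in> V (i + (n - 1)) \<longleftrightarrow> (\<lambda>x. f (2 powi (n - 1) * (2 * x))) \<in> V (i + (n - 1) + 1)"
    by (rule multiresolution_double[OF mra])
  also have "(\<lambda>x. f (2 powi (n - 1) * (2 * x))) = (\<lambda>x. f (2 powi n * x))"
    by (simp add: power_int_diff mult_ac)
  also have "i + (n - 1) + 1 = i + n" by simp
  finally show ?case using step2(2) by (simp only:)
qed simp

lemma wavelet_space_dilate:
  assumes mra: "multiresolution_analysis V \<phi>"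
  shows "f \<in> wavelet_space V i \<longleftrightarrow> (\<lambda>x. f (2 powi n * x)) \<in> wavelet_space V (i + n)"
proof -
  have n0: "(2::real) powi n \<noteq> 0" by simp
  have inner: "L2_inner (\<lambda>x. f (2 powi n * x)) (\<lambda>x. g (2 powi n * x)) = 0 \<longleftrightarrow> L2_inner f g = 0" for g
    using L2_inner_affine[OF n0, of f 0 g] n0 by simp
  have "(\<forall>g\<in>V (i + n). L2_inner (\<lambda>x. f (2 powi n * x)) g = 0) \<longleftrightarrow> (\<forall>g\<in>V i. L2_inner f g = 0)"
  proof
    assume L: "\<forall>g\<in>V (i + n). L2_inner (\<lambda>x. f (2 powi n * x)) g = 0"
    show "\<forall>g\<in>V i. L2_inner f g = 0"
    proof
      fix g assume "g \<in> V i"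
      then have "(\<lambda>x. g (2 powi n * x)) \<in> V (i + n)" using multiresolution_dilate[OF mra] by blast
      with L have "L2_inner (\<lambda>x. f (2 powi n * x)) (\<lambda>x. g (2 powi n * x)) = 0" by blast
      then show "L2_inner f g = 0" by (simp only: inner)
    qed
  next
    assume R: "\<forall>g\<in>V i. L2_inner f g = 0"
    show "\<forall>g\<in>V (i + n). L2_inner (\<lambda>x. f (2 powi n * x)) g = 0"
    proof
      fix g assume g: "g \<in> V (i + n)"
      define h where "h = (\<lambda>x. g (2 powi (- n) * x))"
      have "h \<in> V (i + n + (- n))" unfolding h_def using multiresolution_dilate[OF mra] g by blast
      then have "L2_inner f h = 0" using R by simp
      then have "L2_inner (\<lambda>x. f (2 powi n * x)) (\<lambda>x. h (2 powi n * x)) = 0" by (simp only: inner)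
      moreover have "(\<lambda>x. h (2 powi n * x)) = g"
        unfolding h_def by (simp add: power_int_minus mult.assoc[symmetric])
      ultimately show "L2_inner (\<lambda>x. f (2 powi n * x)) g = 0" by (simp only:)
    qed
  qed
  moreover have "f \<in> V (i + 1) \<longleftrightarrow> (\<lambda>x. f (2 powi n * x)) \<in> V (i + n + 1)"
    using multiresolution_dilate[OF mra, of f "i + 1" n] by (simp add: add_ac)
  ultimately show ?thesis unfolding wavelet_space_def by blast
qed

lemma (in interpolating_generator) wavelet_space_iff_orthogonal:
  assumes mra: "multiresolution_analysis W \<phi>" and W0: "W 0 = V"
  shows "f \<in> wavelet_space W (- 1) \<longleftrightarrow> f \<in> V \<and> (\<forall>k. L2_inner f (half_translates k) = 0)"
proof -
  have dil: "g \<in> W (- 1) \<longleftrightarrow> (\<lambda>x. g (2 * x)) \<in> V" for g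
    using multiresolution_dilate[OF mra, of g "-1" 1] by (simp add: W0)
  have half: "half_translates k \<in> W (- 1)" for k
    unfolding dil using translates_V[of k] by (simp add: half_translates_def translates_def[abs_def])
  have "L2_inner f g = 0" if f: "f \<in> V" and orth: "\<And>k. L2_inner f (half_translates k) = 0" and g: "g \<in> W (- 1)" for g
  proof -
    define h where "h = (\<lambda>x. g (2 * x))"
    have h: "h \<in> V" using g dil by (simp add: h_def)
    have gh: "g = (\<lambda>x. h (0 + 1/2 * x))" by (simp add: h_def)
    have gL2: "g \<in> L2" unfolding gh by (rule L2_affine[OF rkhs_L2[OF V h]]) simp
    let ?c = "\<lambda>k::int. h (of_int k)"
    have ps: "partial_sum ?c half_translates N = (\<lambda>x. partial_sum ?c (translates S) N (0 + 1/2 * x))" for N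
      unfolding partial_sum_def[abs_def] half_translates_eq ..
    have "(\<lambda>N. L2_norm (\<lambda>x. g x - partial_sum ?c half_translates N x)) \<longlonglongrightarrow> 0"
      unfolding ps gh by (rule tendsto_L2_norm_affine[OF _ expansion[OF h]]) simp
    from tendsto_L2_inner_right[OF partial_sum_L2[OF half_translates_L2] gL2 rkhs_L2[OF V f] this]
    have "(\<lambda>N. L2_inner f (partial_sum ?c half_translates N)) \<longlonglongrightarrow> L2_inner f g" .
    moreover have "L2_inner f (partial_sum ?c half_translates N) = 0" for N
      unfolding partial_sum_def[abs_def]
      by (simp only: L2_inner_sum_right[OF half_translates_L2 rkhs_L2[OF V f]] orth mult_zero_right sum.neutral_const)
    ultimately show ?thesis by (simp add: LIMSEQ_const_iff)
  qed
  then show ?thesis unfolding wavelet_space_def using half by (auto simp: W0)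
qed

theorem theorem1:
  fixes V :: "int \<Rightarrow> (real \<Rightarrow> complex) set"
    and \<phi> \<phi>hat S Shat :: "real \<Rightarrow> complex"
    and A B :: real
    and j :: int
    and F :: "int \<Rightarrow> complex"
  assumes "multiresolution_analysis V \<phi>"
    and "fourier_transform \<phi> \<phi>hat"
    and "poisson_summation \<phi> \<phi>hat"
    and "interpolation_basis V S"
    and "fourier_transform S Shat"
    and "0 < A" and "A \<le> B"
    and "\<forall>w. A \<le> (cmod (PE_symbol Shat w))\<^sup>2 \<and> (cmod (PE_symbol Shat w))\<^sup>2 \<le> B"
    and "square_summable F"
  shows "\<exists>!f. f \<in> wavelet_space V (j - 1) \<and>
           wavelet_samples (j - 1) f = (\<lambda>k. f ((2 * of_int k + 1) / 2 powi j)) \<and>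
           wavelet_samples (j - 1) f = F"
proof -
  note mra = assms(1)
  note mra_parts = mra[unfolded multiresolution_analysis_def]
  have V: "rkhs (V i)" for i
    using mra_parts[THEN conjunct1] by (rule spec)
  have nested: "V i \<subseteq> V (i + 1)" for i
    using mra_parts[THEN conjunct2, THEN conjunct1] by (rule spec)
  have \<phi>_riesz: "riesz_basis (V 0) (translates \<phi>)"
    using mra_parts by (elim conjE)
  interpret interpolating_generator "V 0" S
  proof
    show "rkhs (V 0)" by (rule V)
  qed (use assms(4) in \<open>simp_all add: interpolation_basis_def\<close>)
  have \<phi>: "\<phi> \<in> V 0"
  proof -
    have "translates \<phi> 0 \<in> V 0" using \<phi>_riesz by (simp add: riesz_basis_def)
    then show ?thesis by (simp add: translates_def[abs_def])
  qed
  moreover have "(\<lambda>x. \<phi> (x / 2)) \<in> V 0"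
  proof -
    have "(\<lambda>x. \<phi> (2 * x / 2)) \<in> V (-1 + 1)" using \<phi> by simp
    then have "(\<lambda>x. \<phi> (x / 2)) \<in> V (-1)"
      by (rule multiresolution_double[OF mra, THEN iffD2])
    then have "(\<lambda>x. \<phi> (x / 2)) \<in> V (-1 + 1)" by (rule subsetD[OF nested])
    then show ?thesis by simp
  qed
  ultimately obtain P where P: "\<And>w. P (w + 4 * pi) = P w" "AE w in lebesgue. Shat w = P w * Shat (w / 2)"
    "AE w in lebesgue. P_symbol Shat w = P w"
    by (rule refinement_symbol[OF fourier_transform_imp_L2_fourier[OF assms(5)]
      fourier_transform_imp_L2_fourier[OF assms(2)] _ _ \<phi>_riesz assms(3)]) (rule that)
  interpret fourier_interpolating_generator "V 0" S Shat P
  proof unfold_locales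
    show "L2_fourier S Shat" by (rule fourier_transform_imp_L2_fourier[OF assms(5)])
  qed (rule P)+
  interpret invertible_symbol "V 0" S cut_PE "sqrt A" "sqrt B"
    by (rule invertible_symbol_cut_PE[OF assms(6) conjunct1[OF spec[OF assms(8)]] conjunct2[OF spec[OF assms(8)]]])
  have dil: "f \<in> wavelet_space V (j - 1) \<longleftrightarrow> (\<lambda>x. f (2 powi (- j) * x)) \<in> V 0 \<and>
      (\<forall>k. L2_inner (\<lambda>x. f (2 powi (- j) * x)) (half_translates k) = 0)" for f
    using wavelet_space_dilate[OF mra, of f "j - 1" "- j"] wavelet_space_iff_orthogonal[OF mra refl] by simp
  have samples: "wavelet_samples (j - 1) f = (\<lambda>k. f ((2 * of_int k + 1) / 2 powi j))" for f
    unfolding wavelet_samples_def by (simp add: fun_eq_iff power_int_diff add_divide_distrib mult.commute)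
  have point: "(2 * of_int k + 1) / 2 powi j = (2 :: real) powi (- j) * of_int (2 * k + 1)" for k :: int
    by (simp add: power_int_minus field_simps)
  obtain g where g: "g \<in> V 0" "\<And>k. L2_inner g (half_translates k) = 0"
    "\<And>k::int. g (of_int (2 * k + 1)) = F k"
    using odd_interpolation_exists[OF assms(9)] by blast
  define f where "f = (\<lambda>x. g (2 powi j * x))"
  have fg: "(\<lambda>x. f (2 powi (- j) * x)) = g"
    unfolding f_def by (simp add: power_int_minus mult.assoc[symmetric])
  show ?thesis
    unfolding samples
  proof (rule ex1I[of _ f], intro conjI refl)
    show "f \<in> wavelet_space V (j - 1)" unfolding dil fg using g by blast
    show "(\<lambda>k. f ((2 * of_int k + 1) / 2 powi j)) = F"
      unfolding point using g(3) fun_cong[OF fg] by (simp only:)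
  next
    fix h assume "h \<in> wavelet_space V (j - 1) \<and>
      (\<lambda>k. h ((2 * of_int k + 1) / 2 powi j)) = (\<lambda>k. h ((2 * of_int k + 1) / 2 powi j)) \<and>
      (\<lambda>k. h ((2 * of_int k + 1) / 2 powi j)) = F"
    then have h: "(\<lambda>x. h (2 powi (- j) * x)) \<in> V 0"
      "\<And>k. L2_inner (\<lambda>x. h (2 powi (- j) * x)) (half_translates k) = 0"
      "\<And>k. h (2 powi (- j) * of_int (2 * k + 1)) = F k"
      unfolding dil point by (auto simp only:)
    have "(\<lambda>x. h (2 powi (- j) * x) - g x) = (\<lambda>x. 0)"
    proof (rule odd_interpolation_unique)
      show "(\<lambda>x. h (2 powi (- j) * x) - g x) \<in> V 0" by (rule rkhs_diff[OF V h(1) g(1)])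
      show "L2_inner (\<lambda>x. h (2 powi (- j) * x) - g x) (half_translates k) = 0" for k
        using L2_inner_diff_left[OF rkhs_L2[OF V h(1)] rkhs_L2[OF V g(1)] half_translates_L2] h(2) g(2) by simp
      show "h (2 powi (- j) * of_int (2 * k + 1)) - g (of_int (2 * k + 1)) = 0" for k :: int
        unfolding h(3) g(3) by simp
    qed
    then have "h (2 powi (- j) * x) = g x" for x by (metis eq_iff_diff_eq_0)
    from this[of "2 powi j * _"] show "h = f"
      unfolding f_def by (simp add: fun_eq_iff power_int_minus mult.assoc[symmetric])
  qed
qed


end
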